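(* Let $D_+$ be a link diagram with a chosen crossing $v$, and let $D_0$ (resp. $D_\infty$) be the diagram obtained from $D_+$ by the positive-marker (resp. negative-marker) smoothing of $v$. If $D_\infty$ is $H$-$(k_1(D_\infty),k_2(D_\infty))$-thick and $D_0$ is $H$-$(k_1(D_0),k_2(D_0))$-thick, then $D_+$ is $H$-$(k_1(D_+),k_2(D_+))$-thick, where $$k_1(D_+)=\max\Big(k_1(D_\infty)+\tfrac12\big(|s_+(D_\infty)|-|s_+(D_+)|+1\big),\ k_1(D_0)\Big),$$ $$k_2(D_+)=\max\Big(k_2(D_\infty),\ k_2(D_0)+\tfrac12\big(|s_-(D_0)|-|s_-(D_+)|+1\big)\Big).$$ In particular: (i) if $|s_+(D_+)|-|s_+(D_\infty)|=1$, as is always the case when $D_+$ is $+$-adequate, then $k_1(D_+)=\max(k_1(D_\infty),k_1(D_0))$; (ii) if $|s_-(D_+)|-|s_-(D_0)|=1$, as is always the case when $D_+$ is $-$-adequate, then $k_2(D_+)=\max(k_2(D_\infty),k_2(D_0))$.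
   Context: Diagrams: diagrams are in the plane (disc), of unoriented framed links, with ordered crossings. At each crossing there are two smoothings: the positive-marker smoothing ($A$-smoothing) joins the two local regions swept out when the overcrossing arc is rotated counterclockwise until it meets the undercrossing arc; the negative-marker smoothing joins the other two regions. A Kauffman state $s$ of $D$ assigns $+1$ or $-1$ (a positive or negative marker) to each crossing; $D_s$ is the system of circles obtained by smoothing all crossings according to $s$, $|s|$ is the number of circles of $D_s$, and $\sigma(s)$ is the number of positive minus the number of negative markers. $s_+=s_+(D)$ (resp. $s_-=s_-(D)$) is the state with all markers positive (resp. negative). $D$ is $+$-adequate (resp. $-$-adequate) if every crossing connects two different circles of $D_{s_+}$ (resp. $D_{s_-}$). Khovanov homology: an enhanced state $S$ is a Kauffman state $s$ with a sign $+$ or $-$ on each circle of $D_s$; put $\sigma(S)=\sigma(s)$ and $\tau(S)=\#\{\text{positive circles}\}-\#\{\text{negative circles}\}$. $\mathcal{C}_{i,j}(D)$ is the free abelian group on enhanced states with $\sigma(S)=i$ and $\sigma(S)+2\tau(S)=j$. The differential $d_{i,j}:\mathcal{C}_{i,j}(D)\to\mathcal{C}_{i-2,j}(D)$ is $d(S)=\sum_{S'}(-1)^{t(S:S')}[S:S']S'$, the sum over enhanced states $S'$ generating $\mathcal C_{i-2,j}(D)$, where $[S:S']=1$ if the markers of $S$ and $S'$ differ at exactly one crossing $v$ and all circles not touching $v$ have the same sign in $S$ and $S'$, and $[S:S']=0$ otherwise; $t(S:S')$ is the number of negative markers of $S$ at crossings bigger than $v$ in the ordering. $H_{i,j}(D)=\ker(d_{i,j})/\mathrm{im}(d_{i+2,j})$.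 Thickness: a diagram $D$ with $N$ crossings is $H$-$(k_1,k_2)$-thick if $H_{i,j}(D)=0$ with a possible exception of $i,j$ satisfying $N-2|s_-|-4k_2\le j-2i\le 2|s_+|-N+4k_1$. *)

theory Defs
  imports
    "HOL-Algebra.Free_Abelian_Groups"
    "HOL-Algebra.Elementary_Groups"
    "HOL-Combinatorics.Permutations"
    "HOL-Library.FuncSet"
    Complex_Main
begin

section \<open>Link diagrams\<close>

text \<open>
  A link diagram is given by its planar code, i.e. as a combinatorial map. The underlying plane graph
  has a vertex of degree four at each crossing, and it may have vertices of degree two, which are just
  marked points on arcs: a component without crossings is a cycle of such vertices, and smoothing
  a crossing replaces it by two of them. Every edge consists of two darts (half-edges), exchanged
  by \<open>edge\<close>; \<open>rot\<close> takes a dart to the next one counterclockwise around its vertex.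
  Crossings are named, and thereby ordered, by natural numbers; \<open>under D v\<close> is one of the two
  darts of the undercrossing arc at \<open>v\<close>. The framing is the blackboard framing.
\<close>

record diagram =
  darts :: "nat set"
  edge :: "nat \<Rightarrow> nat"
  rot :: "nat \<Rightarrow> nat"
  crossings :: "nat set"
  under :: "nat \<Rightarrow> nat"

text \<open>
  The darts at a crossing, counterclockwise: numbers 0 and 2 belong to the undercrossing arc,
  1 and 3 to the overcrossing arc.
\<close>

definition dart_at :: "diagram \<Rightarrow> nat \<Rightarrow> nat \<Rightarrow> nat" where
  "dart_at D v k = (rot D ^^ k) (under D v)"

definition darts_at :: "diagram \<Rightarrow> nat \<Rightarrow> nat set" where
  "darts_at D v = dart_at D v ` {0, 1, 2, 3}"

definition plain_darts :: "diagram \<Rightarrow> nat set" where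
  "plain_darts D = darts D - (\<Union>v\<in>crossings D. darts_at D v)"

definition graph_of :: "nat set \<Rightarrow> (nat \<Rightarrow> nat) \<Rightarrow> (nat \<times> nat) set" where
  "graph_of X f = {(x, f x) |x. x \<in> X}"

text \<open>
  The relation \<open>R\<close> is always a union of graphs of permutations of finite sets, so that its
  reflexive transitive closure is already symmetric.
\<close>

definition orbits :: "nat set \<Rightarrow> (nat \<times> nat) set \<Rightarrow> nat set set" where
  "orbits X R = X // R\<^sup>*"

text \<open>
  Planarity is Euler's formula, summed over the connected components of the graph. Since
  each component contributes at most 2 to the left-hand side, all of them have genus 0.
\<close>

definition planar :: "diagram \<Rightarrow> bool" where
  "planar D \<longleftrightarrow>
     int (card (orbits (darts D) (graph_of (darts D) (rot D))))
     - int (card (orbits (darts D) (graph_of (darts D) (edge D))))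
     + int (card (orbits (darts D) (graph_of (darts D) (rot D \<circ> edge D))))
     = 2 * int (card (orbits (darts D) (graph_of (darts D) (rot D) \<union> graph_of (darts D) (edge D))))"

definition link_diagram :: "diagram \<Rightarrow> bool" where
  "link_diagram D \<longleftrightarrow>
     finite (darts D) \<and> finite (crossings D) \<and>
     edge D permutes darts D \<and> (\<forall>x\<in>darts D. edge D x \<noteq> x \<and> edge D (edge D x) = x) \<and>
     rot D permutes darts D \<and>
     (\<forall>v\<in>crossings D. darts_at D v \<subseteq> darts D \<and> inj_on (dart_at D v) {0, 1, 2, 3} \<and>
        dart_at D v 4 = dart_at D v 0) \<and>
     (\<forall>v\<in>crossings D. \<forall>w\<in>crossings D. v \<noteq> w \<longrightarrow> darts_at D v \<inter> darts_at D w = {}) \<and>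
     (\<forall>x\<in>plain_darts D. rot D x \<noteq> x \<and> rot D (rot D x) = x) \<and>
     planar D"

section \<open>Smoothings and Kauffman states\<close>

text \<open>
  Rotated counterclockwise, the overcrossing arc, with darts 1 and 3, meets the undercrossing arc
  after sweeping out the region between darts 1 and 2 and the one between darts 3 and 0.
  Joining these two regions leaves an arc connecting darts 0 and 1 and an arc connecting
  darts 2 and 3. Joining the other two regions connects 1 with 2 and 3 with 0.
\<close>

definition smooth_rot :: "diagram \<Rightarrow> nat \<Rightarrow> int \<Rightarrow> nat \<Rightarrow> nat" where
  "smooth_rot D v m = (let a = dart_at D v in
     if m = 1 then (rot D)(a 0 := a 1, a 1 := a 0, a 2 := a 3, a 3 := a 2)
     else (rot D)(a 1 := a 2, a 2 := a 1, a 3 := a 0, a 0 := a 3))"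

definition smoothing :: "diagram \<Rightarrow> nat \<Rightarrow> int \<Rightarrow> diagram" where
  "smoothing D v m = D\<lparr>crossings := crossings D - {v}, rot := smooth_rot D v m\<rparr>"

definition states :: "diagram \<Rightarrow> (nat \<Rightarrow> int) set" where
  "states D = crossings D \<rightarrow>\<^sub>E {1, -1}"

text \<open>A circle is represented by the set of its darts.\<close>

definition circles :: "diagram \<Rightarrow> (nat \<Rightarrow> int) \<Rightarrow> nat set set" where
  "circles D s = orbits (darts D)
     (graph_of (darts D) (edge D) \<union> graph_of (plain_darts D) (rot D) \<union>
      (\<Union>v\<in>crossings D. graph_of (darts_at D v) (smooth_rot D v (s v))))"

definition touches :: "diagram \<Rightarrow> nat set \<Rightarrow> nat \<Rightarrow> bool" where
  "touches D C v \<longleftrightarrow> C \<inter> darts_at D v \<noteq> {}"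

definition splus :: "diagram \<Rightarrow> nat \<Rightarrow> int" where
  "splus D = (\<lambda>v\<in>crossings D. 1)"

definition sminus :: "diagram \<Rightarrow> nat \<Rightarrow> int" where
  "sminus D = (\<lambda>v\<in>crossings D. -1)"

definition num_circles :: "diagram \<Rightarrow> (nat \<Rightarrow> int) \<Rightarrow> int" where
  "num_circles D s = int (card (circles D s))"

definition adequate_state :: "diagram \<Rightarrow> (nat \<Rightarrow> int) \<Rightarrow> bool" where
  "adequate_state D s \<longleftrightarrow>
     (\<forall>v\<in>crossings D. \<exists>C\<in>circles D s. \<exists>C'\<in>circles D s. C \<noteq> C' \<and> touches D C v \<and> touches D C' v)"

definition plus_adequate :: "diagram \<Rightarrow> bool" where
  "plus_adequate D \<longleftrightarrow> adequate_state D (splus D)"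

definition minus_adequate :: "diagram \<Rightarrow> bool" where
  "minus_adequate D \<longleftrightarrow> adequate_state D (sminus D)"

section \<open>Khovanov homology\<close>

type_synonym enhanced_state = "(nat \<Rightarrow> int) \<times> (nat set \<Rightarrow> int)"

definition enhanced_states :: "diagram \<Rightarrow> enhanced_state set" where
  "enhanced_states D = (SIGMA s:states D. circles D s \<rightarrow>\<^sub>E {1, -1})"

definition sigma :: "diagram \<Rightarrow> enhanced_state \<Rightarrow> int" where
  "sigma D S = int (card {v \<in> crossings D. fst S v = 1}) - int (card {v \<in> crossings D. fst S v = -1})"

definition tau :: "diagram \<Rightarrow> enhanced_state \<Rightarrow> int" where
  "tau D S = int (card {C \<in> circles D (fst S). snd S C = 1})
           - int (card {C \<in> circles D (fst S). snd S C = -1})"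

definition gens :: "diagram \<Rightarrow> int \<Rightarrow> int \<Rightarrow> enhanced_state set" where
  "gens D i j = {S \<in> enhanced_states D. sigma D S = i \<and> sigma D S + 2 * tau D S = j}"

definition chain_gp :: "diagram \<Rightarrow> int \<Rightarrow> int \<Rightarrow> (enhanced_state \<Rightarrow>\<^sub>0 int) monoid" where
  "chain_gp D i j = free_Abelian_group (gens D i j)"

definition differ_only_at :: "diagram \<Rightarrow> enhanced_state \<Rightarrow> enhanced_state \<Rightarrow> nat \<Rightarrow> bool" where
  "differ_only_at D S S' v \<longleftrightarrow> v \<in> crossings D \<and> fst S v \<noteq> fst S' v \<and>
     (\<forall>w\<in>crossings D - {v}. fst S w = fst S' w)"

text \<open>
  The circles that do not touch the crossing \<open>v\<close> are the same for both states.
\<close>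

definition incidence :: "diagram \<Rightarrow> enhanced_state \<Rightarrow> enhanced_state \<Rightarrow> int" where
  "incidence D S S' =
     (if \<exists>v. differ_only_at D S S' v \<and>
             (\<forall>C\<in>circles D (fst S). \<not> touches D C v \<longrightarrow> snd S C = snd S' C)
      then 1 else 0)"

definition sign_exp :: "diagram \<Rightarrow> enhanced_state \<Rightarrow> enhanced_state \<Rightarrow> nat" where
  "sign_exp D S S' =
     card {w \<in> crossings D. fst S w = -1 \<and> (\<exists>v. differ_only_at D S S' v \<and> v < w)}"

definition differential ::
  "diagram \<Rightarrow> int \<Rightarrow> int \<Rightarrow> (enhanced_state \<Rightarrow>\<^sub>0 int) \<Rightarrow> (enhanced_state \<Rightarrow>\<^sub>0 int)" where
  "differential D i j = frag_extend (\<lambda>S. \<Sum>S'\<in>gens D (i - 2) j.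
     frag_cmul ((-1) ^ sign_exp D S S' * incidence D S S') (frag_of S'))"

definition homology :: "diagram \<Rightarrow> int \<Rightarrow> int \<Rightarrow> (enhanced_state \<Rightarrow>\<^sub>0 int) set monoid" where
  "homology D i j =
     subgroup_generated (chain_gp D i j)
       (kernel (chain_gp D i j) (chain_gp D (i - 2) j) (differential D i j))
     Mod (differential D (i + 2) j ` carrier (chain_gp D (i + 2) j))"

text \<open>
  The thickness parameters are arbitrary real numbers, so no integrality is presupposed in the
  formulas containing a factor 1/2.
\<close>

definition H_thick :: "diagram \<Rightarrow> real \<Rightarrow> real \<Rightarrow> bool" where
  "H_thick D k1 k2 \<longleftrightarrow> (\<forall>i j.
     \<not> (real (card (crossings D)) - 2 * num_circles D (sminus D) - 4 * k2 \<le> j - 2 * i \<and>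
        j - 2 * i \<le> 2 * num_circles D (splus D) - real (card (crossings D)) + 4 * k1)
     \<longrightarrow> trivial_group (homology D i j))"

end

theory Submission
  imports Defs "HOL-Combinatorics.Orbits"
begin

text \<open>
  The states with a negative marker at \<open>v\<close> span a subcomplex of the Khovanov complex of \<open>Dp\<close>, which
  is the complex of \<open>Dinf\<close> up to signs and a shift; the quotient is the complex of \<open>D0\<close>. Hence
  $H_{i+1,j+1}(D_\infty) \to H_{i,j}(D_+) \to H_{i-1,j-1}(D_0)$ is exact in the middle, and the
  thickness bounds follow by comparing degrees.

  Exactness needs $d^2 = 0$, which fails for non-planar diagrams: there the change of one marker may
  turn one circle into one circle. Planarity is used as follows. Resolving a crossing composes the
  rotation with a transposition, which splits or merges orbits; following the numbers of vertices,
  faces and components through the resolution of all crossings shows that genus 0 forces an orientation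
  of the darts that alternates around each crossing. All circles of all states are then oriented
  coherently, so a change of marker acts on them by a transposition and merges two circles or splits
  one. For two crossings, both orders of changing the markers lead to the same number of
  intermediate enhanced states, because this number depends only on the first and the last state.
\<close>

section \<open>Orbits of permutations and transpositions\<close>

text \<open>The two smoothings of a crossing differ by a product of two transpositions, of darts 0,
  2 and of darts 1, 3, while a circle is an orbit of two involutions and not the cycle of a
  permutation. This is why unoriented circles are out of control. An alternating orientation cures
  both defects: on the darts of one orientation a circle is a single cycle of the rotation after the
  edge involution, and only one of the two transpositions moves these darts. Composition with one
  transposition always changes the number of cycles by one.

  Origin of the correction terms: a marker m at \<open>v\<close> adds m to sigma and nothing to tau,
  so passing from the smoothing to the full diagram moves (i, j) by (m, m) and j - 2i by -m, while
  the number N of crossings grows by one. In the bound that involves the extreme state with marker m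
  these two effects cancel, and the number of circles is unchanged. In the other bound they add up
  to 2; with twice the difference of the circle numbers, and divided by the factor 4 in front of the
  thickness parameter, this is half of (difference + 1).\<close>

definition link :: "('a \<times> 'a) set \<Rightarrow> 'a \<Rightarrow> 'a \<Rightarrow> ('a \<times> 'a) set" where
  "link E x y = E \<union> {(a, b). (a, x) \<in> E \<and> (y, b) \<in> E \<or> (a, y) \<in> E \<and> (x, b) \<in> E}"

lemma sym_rtranclI: "(\<And>x y. (x, y) \<in> R \<Longrightarrow> (y, x) \<in> R\<^sup>*) \<Longrightarrow> sym (R\<^sup>*)"
proof (rule symI)
  fix x y assume R: "\<And>x y. (x, y) \<in> R \<Longrightarrow> (y, x) \<in> R\<^sup>*" and "(x, y) \<in> R\<^sup>*"
  from this(2) show "(y, x) \<in> R\<^sup>*"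
    by (induction rule: rtrancl_induct) (auto dest: R intro: rtrancl_trans)
qed

text \<open>For an equivalence \<open>E\<close>, \<open>link E x y\<close> is the equivalence that
  fuses the classes of \<open>x\<close> and \<open>y\<close>: a chain needs the new identification
  at most once. Being closed under composition, it can be compared with \<open>S\<close> step by
  step.\<close>

lemma rtrancl_eq_linkI:
  assumes sym: "sym (R\<^sup>*)"
    and S: "\<And>a b. (a, b) \<in> S \<Longrightarrow> (a, b) \<in> link (R\<^sup>*) x y"
    and R: "\<And>a b. (a, b) \<in> R \<Longrightarrow> (a, b) \<in> S\<^sup>*" and xy: "(x, y) \<in> S\<^sup>*" "(y, x) \<in> S\<^sup>*"
  shows "S\<^sup>* = link (R\<^sup>*) x y"
proof
  have RS: "R\<^sup>* \<subseteq> S\<^sup>*" using R by (metis rtrancl_subset_rtrancl subrelI)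
  show "link (R\<^sup>*) x y \<subseteq> S\<^sup>*"
    unfolding link_def using RS xy by (blast intro: rtrancl_trans)
  show "S\<^sup>* \<subseteq> link (R\<^sup>*) x y"
  proof
    fix p assume "p \<in> S\<^sup>*"
    then obtain a b where p: "p = (a, b)" and ab: "(a, b) \<in> S\<^sup>*" by (cases p) auto
    from ab have "(a, b) \<in> link (R\<^sup>*) x y"
    proof (induction rule: rtrancl_induct)
      case base show ?case by (simp add: link_def)
    next
      case (step b c)
      have t: "trans (R\<^sup>*)" by (rule trans_rtrancl)
      from step.IH S[OF step.hyps(2)] show ?case
        unfolding link_def using t sym by (auto dest: transD symD intro: rtrancl_trans)
    qed
    with p show "p \<in> link (R\<^sup>*) x y" by simp
  qed
qed

lemma link_same:
  assumes "sym (R\<^sup>*)" "(x, y) \<in> R\<^sup>*"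
  shows "link (R\<^sup>*) x y = R\<^sup>*"
  unfolding link_def using assms by (auto intro: rtrancl_trans dest: symD)

lemma quotient_link:
  assumes sym: "sym E" and tr: "trans E" and refl: "refl E" and xy: "(x, y) \<notin> E" "x \<in> X" "y \<in> X"
  shows "X // link E x y = X // E - {E `` {x}, E `` {y}} \<union> {E `` {x} \<union> E `` {y}}"
    and "E `` {x} \<noteq> E `` {y}"
proof -
  have xx: "(a, a) \<in> E" for a using refl by (auto dest: refl_onD)
  have cl: "link E x y `` {a} = (if a \<in> E `` {x} \<union> E `` {y} then E `` {x} \<union> E `` {y} else E `` {a})" for a
    using sym tr xx unfolding link_def by (auto dest: symD transD)
  have ne: "E `` {a} \<noteq> E `` {x}" "E `` {a} \<noteq> E `` {y}" if "a \<notin> E `` {x} \<union> E `` {y}" for a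
    using that xx by blast+
  have eq: "E `` {a} = E `` {x}" if "a \<in> E `` {x}" for a
    using that sym tr by (auto dest: symD transD)
  have eq': "E `` {a} = E `` {y}" if "a \<in> E `` {y}" for a
    using that sym tr by (auto dest: symD transD)
  show "E `` {x} \<noteq> E `` {y}" using xy xx by auto
  show "X // link E x y = X // E - {E `` {x}, E `` {y}} \<union> {E `` {x} \<union> E `` {y}}" (is "?L = ?R")
  proof
    show "?L \<subseteq> ?R"
    proof
      fix Q assume "Q \<in> ?L"
      then obtain a where a: "a \<in> X" "Q = link E x y `` {a}" by (auto elim: quotientE)
      then show "Q \<in> ?R" using ne[of a] by (auto simp: cl intro: quotientI)
    qed
    have "E `` {x} \<union> E `` {y} \<in> ?L" using quotientI[of x X "link E x y"] xy(2) xx by (simp add: cl)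
    moreover have "E `` {a} \<in> ?L" if "a \<in> X" "E `` {a} \<noteq> E `` {x}" "E `` {a} \<noteq> E `` {y}" for a
    proof -
      have "a \<notin> E `` {x} \<union> E `` {y}" using that eq eq' by blast
      then show ?thesis using quotientI[of a X "link E x y"] that(1) by (simp add: cl)
    qed
    ultimately show "?R \<subseteq> ?L" by (auto elim!: quotientE)
  qed
qed

lemma card_quotient_link:
  assumes "finite X" "sym E" "trans E" "refl E" "(x, y) \<notin> E" "x \<in> X" "y \<in> X"
  shows "card (X // E) = Suc (card (X // link E x y))"
proof -
  have fin: "finite (X // E)" using assms(1) unfolding quotient_def by simp
  note q = quotient_link[OF assms(2-7)]
  have in1: "{E `` {x}, E `` {y}} \<subseteq> X // E" using assms by (auto intro: quotientI)
  \<comment> \<open>If the union were already one of the remaining classes, the count would drop by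
    two.\<close>
  have "E `` {x} \<union> E `` {y} \<notin> X // E - {E `` {x}, E `` {y}}"
  proof
    assume a: "E `` {x} \<union> E `` {y} \<in> X // E - {E `` {x}, E `` {y}}"
    then obtain z where z: "E `` {x} \<union> E `` {y} = E `` {z}" by (auto elim!: quotientE)
    have "x \<in> E `` {z}" "y \<in> E `` {z}" using z assms(4) by (auto dest: refl_onD)
    then have "(x, y) \<in> E" using assms(2,3) by (auto dest: symD transD)
    then show False using assms(5) by simp
  qed
  then have "card (X // link E x y) = Suc (card (X // E - {E `` {x}, E `` {y}}))"
    unfolding q(1) using fin by simp
  also have "card (X // E - {E `` {x}, E `` {y}}) = card (X // E) - 2"
    using in1 q(2) by (subst card_Diff_subset) auto
  finally show ?thesis using card_mono[OF fin in1] q(2) by simp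
qed

lemma funpow_in_orbit_rel:
  assumes "p permutes X" "x \<in> X"
  shows "(p ^^ n) x \<in> X \<and> (x, (p ^^ n) x) \<in> (graph_of X p)\<^sup>*"
proof (induction n)
  case 0 show ?case using assms by simp
next
  case (Suc n)
  then have "((p ^^ n) x, p ((p ^^ n) x)) \<in> graph_of X p" by (auto simp: graph_of_def)
  with Suc show ?case using permutes_in_image[OF assms(1)] by (auto intro: rtrancl_into_rtrancl)
qed

lemma permutes_funpow_cycle:
  assumes "p permutes X" "finite X"
  obtains n where "0 < n" "(p ^^ n) x = x"
proof -
  have "permutation p" using assms permutation_permutes by blast
  then have "x \<in> orbit p x" by (rule permutation_self_in_orbit)
  then show ?thesis using that unfolding orbit_altdef by auto
qed

text \<open>On a finite set the inverse of a permutation step is an iterate of the permutation, so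
  chains of steps can be reversed.\<close>

lemma sym_orbit_rel:
  assumes "p permutes X" "finite X"
  shows "sym ((graph_of X p)\<^sup>*)"
proof (rule sym_rtranclI)
  fix x y assume "(x, y) \<in> graph_of X p"
  then have x: "x \<in> X" and y: "y = p x" by (auto simp: graph_of_def)
  obtain n where n: "0 < n" "(p ^^ n) x = x" using permutes_funpow_cycle[OF assms] .
  then obtain m where "n = Suc m" by (cases n) auto
  then have "x = (p ^^ m) y" using n y by (simp add: funpow_swap1)
  moreover have "y \<in> X" using x y permutes_in_image[OF assms(1)] by simp
  ultimately show "(y, x) \<in> (graph_of X p)\<^sup>*" using funpow_in_orbit_rel[OF assms(1)] by metis
qed

lemma orbit_rel_funpow:
  assumes "(x, y) \<in> (graph_of X p)\<^sup>*"
  shows "\<exists>n. y = (p ^^ n) x"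
  using assms
proof (induction rule: rtrancl_induct)
  case base show ?case by (rule exI[of _ 0]) simp
next
  case (step y z)
  then obtain n where "y = (p ^^ n) x" by blast
  then have "z = (p ^^ Suc n) x" using step.hyps(2) by (auto simp: graph_of_def)
  then show ?case by blast
qed

text \<open>The segment of the orbit of \<open>x\<close> up to its first return to \<open>{x, y}\<close> is followed by both
  permutations.\<close>

lemma transposed_orbit_segment:
  assumes p: "p permutes X" and fin: "finite X" and xy: "x \<noteq> y" "x \<in> X" "y \<in> X"
    and q: "q = transpose x y \<circ> p"
  obtains n where "0 < n" "(p ^^ n) x \<in> {x, y}" "\<And>i. i < n \<Longrightarrow> (q ^^ i) x = (p ^^ i) x"
    "\<And>i. 0 < i \<Longrightarrow> i < n \<Longrightarrow> (p ^^ i) x \<notin> {x, y}"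
proof -
  obtain k where "0 < k" "(p ^^ k) x = x" using permutes_funpow_cycle[OF p fin] .
  then have ex: "\<exists>n. 0 < n \<and> (p ^^ n) x \<in> {x, y}" by blast
  define n where "n = (LEAST n. 0 < n \<and> (p ^^ n) x \<in> {x, y})"
  have n: "0 < n" "(p ^^ n) x \<in> {x, y}" using LeastI_ex[OF ex] unfolding n_def by auto
  have lt: "(p ^^ i) x \<notin> {x, y}" if "0 < i" "i < n" for i
    using not_less_Least[of i "\<lambda>n. 0 < n \<and> (p ^^ n) x \<in> {x, y}"] that unfolding n_def by auto
  have "(q ^^ i) x = (p ^^ i) x" if "i < n" for i
    using that
  proof (induction i)
    case (Suc i)
    then have "(q ^^ i) x = (p ^^ i) x" by simp
    then have "(q ^^ Suc i) x = transpose x y ((p ^^ Suc i) x)" by (simp add: q o_def)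
    with lt[of "Suc i"] Suc.prems show ?case by (simp add: transpose_apply_other del: funpow.simps)
  qed simp
  with n lt that show ?thesis by blast
qed

text \<open>\<open>q\<close> follows \<open>p\<close> from \<open>x\<close> until \<open>p\<close>
  would reach \<open>y\<close>, and returns to \<open>x\<close> instead. This arc \<open>Z\<close>
  is closed under \<open>q\<close> and misses \<open>y\<close>.\<close>

lemma transpose_splits_orbit:
  assumes p: "p permutes X" and fin: "finite X" and xy: "x \<noteq> y" "x \<in> X" "y \<in> X"
    and q: "q = transpose x y \<circ> p" and con: "(x, y) \<in> (graph_of X p)\<^sup>*"
  shows "(x, y) \<notin> (graph_of X q)\<^sup>*"
proof
  assume "(x, y) \<in> (graph_of X q)\<^sup>*"
  obtain n where n: "0 < n" "(p ^^ n) x \<in> {x, y}" "\<And>i. i < n \<Longrightarrow> (q ^^ i) x = (p ^^ i) x"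
    "\<And>i. 0 < i \<Longrightarrow> i < n \<Longrightarrow> (p ^^ i) x \<notin> {x, y}"
    by (rule transposed_orbit_segment[OF p fin xy q]) blast
  obtain m where m: "n = Suc m" using n(1) by (cases n) auto
  define Z where "Z = (\<lambda>i. (p ^^ i) x) ` {..<n}"
  have yZ: "y \<notin> Z"
  proof
    assume "y \<in> Z"
    then obtain i where i: "i < n" "y = (p ^^ i) x" by (auto simp: Z_def)
    then show False using n(4)[of i] xy(1) by (cases i) auto
  qed
  \<comment> \<open>If \<open>p\<close> came back to \<open>x\<close> first, the whole cycle of
    \<open>x\<close> would be \<open>Z\<close>, which does not contain \<open>y\<close>.\<close>
  have py: "(p ^^ n) x = y"
  proof (rule ccontr)
    assume "(p ^^ n) x \<noteq> y"
    then have px: "(p ^^ n) x = x" using n(2) by blast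
    obtain k where "y = (p ^^ k) x" using orbit_rel_funpow[OF con] by blast
    also have "\<dots> = (p ^^ (k mod n)) x" using px by (simp add: funpow_mod_eq)
    finally have "y \<in> Z" using n(1) by (auto simp: Z_def)
    with yZ show False by simp
  qed
  have Zq: "q z \<in> Z" if z: "z \<in> Z" for z
  proof -
    obtain i where i: "i < n" "z = (p ^^ i) x" using z by (auto simp: Z_def)
    show ?thesis
    proof (cases "Suc i < n")
      case True
      have "q z = (q ^^ Suc i) x" using i n(3)[of i] by simp
      also have "\<dots> = (p ^^ Suc i) x" using n(3)[OF True] .
      finally show ?thesis using True unfolding Z_def by blast
    next
      case False
      then have "Suc i = n" using i by simp
      then have "q z = transpose x y y" using i py by (auto simp: q)
      then have "q z = (p ^^ 0) x" by simp
      then show ?thesis using n(1) unfolding Z_def by blast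
    qed
  qed
  have "x \<in> Z" unfolding Z_def using n(1) by (auto intro!: image_eqI[of _ _ 0])
  with \<open>(x, y) \<in> (graph_of X q)\<^sup>*\<close> have "y \<in> Z"
    by (induction rule: rtrancl_induct) (auto simp: graph_of_def Zq)
  with yZ show False by simp
qed

text \<open>\<open>q\<close> runs through the \<open>p\<close>-cycle of \<open>x\<close> until
  \<open>p\<close> would return to \<open>x\<close>, and is redirected to \<open>y\<close> there.
  All steps of \<open>p\<close> and \<open>q\<close> agree up to an exchange of \<open>x\<close> and
  \<open>y\<close>, so nothing else is identified.\<close>

lemma transpose_merges_orbits:
  assumes p: "p permutes X" and fin: "finite X" and xy: "x \<noteq> y" "x \<in> X" "y \<in> X"
    and q: "q = transpose x y \<circ> p" and con: "(x, y) \<notin> (graph_of X p)\<^sup>*"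
  shows "(graph_of X q)\<^sup>* = link ((graph_of X p)\<^sup>*) x y"
proof -
  have qX: "q permutes X" using p xy unfolding q by (auto intro: permutes_compose permutes_swap_id)
  have symq: "sym ((graph_of X q)\<^sup>*)" by (rule sym_orbit_rel[OF qX fin])
  have symp: "sym ((graph_of X p)\<^sup>*)" by (rule sym_orbit_rel[OF p fin])
  obtain n where n: "0 < n" "(p ^^ n) x \<in> {x, y}" "\<And>i. i < n \<Longrightarrow> (q ^^ i) x = (p ^^ i) x"
    by (rule transposed_orbit_segment[OF p fin xy q]) blast
  have px: "(p ^^ n) x = x" using n(2) funpow_in_orbit_rel[OF p xy(2), of n] con by auto
  obtain m where m: "n = Suc m" using n(1) by (cases n) auto
  have "(q ^^ n) x = transpose x y ((p ^^ n) x)" using n(3)[of m] by (simp add: m q)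
  then have "(q ^^ n) x = y" using px by simp
  then have xyq: "(x, y) \<in> (graph_of X q)\<^sup>*" using funpow_in_orbit_rel[OF qX xy(2), of n] by simp
  show ?thesis
  proof (rule rtrancl_eq_linkI[OF symp])
    fix a b assume "(a, b) \<in> graph_of X q"
    then have a: "a \<in> X" "b = transpose x y (p a)" by (auto simp: graph_of_def q)
    then have "(a, p a) \<in> (graph_of X p)\<^sup>*" by (auto simp: graph_of_def)
    then show "(a, b) \<in> link ((graph_of X p)\<^sup>*) x y"
      unfolding a(2) transpose_def link_def by auto
  next
    fix a b assume "(a, b) \<in> graph_of X p"
    then have a: "a \<in> X" "b = p a" by (auto simp: graph_of_def)
    then have "(a, transpose x y b) \<in> (graph_of X q)\<^sup>*" by (auto simp: graph_of_def q)
    moreover have "(transpose x y b, b) \<in> (graph_of X q)\<^sup>*"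
      using xyq symq unfolding transpose_def by (auto dest: symD)
    ultimately show "(a, b) \<in> (graph_of X q)\<^sup>*" by (rule rtrancl_trans)
  qed (use xyq symq in \<open>auto dest: symD\<close>)
qed

text \<open>Two fixed-point free involutions \<open>f\<close>, \<open>g\<close> generate a dihedral action: each of its
  orbits is the union of two orbits of \<open>g \<circ> f\<close>, which are exchanged by \<open>f\<close>.\<close>

locale involution_pair =
  fixes X :: "nat set" and f g :: "nat \<Rightarrow> nat"
  assumes fin: "finite X" and f: "f permutes X" and g: "g permutes X"
    and f_inv: "x \<in> X \<Longrightarrow> f (f x) = x" and f_fpf: "x \<in> X \<Longrightarrow> f x \<noteq> x"
    and g_inv: "x \<in> X \<Longrightarrow> g (g x) = x" and g_fpf: "x \<in> X \<Longrightarrow> g x \<noteq> x"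
begin

abbreviation rotation ("P") where "P \<equiv> (graph_of X (g \<circ> f))\<^sup>*"
abbreviation dihedral ("C") where "C \<equiv> (graph_of X g \<union> graph_of X f)\<^sup>*"

lemma f_in: "f x \<in> X \<longleftrightarrow> x \<in> X" and g_in: "g x \<in> X \<longleftrightarrow> x \<in> X"
  using permutes_in_image[OF f] permutes_in_image[OF g] by simp_all

lemma gf_permutes: "g \<circ> f permutes X"
  by (rule permutes_compose[OF f g])

lemma sym_P: "sym P"
  by (rule sym_orbit_rel[OF gf_permutes fin])

lemma sym_C: "sym C"
  by (rule sym_rtranclI) (auto simp: graph_of_def f_in g_in f_inv g_inv intro!: r_into_rtrancl)

lemma P_subset_C: "P \<subseteq> C"
proof -
  have "(a, b) \<in> C" if "(a, b) \<in> graph_of X (g \<circ> f)" for a b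
  proof -
    from that have "(a, f a) \<in> graph_of X f" "(f a, b) \<in> graph_of X g" by (auto simp: graph_of_def f_in)
    then show ?thesis by (meson UnI1 UnI2 r_into_rtrancl rtrancl_trans)
  qed
  then show ?thesis by (metis rtrancl_subset_rtrancl subrelI)
qed

text \<open>\<open>f\<close> conjugates \<open>g \<circ> f\<close> to \<open>f \<circ> g\<close>,
  which is its inverse on \<open>X\<close>; a forward step becomes a backward one.\<close>

lemma P_flip:
  assumes "(a, b) \<in> P" "a \<in> X"
  shows "(f a, f b) \<in> P"
  using assms(1)
proof (induction rule: rtrancl_induct)
  case (step b c)
  then have b: "b \<in> X" "c = g (f b)" by (auto simp: graph_of_def)
  have "(f c, f b) \<in> graph_of X (g \<circ> f)" using b f_inv g_inv g_in f_in by (auto simp: graph_of_def)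
  then have "(f b, f c) \<in> P" using sym_P by (auto dest: symD)
  with step.IH show ?case by (rule rtrancl_trans)
qed simp

text \<open>Applying \<open>f\<close> and then either involution is a rotation or the identity, so
  along a chain only the parity of the number of steps matters.\<close>

lemma C_cases:
  assumes "(a, b) \<in> C" "a \<in> X"
  shows "(a, b) \<in> P \<or> (f a, b) \<in> P"
  using assms(1)
proof (induction rule: rtrancl_induct)
  case (step b c)
  have bX: "b \<in> X" using step.hyps(2) by (auto simp: graph_of_def)
  have flipped: "(f b, c) \<in> P"
  proof -
    from step.hyps(2) consider "c = g b" | "c = f b" by (auto simp: graph_of_def)
    then show ?thesis
    proof cases
      case 1
      then have "(f b, c) \<in> graph_of X (g \<circ> f)" using bX f_in f_inv by (auto simp: graph_of_def)
      then show ?thesis by auto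
    qed simp
  qed
  have ffa: "f (f a) = a" by (rule f_inv[OF assms(2)])
  from step.IH show ?case
  proof
    assume "(a, b) \<in> P"
    then have "(f a, f b) \<in> P" by (rule P_flip[OF _ assms(2)])
    then show ?thesis using flipped by (blast intro: rtrancl_trans)
  next
    assume "(f a, b) \<in> P"
    then have "(f (f a), f b) \<in> P" by (rule P_flip) (use assms(2) f_in in simp)
    then have "(f (f a), c) \<in> P" using flipped by (rule rtrancl_trans)
    then show ?thesis by (simp only: ffa simp_thms)
  qed
qed simp

text \<open>If \<open>f x\<close> were the \<open>k\<close>-th iterate of \<open>x\<close>, then
  \<open>f\<close> would reflect the segment of iterates from 0 to \<open>k\<close>. The middle of
  the segment gives a fixed point of \<open>f\<close> for even \<open>k\<close>, and of
  \<open>g\<close> for odd \<open>k\<close>.\<close>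

lemma not_P_flip:
  assumes x: "x \<in> X"
  shows "(x, f x) \<notin> P"
proof
  assume "(x, f x) \<in> P"
  then obtain k where k: "f x = ((g \<circ> f) ^^ k) x" using orbit_rel_funpow by blast
  define h where "h = g \<circ> f"
  have h: "h z = g (f z)" for z by (simp add: h_def)
  have inX: "(h ^^ i) x \<in> X" for i using funpow_in_orbit_rel[OF gf_permutes x] by (simp only: h_def)
  have ret: "f ((h ^^ i) x) = (h ^^ (k - i)) x" if "i \<le> k" for i
    using that
  proof (induction i)
    case 0 show ?case using k by (simp only: h_def funpow_0 diff_zero)
  next
    case (Suc i)
    let ?z = "(h ^^ i) x"
    let ?u = "(h ^^ (k - Suc i)) x"
    have "k - i = Suc (k - Suc i)" using Suc.prems by simp
    then have "f ?z = h ?u" using Suc by simp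
    then have "f ?z = g (f ?u)" using h by metis
    then have "g (f ?z) = f ?u" using g_inv f_in inX by metis
    then have "f (g (f ?z)) = ?u" using f_inv inX by metis
    then have "f (h ?z) = ?u" using h by metis
    then show ?case by simp
  qed
  show False
  proof (cases "even k")
    case True
    then obtain m where "k = m + m" by (metis mult_2 evenE)
    then have "f ((h ^^ m) x) = (h ^^ m) x" using ret[of m] by simp
    then show False using f_fpf[OF inX] by blast
  next
    case False
    then obtain m where m: "k = Suc (m + m)" by (metis mult_2 oddE Suc_eq_plus1)
    then have "f ((h ^^ m) x) = (h ^^ Suc m) x" using ret[of m] by (simp add: Suc_diff_le)
    then have "f ((h ^^ m) x) = h ((h ^^ m) x)" by simp
    then have "f ((h ^^ m) x) = g (f ((h ^^ m) x))" using h by metis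
    then show False using g_fpf f_in inX by metis
  qed
qed

text \<open>In each dihedral orbit \<open>e\<close> singles out the rotation orbit of a chosen
  representative; \<open>f\<close> and \<open>g\<close> both exchange it with the other one.\<close>

lemma ex_alternating:
  obtains e :: "nat \<Rightarrow> bool" where "\<And>x. x \<in> X \<Longrightarrow> e (f x) \<noteq> e x" "\<And>x. x \<in> X \<Longrightarrow> e (g x) \<noteq> e x"
proof -
  \<comment> \<open>The choice depends on the class alone, so related elements get the same
    representative.\<close>
  define r where "r x = (SOME z. z \<in> C `` {x})" for x
  have r: "(x, r x) \<in> C" for x
  proof -
    have "r x \<in> C `` {x}" unfolding r_def by (rule someI[of _ x]) auto
    then show ?thesis by simp
  qed
  define e where "e x \<longleftrightarrow> (r x, x) \<in> P" for x
  have rX: "r x \<in> X" if "x \<in> X" for x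
    using r[of x] that by (induction rule: rtrancl_induct) (auto simp: graph_of_def f_in g_in)
  have r_eq: "r x = r y" if "(x, y) \<in> C" for x y
  proof -
    have "C `` {x} = C `` {y}" using that sym_C by (auto dest: symD intro: rtrancl_trans)
    then show ?thesis by (simp add: r_def)
  qed
  have ef: "e (f x) \<noteq> e x" if x: "x \<in> X" for x
  proof -
    have rr: "r (f x) = r x" using x f_in f_inv by (intro r_eq r_into_rtrancl) (auto simp: graph_of_def)
    have "(r x, x) \<in> C" using r[of x] sym_C by (auto dest: symD)
    then consider "(r x, x) \<in> P" | "(f (r x), x) \<in> P" using C_cases rX x by blast
    then show ?thesis
    proof cases
      case 1
      have "\<not> (r x, f x) \<in> P" using 1 sym_P not_P_flip[OF x] by (meson rtrancl_trans symD)
      then show ?thesis using 1 by (simp add: e_def rr)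
    next
      case 2
      then have "(r x, f x) \<in> P" using P_flip[OF 2] f_in f_inv rX x by auto
      moreover have "\<not> (r x, x) \<in> P"
        using calculation sym_P not_P_flip[OF x] by (meson rtrancl_trans symD)
      ultimately show ?thesis by (simp add: e_def rr)
    qed
  qed
  have eg: "e (g x) \<noteq> e x" if x: "x \<in> X" for x
  proof -
    \<comment> \<open>\<open>g x\<close> is one rotation step away from \<open>f x\<close>, so both
      have the same value.\<close>
    have st: "(f x, g x) \<in> P" using x f_in f_inv by (intro r_into_rtrancl) (auto simp: graph_of_def)
    have "r (g x) = r (f x)" using st P_subset_C r_eq by (metis subsetD)
    then have "e (g x) = e (f x)" unfolding e_def using st sym_P by (metis rtrancl_trans symD)
    then show ?thesis using ef[OF x] by simp
  qed
  show ?thesis using that ef eg by blast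
qed

text \<open>A dihedral orbit is covered by the rotation orbits of a representative and of its image
  under \<open>f\<close>. For a map without crossings this bounds the faces of a component by two,
  whence \<open>euler_defect\<close> is nonnegative.\<close>

lemma card_rotation_le: "card (X // P) \<le> 2 * card (X // C)"
proof -
  define r where "r K = (SOME z. z \<in> K)" for K :: "nat set"
  have fC: "finite (X // C)" using fin unfolding quotient_def by simp
  have "X // P \<subseteq> (\<Union>K\<in>X // C. {P `` {r K}, P `` {f (r K)}})"
  proof
    fix Q assume "Q \<in> X // P"
    then obtain x where x: "x \<in> X" "Q = P `` {x}" by (auto elim: quotientE)
    let ?K = "C `` {x}"
    have "r ?K \<in> ?K" unfolding r_def by (rule someI[of _ x]) auto
    then have rx: "(x, r ?K) \<in> C" by simp
    then have rX: "r ?K \<in> X" using x(1)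
      by (induction rule: rtrancl_induct) (auto simp: graph_of_def f_in g_in)
    have "(r ?K, x) \<in> C" using rx sym_C by (auto dest: symD)
    then have "(r ?K, x) \<in> P \<or> (f (r ?K), x) \<in> P" using C_cases rX by blast
    then have "Q = P `` {r ?K} \<or> Q = P `` {f (r ?K)}"
      unfolding x(2) using sym_P by (auto dest: symD intro: rtrancl_trans)
    then show "Q \<in> (\<Union>K\<in>X // C. {P `` {r K}, P `` {f (r K)}})"
      using x(1) by (auto intro: quotientI)
  qed
  then have "card (X // P) \<le> card (\<Union>K\<in>X // C. {P `` {r K}, P `` {f (r K)}})"
    by (intro card_mono) (use fC in auto)
  also have "\<dots> \<le> (\<Sum>K\<in>X // C. card {P `` {r K}, P `` {f (r K)}})" by (rule card_UN_le[OF fC])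
  also have "\<dots> \<le> (\<Sum>K\<in>X // C. 2)" by (intro sum_mono) (simp add: card_insert_if)
  finally show ?thesis by simp
qed

end

text \<open>Serves for edges and for vertices of degree two, whose contributions to Euler's formula
  cancel.\<close>

lemma card_orbits_involution:
  assumes "finite X" "f permutes X" "\<And>x. x \<in> X \<Longrightarrow> f (f x) = x" "\<And>x. x \<in> X \<Longrightarrow> f x \<noteq> x"
  shows "2 * card (X // (graph_of X f)\<^sup>*) = card X"
proof -
  have in_X: "f x \<in> X \<longleftrightarrow> x \<in> X" for x by (rule permutes_in_image[OF assms(2)])
  have cl: "(graph_of X f)\<^sup>* `` {x} = {x, f x}" if "x \<in> X" for x
  proof
    show "(graph_of X f)\<^sup>* `` {x} \<subseteq> {x, f x}"
    proof
      fix y assume "y \<in> (graph_of X f)\<^sup>* `` {x}"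
      then have "(x, y) \<in> (graph_of X f)\<^sup>*" by simp
      then show "y \<in> {x, f x}"
        by (induction rule: rtrancl_induct) (use that assms(3) in \<open>auto simp: graph_of_def\<close>)
    qed
    show "{x, f x} \<subseteq> (graph_of X f)\<^sup>* `` {x}" using that by (auto simp: graph_of_def intro: r_into_rtrancl)
  qed
  have q: "X // (graph_of X f)\<^sup>* = (\<lambda>x. {x, f x}) ` X"
    unfolding quotient_def using cl by auto
  have "2 * card ((\<lambda>x. {x, f x}) ` X) = card (\<Union>((\<lambda>x. {x, f x}) ` X))"
  proof (rule card_partition)
    fix c1 c2 assume c: "c1 \<in> (\<lambda>x. {x, f x}) ` X" "c2 \<in> (\<lambda>x. {x, f x}) ` X" "c1 \<noteq> c2"
    then obtain x y where "x \<in> X" "y \<in> X" "c1 = {x, f x}" "c2 = {y, f y}" by auto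
    with c(3) assms(3)[of x] assms(3)[of y] show "c1 \<inter> c2 = {}" by auto
  next
    show "card c = 2" if "c \<in> (\<lambda>x. {x, f x}) ` X" for c
    using that assms(4) by (auto simp: card_insert_if) metis
  qed (use assms in_X in auto)
  moreover have "\<Union>((\<lambda>x. {x, f x}) ` X) = X" using in_X by auto
  ultimately show ?thesis using q by simp
qed

section \<open>Planar diagrams are alternately orientable\<close>

text \<open>Planarity is split off from \<open>link_diagram\<close>: the other clauses pass to
  smoothings by direct checks, while the genus has to be followed by counting orbits.\<close>

definition diagram_map :: "diagram \<Rightarrow> bool" where
  "diagram_map D \<longleftrightarrow>
     finite (darts D) \<and> finite (crossings D) \<and>
     edge D permutes darts D \<and> (\<forall>x\<in>darts D. edge D x \<noteq> x \<and> edge D (edge D x) = x) \<and>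
     rot D permutes darts D \<and>
     (\<forall>v\<in>crossings D. darts_at D v \<subseteq> darts D \<and> inj_on (dart_at D v) {0, 1, 2, 3} \<and>
        dart_at D v 4 = dart_at D v 0) \<and>
     (\<forall>v\<in>crossings D. \<forall>w\<in>crossings D. v \<noteq> w \<longrightarrow> darts_at D v \<inter> darts_at D w = {}) \<and>
     (\<forall>x\<in>plain_darts D. rot D x \<noteq> x \<and> rot D (rot D x) = x)"

lemma link_diagram_iff: "link_diagram D \<longleftrightarrow> diagram_map D \<and> planar D"
  by (simp only: link_diagram_def diagram_map_def conj_assoc)

lemma smoothing_simps [simp]:
  "darts (smoothing D v m) = darts D" "edge (smoothing D v m) = edge D"
  "crossings (smoothing D v m) = crossings D - {v}" "under (smoothing D v m) = under D"
  "rot (smoothing D v m) = smooth_rot D v m"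
  by (simp_all add: smoothing_def)

lemma rot_dart_at: "rot D (dart_at D v k) = dart_at D v (Suc k)"
  by (simp add: dart_at_def)

lemma darts_at_eq: "darts_at D v = {dart_at D v 0, dart_at D v (Suc 0), dart_at D v 2, dart_at D v 3}"
  by (simp add: darts_at_def)

context
  fixes D :: diagram
  assumes D: "diagram_map D"
begin

lemma fin_darts: "finite (darts D)" and fin_crossings: "finite (crossings D)"
  and edge_permutes: "edge D permutes darts D" and rot_permutes: "rot D permutes darts D"
  and edge_fpf: "x \<in> darts D \<Longrightarrow> edge D x \<noteq> x" and edge_inv: "x \<in> darts D \<Longrightarrow> edge D (edge D x) = x"
  and plain_fpf: "x \<in> plain_darts D \<Longrightarrow> rot D x \<noteq> x"
  and plain_inv: "x \<in> plain_darts D \<Longrightarrow> rot D (rot D x) = x"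
  and darts_at_subset: "v \<in> crossings D \<Longrightarrow> darts_at D v \<subseteq> darts D"
  and darts_at_disjoint: "v \<in> crossings D \<Longrightarrow> w \<in> crossings D \<Longrightarrow> v \<noteq> w \<Longrightarrow> darts_at D v \<inter> darts_at D w = {}"
  using D by (simp_all add: diagram_map_def)

lemma dart_at_distinct:
  assumes "v \<in> crossings D"
  shows "dart_at D v 0 \<noteq> dart_at D v (Suc 0)" "dart_at D v 0 \<noteq> dart_at D v 2" "dart_at D v 0 \<noteq> dart_at D v 3"
    "dart_at D v (Suc 0) \<noteq> dart_at D v 2" "dart_at D v (Suc 0) \<noteq> dart_at D v 3" "dart_at D v 2 \<noteq> dart_at D v 3"
proof -
  have "inj_on (dart_at D v) {0, 1, 2, 3}" using D assms unfolding diagram_map_def by blast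
  then show "dart_at D v 0 \<noteq> dart_at D v (Suc 0)" "dart_at D v 0 \<noteq> dart_at D v 2" "dart_at D v 0 \<noteq> dart_at D v 3"
    "dart_at D v (Suc 0) \<noteq> dart_at D v 2" "dart_at D v (Suc 0) \<noteq> dart_at D v 3" "dart_at D v 2 \<noteq> dart_at D v 3"
    by (auto simp: inj_on_def)
qed

lemma rot_at:
  assumes "v \<in> crossings D"
  shows "rot D (dart_at D v 0) = dart_at D v (Suc 0)" "rot D (dart_at D v (Suc 0)) = dart_at D v 2"
    "rot D (dart_at D v 2) = dart_at D v 3" "rot D (dart_at D v 3) = dart_at D v 0"
proof -
  have "dart_at D v 4 = dart_at D v 0" using D assms unfolding diagram_map_def by blast
  then show "rot D (dart_at D v 0) = dart_at D v (Suc 0)" "rot D (dart_at D v (Suc 0)) = dart_at D v 2"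
    "rot D (dart_at D v 2) = dart_at D v 3" "rot D (dart_at D v 3) = dart_at D v 0"
    by (simp_all add: rot_dart_at eval_nat_numeral)
qed

lemma rot_in_darts_at:
  assumes "v \<in> crossings D"
  shows "rot D x \<in> darts_at D v \<longleftrightarrow> x \<in> darts_at D v"
proof -
  have inj: "inj (rot D)" using rot_permutes by (rule permutes_inj)
  have "rot D ` darts_at D v = darts_at D v" unfolding darts_at_eq by (auto simp: rot_at[OF assms])
  then show ?thesis using inj_image_mem_iff[OF inj] by metis
qed

lemma dart_at_in: "v \<in> crossings D \<Longrightarrow> dart_at D v k \<in> darts_at D v"
proof (induction k)
  case 0 show ?case by (simp add: darts_at_eq)
next
  case (Suc k) then show ?case using rot_in_darts_at rot_dart_at by metis
qed

lemma smooth_rot_at: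
  assumes "v \<in> crossings D"
  shows "m = 1 \<Longrightarrow> smooth_rot D v m (dart_at D v 0) = dart_at D v (Suc 0)"
    "m = 1 \<Longrightarrow> smooth_rot D v m (dart_at D v (Suc 0)) = dart_at D v 0"
    "m = 1 \<Longrightarrow> smooth_rot D v m (dart_at D v 2) = dart_at D v 3"
    "m = 1 \<Longrightarrow> smooth_rot D v m (dart_at D v 3) = dart_at D v 2"
    "m \<noteq> 1 \<Longrightarrow> smooth_rot D v m (dart_at D v (Suc 0)) = dart_at D v 2"
    "m \<noteq> 1 \<Longrightarrow> smooth_rot D v m (dart_at D v 2) = dart_at D v (Suc 0)"
    "m \<noteq> 1 \<Longrightarrow> smooth_rot D v m (dart_at D v 3) = dart_at D v 0"
    "m \<noteq> 1 \<Longrightarrow> smooth_rot D v m (dart_at D v 0) = dart_at D v 3"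
  by (simp_all add: smooth_rot_def Let_def dart_at_distinct[OF assms] dart_at_distinct[OF assms, symmetric])

lemma smooth_rot_off: "x \<notin> darts_at D v \<Longrightarrow> smooth_rot D v m x = rot D x"
  by (auto simp: smooth_rot_def Let_def darts_at_eq)

text \<open>The 4-cycle (0 1 2 3) followed by (0 2) is (0 1)(2 3), and followed by (1 3) it is (0
  3)(1 2).\<close>

lemma smooth_rot_eq:
  assumes v: "v \<in> crossings D"
  shows "smooth_rot D v m =
    (if m = 1 then transpose (dart_at D v 0) (dart_at D v 2) \<circ> rot D
     else transpose (dart_at D v (Suc 0)) (dart_at D v 3) \<circ> rot D)"
proof
  fix x
  show "smooth_rot D v m x =
    (if m = 1 then transpose (dart_at D v 0) (dart_at D v 2) \<circ> rot D
     else transpose (dart_at D v (Suc 0)) (dart_at D v 3) \<circ> rot D) x"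
  proof (cases "x \<in> darts_at D v")
    case True
    then consider "x = dart_at D v 0" | "x = dart_at D v (Suc 0)" | "x = dart_at D v 2" | "x = dart_at D v 3"
      by (auto simp: darts_at_eq)
    then show ?thesis
      by cases (simp_all add: transpose_def smooth_rot_at[OF v] rot_at[OF v] dart_at_distinct[OF v]
        dart_at_distinct[OF v, symmetric])
  next
    case False
    then have "rot D x \<notin> darts_at D v" using rot_in_darts_at[OF v] by simp
    then show ?thesis using smooth_rot_off[OF False] by (auto simp: darts_at_eq transpose_def)
  qed
qed

lemma smooth_rot_permutes:
  assumes v: "v \<in> crossings D"
  shows "smooth_rot D v m permutes darts D"
proof -
  have "dart_at D v k \<in> darts D" for k using dart_at_in[OF v] darts_at_subset[OF v] by blast
  then show ?thesis unfolding smooth_rot_eq[OF v]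
    by (auto intro!: permutes_compose[OF rot_permutes] permutes_swap_id)
qed

lemma dart_at_smoothing:
  assumes "v \<in> crossings D" "w \<in> crossings D" "w \<noteq> v"
  shows "dart_at (smoothing D v m) w k = dart_at D w k"
proof (induction k)
  case (Suc k)
  have "dart_at D w k \<notin> darts_at D v" using dart_at_in darts_at_disjoint assms by blast
  then show ?case using Suc by (simp flip: rot_dart_at add: smooth_rot_off)
qed (simp add: dart_at_def)

lemma darts_at_smoothing:
  assumes "v \<in> crossings D" "w \<in> crossings D" "w \<noteq> v"
  shows "darts_at (smoothing D v m) w = darts_at D w"
  using assms by (simp add: darts_at_eq dart_at_smoothing)

lemma plain_darts_smoothing:
  assumes "v \<in> crossings D"
  shows "plain_darts (smoothing D v m) = plain_darts D \<union> darts_at D v"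
proof -
  have "(\<Union>w\<in>crossings D - {v}. darts_at (smoothing D v m) w) = (\<Union>w\<in>crossings D - {v}. darts_at D w)"
    using darts_at_smoothing[OF assms] by auto
  moreover have "x = v" if "a \<in> darts_at D v" "a \<in> darts_at D x" "x \<in> crossings D" for a x
    using that darts_at_disjoint[OF assms, of x] by blast
  ultimately show ?thesis using darts_at_subset[OF assms] assms by (auto simp: plain_darts_def)
qed

lemma smooth_rot_involution:
  assumes v: "v \<in> crossings D" and x: "x \<in> darts_at D v"
  shows "smooth_rot D v m x \<in> darts_at D v" "smooth_rot D v m x \<noteq> x"
    "smooth_rot D v m (smooth_rot D v m x) = x"
proof -
  from x consider "x = dart_at D v 0" | "x = dart_at D v (Suc 0)" | "x = dart_at D v 2" | "x = dart_at D v 3"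
    by (auto simp: darts_at_eq)
  then have "smooth_rot D v m x \<in> darts_at D v \<and> smooth_rot D v m x \<noteq> x \<and>
    smooth_rot D v m (smooth_rot D v m x) = x"
    by cases (cases "m = 1"; simp add: darts_at_eq smooth_rot_at[OF v] dart_at_distinct[OF v]
        dart_at_distinct[OF v, symmetric])+
  then show "smooth_rot D v m x \<in> darts_at D v" "smooth_rot D v m x \<noteq> x"
    "smooth_rot D v m (smooth_rot D v m x) = x" by auto
qed

lemma diagram_map_smoothing:
  assumes v: "v \<in> crossings D"
  shows "diagram_map (smoothing D v m)"
proof -
  have pd: "x \<notin> darts_at D v" if "x \<in> plain_darts D" for x
    using that v by (auto simp: plain_darts_def)
  have off: "rot D x \<notin> darts_at D v" "smooth_rot D v m x = rot D x" if "x \<in> plain_darts D" for x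
    using pd[OF that] rot_in_darts_at[OF v, of x] smooth_rot_off[of x v m] by blast+
  have pl: "smooth_rot D v m x \<noteq> x \<and> smooth_rot D v m (smooth_rot D v m x) = x"
    if "x \<in> plain_darts D \<union> darts_at D v" for x
    using that
  proof
    assume x: "x \<in> plain_darts D"
    have "smooth_rot D v m (rot D x) = rot D (rot D x)" by (rule smooth_rot_off[OF off(1)[OF x]])
    then show ?thesis by (simp only: off(2)[OF x] plain_fpf[OF x] plain_inv[OF x] not_False_eq_True simp_thms)
  next
    assume "x \<in> darts_at D v"
    from smooth_rot_involution(2,3)[OF v this] show ?thesis by blast
  qed
  have "darts_at D w \<subseteq> darts D \<and> inj_on (dart_at D w) {0, 1, 2, 3} \<and> dart_at D w 4 = dart_at D w 0"
    if "w \<in> crossings D" for w using D that by (simp add: diagram_map_def)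
  moreover have "dart_at (smoothing D v m) w = dart_at D w" if "w \<in> crossings D - {v}" for w
    using that by (intro ext dart_at_smoothing[OF v]) auto
  moreover have "darts_at (smoothing D v m) w = darts_at D w" if "w \<in> crossings D - {v}" for w
    using that by (intro darts_at_smoothing[OF v]) auto
  ultimately have c: "\<forall>w\<in>crossings D - {v}. darts_at (smoothing D v m) w \<subseteq> darts D \<and>
      inj_on (dart_at (smoothing D v m) w) {0, 1, 2, 3} \<and>
      dart_at (smoothing D v m) w 4 = dart_at (smoothing D v m) w 0"
    and dj: "\<forall>w\<in>crossings D - {v}. \<forall>u\<in>crossings D - {v}. w \<noteq> u \<longrightarrow>
      darts_at (smoothing D v m) w \<inter> darts_at (smoothing D v m) u = {}"
    using darts_at_disjoint by (metis DiffD1)+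
  have "\<forall>x\<in>darts D. edge D x \<noteq> x \<and> edge D (edge D x) = x" using edge_fpf edge_inv by blast
  moreover have "\<forall>x\<in>plain_darts D \<union> darts_at D v.
      smooth_rot D v m x \<noteq> x \<and> smooth_rot D v m (smooth_rot D v m x) = x" using pl by blast
  ultimately show ?thesis
    unfolding diagram_map_def plain_darts_smoothing[OF v] smoothing_simps
    by (intro conjI finite_Diff smooth_rot_permutes[OF v] fin_darts fin_crossings edge_permutes c dj)
qed

end

text \<open>With \<open>e\<close> read as "outgoing", this is an orientation of the edges that
  alternates between in and out around every vertex. In the plane, orienting the edges as boundaries
  of the black regions of a checkerboard colouring gives one.\<close>

definition alternating :: "diagram \<Rightarrow> (nat \<Rightarrow> bool) \<Rightarrow> bool" where
  "alternating D e \<longleftrightarrow> (\<forall>x\<in>darts D. e (edge D x) \<noteq> e x \<and> e (rot D x) \<noteq> e x)"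

lemma alternating_at:
  assumes "diagram_map D" "alternating D e" "v \<in> crossings D"
  shows "e (dart_at D v (Suc 0)) \<noteq> e (dart_at D v 0)" "e (dart_at D v 2) = e (dart_at D v 0)"
    "e (dart_at D v 3) \<noteq> e (dart_at D v 0)"
proof -
  have "dart_at D v k \<in> darts D" for k
    using dart_at_in[OF assms(1,3)] darts_at_subset[OF assms(1,3)] by blast
  then have "e (rot D (dart_at D v k)) \<noteq> e (dart_at D v k)" for k
    using assms(2) by (simp add: alternating_def)
  from this[of 0] this[of 1] this[of 2] this[of 3]
  show "e (dart_at D v (Suc 0)) \<noteq> e (dart_at D v 0)" "e (dart_at D v 2) = e (dart_at D v 0)"
    "e (dart_at D v 3) \<noteq> e (dart_at D v 0)"
    by (auto simp: rot_at[OF assms(1,3)])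
qed

text \<open>Either smoothing joins darts that are neighbours in the rotation, and these have
  opposite orientations.\<close>

lemma alternating_smoothing:
  assumes "diagram_map D" "alternating D e" "v \<in> crossings D"
  shows "alternating (smoothing D v m) e"
  unfolding alternating_def
proof
  fix x assume x: "x \<in> darts (smoothing D v m)"
  have "e (smooth_rot D v m x) \<noteq> e x"
  proof (cases "x \<in> darts_at D v")
    case True
    then show ?thesis
      unfolding darts_at_eq using smooth_rot_at[OF assms(1,3), of m] alternating_at[OF assms]
      by (cases "m = 1") auto
  next
    case False
    then show ?thesis using assms x by (simp add: smooth_rot_off alternating_def)
  qed
  then show "e (edge (smoothing D v m) x) \<noteq> e x \<and> e (rot (smoothing D v m) x) \<noteq> e x"
    using x assms(2) by (simp add: alternating_def)
qed

section \<open>The genus under resolution of crossings\<close>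

abbreviation component_rel :: "diagram \<Rightarrow> (nat \<times> nat) set" where
  "component_rel D \<equiv> (graph_of (darts D) (rot D) \<union> graph_of (darts D) (edge D))\<^sup>*"

text \<open>Twice the sum of the genera of the components.\<close>

definition euler_defect :: "diagram \<Rightarrow> int" where
  "euler_defect D = 2 * int (card (darts D // component_rel D))
     - int (card (darts D // (graph_of (darts D) (rot D))\<^sup>*))
     + int (card (darts D // (graph_of (darts D) (edge D))\<^sup>*))
     - int (card (darts D // (graph_of (darts D) (rot D \<circ> edge D))\<^sup>*))"

lemma planar_iff_euler_defect: "planar D \<longleftrightarrow> euler_defect D = 0"
  unfolding planar_def euler_defect_def orbits_def by linarith

lemma sym_component_rel:
  assumes "diagram_map D" shows "sym (component_rel D)"
proof (rule sym_rtranclI)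
  fix x y assume "(x, y) \<in> graph_of (darts D) (rot D) \<union> graph_of (darts D) (edge D)"
  then have "(y, x) \<in> (graph_of (darts D) (rot D))\<^sup>* \<or> (y, x) \<in> (graph_of (darts D) (edge D))\<^sup>*"
    using sym_orbit_rel[OF rot_permutes[OF assms] fin_darts[OF assms]]
      sym_orbit_rel[OF edge_permutes[OF assms] fin_darts[OF assms]] by (auto dest: symD)
  then show "(y, x) \<in> component_rel D"
    by (meson Un_upper1 Un_upper2 rtrancl_mono subsetD)
qed

text \<open>The smoothing cuts the vertex into two, one with dart 0 and one with dart 2; regluing
  them identifies their components and nothing else.\<close>

lemma component_rel_smoothing:
  assumes "diagram_map D" "v \<in> crossings D"
  shows "component_rel D = link (component_rel (smoothing D v 1)) (dart_at D v 0) (dart_at D v 2)"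
proof (rule rtrancl_eq_linkI)
  let ?D' = "smoothing D v 1" and ?x = "dart_at D v 0" and ?y = "dart_at D v 2"
  have rot: "rot ?D' = transpose ?x ?y \<circ> rot D" using smooth_rot_eq[OF assms, of 1] by simp
  then have rot': "rot D = transpose ?x ?y \<circ> rot ?D'" by (simp add: fun_eq_iff)
  have inD: "dart_at D v k \<in> darts D" for k
    using dart_at_in[OF assms] darts_at_subset[OF assms] by blast
  then have st: "(dart_at D v k, rot D (dart_at D v k)) \<in> component_rel D" for k
    by (auto simp: graph_of_def)
  show xy: "(?x, ?y) \<in> component_rel D" using st[of 0] st[of 1] by (simp add: rot_at[OF assms])
  show yx: "(?y, ?x) \<in> component_rel D" using st[of 2] st[of 3] by (simp add: rot_at[OF assms])
  show "sym (component_rel ?D')" by (rule sym_component_rel[OF diagram_map_smoothing[OF assms]])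
  fix a b
  show "(a, b) \<in> link (component_rel ?D') ?x ?y"
    if "(a, b) \<in> graph_of (darts D) (rot D) \<union> graph_of (darts D) (edge D)"
    using that
  proof
    assume "(a, b) \<in> graph_of (darts D) (rot D)"
    then have a: "a \<in> darts D" "b = transpose ?x ?y (rot ?D' a)" using rot' by (auto simp: graph_of_def)
    then have "(a, rot ?D' a) \<in> component_rel ?D'" by (auto simp: graph_of_def)
    then show ?thesis unfolding a(2) by (auto simp: link_def transpose_def simp del: smoothing_simps)
  qed (auto simp: link_def)
  show "(a, b) \<in> component_rel D"
    if "(a, b) \<in> graph_of (darts ?D') (rot ?D') \<union> graph_of (darts ?D') (edge ?D')"
    using that
  proof
    assume "(a, b) \<in> graph_of (darts ?D') (rot ?D')"
    then have a: "a \<in> darts D" "b = transpose ?x ?y (rot D a)" using rot by (auto simp: graph_of_def)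
    then have "(a, rot D a) \<in> component_rel D" by (auto simp: graph_of_def)
    then show ?thesis unfolding a(2) transpose_def using xy yx by (auto intro: rtrancl_trans)
  qed auto
qed

text \<open>Nonnegativity is proved along with the orientation, because it is what makes genus 0
  pass from \<open>D\<close> to its smoothing: one resolution lowers the defect by 0 or 2.\<close>

theorem alternating_of_euler_defect:
  assumes "diagram_map D"
  shows "0 \<le> euler_defect D \<and> (euler_defect D = 0 \<longrightarrow> (\<exists>e. alternating D e))"
  using assms
proof (induction "card (crossings D)" arbitrary: D)
  case 0
  then have "crossings D = {}" using fin_crossings[OF 0(2)] by simp
  then have plain: "plain_darts D = darts D" by (simp add: plain_darts_def)
  note D = \<open>diagram_map D\<close>
  interpret involution_pair "darts D" "edge D" "rot D"
    by unfold_locales (use fin_darts edge_permutes rot_permutes edge_inv edge_fpf plain_inv plain_fpf D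
      plain in auto)
  \<comment> \<open>All vertices have degree two, so vertices and edges are equal in number and the
    defect is 2C - F.\<close>
  have "2 * card (darts D // (graph_of (darts D) (rot D))\<^sup>*) = card (darts D)"
    by (rule card_orbits_involution) (use fin g g_inv g_fpf in auto)
  moreover have "2 * card (darts D // (graph_of (darts D) (edge D))\<^sup>*) = card (darts D)"
    by (rule card_orbits_involution) (use fin f f_inv f_fpf in auto)
  moreover note card_rotation_le
  moreover have "\<exists>e. alternating D e"
    by (rule ex_alternating) (auto simp: alternating_def)
  ultimately show ?case by (auto simp: euler_defect_def)
next
  case (Suc n)
  note D = \<open>diagram_map D\<close>
  then obtain v where v: "v \<in> crossings D" using Suc(2) by fastforce
  let ?D' = "smoothing D v 1" and ?x = "dart_at D v 0" and ?y = "dart_at D v 2"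
  let ?X = "darts D"
  have D': "diagram_map ?D'" by (rule diagram_map_smoothing[OF D v])
  have "n = card (crossings ?D')" using Suc(2) v fin_crossings[OF D] by simp
  note IH = Suc(1)[OF this D']
  have X: "darts ?D' = ?X" by simp
  have fin: "finite ?X" by (rule fin_darts[OF D])
  have inD: "dart_at D v k \<in> ?X" for k using dart_at_in[OF D v] darts_at_subset[OF D v] by blast
  have xy: "?x \<noteq> ?y" by (rule dart_at_distinct(2)[OF D v])
  have rot: "rot ?D' = transpose ?x ?y \<circ> rot D" using smooth_rot_eq[OF D v, of 1] by simp
  then have rot': "rot D = transpose ?x ?y \<circ> rot ?D'" by (simp add: fun_eq_iff)
  let ?V = "\<lambda>D. (graph_of (darts D) (rot D))\<^sup>*" and ?F = "\<lambda>D. (graph_of (darts D) (rot D \<circ> edge D))\<^sup>*"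
  have perm: "rot D \<circ> edge D permutes ?X" "rot ?D' \<circ> edge ?D' permutes ?X"
    using edge_permutes[OF D] rot_permutes[OF D] edge_permutes[OF D'] rot_permutes[OF D'] X
    by (auto intro: permutes_compose simp del: smoothing_simps(5))
  have symF: "sym (?F D)" "sym (?F ?D')" using sym_orbit_rel[OF perm(1) fin] sym_orbit_rel[OF perm(2) fin] by auto
  have sym: "sym (?V ?D')" using sym_orbit_rel[OF rot_permutes[OF D'] fin_darts[OF D']] .
  have V: "card (?X // ?V ?D') = Suc (card (?X // ?V D))"
  proof -
    have st: "(dart_at D v k, rot D (dart_at D v k)) \<in> ?V D" for k using inD by (auto simp: graph_of_def)
    have "(?x, ?y) \<in> ?V D" using st[of 0] st[of 1] by (simp add: rot_at[OF D v])
    then have n: "(?x, ?y) \<notin> ?V ?D'"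
      using transpose_splits_orbit[OF rot_permutes[OF D] fin xy inD inD rot] X by simp
    then have "?V D = link (?V ?D') ?x ?y"
      using transpose_merges_orbits[OF _ fin xy inD inD rot'] rot_permutes[OF D'] X by simp
    then show ?thesis using card_quotient_link[OF fin sym trans_rtrancl refl_rtrancl n inD inD] by simp
  qed
  have sw: "rot D \<circ> edge D = transpose ?x ?y \<circ> (rot ?D' \<circ> edge ?D')"
    "rot ?D' \<circ> edge ?D' = transpose ?x ?y \<circ> (rot D \<circ> edge D)"
    using rot rot' by (auto simp: comp_assoc)
  have C: "card (?X // component_rel ?D') =
    (if (?x, ?y) \<in> component_rel ?D' then card (?X // component_rel D) else Suc (card (?X // component_rel D)))"
    using card_quotient_link[OF fin sym_component_rel[OF D'] trans_rtrancl refl_rtrancl _ inD inD]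
      link_same[OF sym_component_rel[OF D']] component_rel_smoothing[OF D v] by auto
  have F: "int (card (?X // ?F D)) = card (?X // ?F ?D') + (if (?x, ?y) \<in> ?F ?D' then 1 else - 1)"
  proof (cases "(?x, ?y) \<in> ?F ?D'")
    case True
    then have n: "(?x, ?y) \<notin> ?F D"
      using transpose_splits_orbit[OF perm(2) fin xy inD inD sw(1)] X by simp
    then have "?F ?D' = link (?F D) ?x ?y"
      using transpose_merges_orbits[OF perm(1) fin xy inD inD sw(2)] X by simp
    then show ?thesis using True card_quotient_link[OF fin symF(1) trans_rtrancl refl_rtrancl n inD inD] by simp
  next
    case False
    then have "?F D = link (?F ?D') ?x ?y"
      using transpose_merges_orbits[OF perm(2) fin xy inD inD sw(1)] X by simp
    then show ?thesis using False card_quotient_link[OF fin symF(2) trans_rtrancl refl_rtrancl False inD inD] by simp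
  qed
  have FC: "?F ?D' \<subseteq> component_rel ?D'"
  proof -
    have "(a, b) \<in> component_rel ?D'" if "(a, b) \<in> graph_of (darts ?D') (rot ?D' \<circ> edge ?D')" for a b
    proof -
      have "edge D a \<in> darts D" if "a \<in> darts D" for a
        using that permutes_in_image[OF edge_permutes[OF D]] by blast
      with that have "(a, edge ?D' a) \<in> component_rel ?D'" "(edge ?D' a, b) \<in> component_rel ?D'"
        by (auto simp: graph_of_def intro!: r_into_rtrancl)
      then show ?thesis by (rule rtrancl_trans)
    qed
    then show ?thesis by (metis rtrancl_subset_rtrancl subrelI)
  qed
  \<comment> \<open>Regluing loses one vertex. If \<open>?x\<close> and \<open>?y\<close> lie on one
    face of \<open>?D'\<close>, that face is split; on two faces of one component, these are fused
    and a handle arises; in two components, both faces and components are fused. Only the handle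
    changes 2C - V + E - F.\<close>
  have defect: "euler_defect D = euler_defect ?D' +
    (if (?x, ?y) \<notin> ?F ?D' \<and> (?x, ?y) \<in> component_rel ?D' then 2 else 0)"
    using V F C FC unfolding euler_defect_def X smoothing_simps(2) by (auto split: if_splits)
  show ?case
  proof (intro conjI impI)
    show "0 \<le> euler_defect D" using defect IH by auto
    assume "euler_defect D = 0"
    with defect IH have 0: "euler_defect ?D' = 0" and con: "(?x, ?y) \<in> component_rel ?D' \<Longrightarrow> (?x, ?y) \<in> ?F ?D'"
      by (auto split: if_splits)
    from 0 IH obtain e where e: "alternating ?D' e" by blast
    have eD: "e (edge D a) \<noteq> e a" "e (rot ?D' a) \<noteq> e a" if "a \<in> ?X" for a
      using e that by (auto simp: alternating_def)
    have "\<exists>e. alternating ?D' e \<and> e ?x = e ?y"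
    proof (cases "(?x, ?y) \<in> component_rel ?D'")
      case True
      \<comment> \<open>A step along a face reverses the orientation twice. Hence \<open>?x\<close>
        and \<open>?y\<close>, which share a face, are equally oriented already.\<close>
      have inv: "e b = e a" if "(a, b) \<in> graph_of (darts ?D') (rot ?D' \<circ> edge ?D')" for a b
      proof -
        have "a \<in> ?X" "b = rot ?D' (edge D a)" using that by (auto simp: graph_of_def)
        then show ?thesis
          using eD(1)[of a] eD(2)[of "edge D a"] permutes_in_image[OF edge_permutes[OF D], of a] by auto
      qed
      have "e b = e a" if "(a, b) \<in> ?F ?D'" for a b
        using that
      proof (induction rule: rtrancl_induct)
        case (step b c) then show ?case using inv[OF step.hyps(2)] by simp
      qed simp
      then have "e ?y = e ?x" using con[OF True] .
      with e show ?thesis by metis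
    next
      case False
      \<comment> \<open>The orientation of a component can be reversed as a whole. Here it is
        normalised to be true at \<open>?x\<close> on the component of \<open>?x\<close>, and true
        at \<open>?y\<close> where \<open>e\<close> is compared with \<open>e ?y\<close>.\<close>
      define e' where "e' a = (if (?x, a) \<in> component_rel ?D' then e a = e ?x else e a = e ?y)" for a
      have "e' ?x = e' ?y" using False by (simp add: e'_def)
      moreover have "alternating ?D' e'"
        unfolding alternating_def
      proof
        fix a assume a: "a \<in> darts ?D'"
        have same: "(?x, b) \<in> component_rel ?D' \<longleftrightarrow> (?x, a) \<in> component_rel ?D'"
          if "b = edge ?D' a \<or> b = rot ?D' a" for b
        proof -
          have "(a, b) \<in> component_rel ?D'" using that a by (auto simp: graph_of_def)
          moreover from this have "(b, a) \<in> component_rel ?D'" using sym_component_rel[OF D'] by (auto dest: symD)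
          ultimately show ?thesis by (blast intro: rtrancl_trans)
        qed
        have s: "(?x, edge ?D' a) \<in> component_rel ?D' \<longleftrightarrow> (?x, a) \<in> component_rel ?D'"
          "(?x, rot ?D' a) \<in> component_rel ?D' \<longleftrightarrow> (?x, a) \<in> component_rel ?D'"
          by (rule same, simp)+
        have "e (edge ?D' a) \<noteq> e a" "e (rot ?D' a) \<noteq> e a" using e a unfolding alternating_def by blast+
        then show "e' (edge ?D' a) \<noteq> e' a \<and> e' (rot ?D' a) \<noteq> e' a"
          unfolding e'_def s by argo
      qed
      ultimately show ?thesis by blast
    qed
    then obtain e where e: "alternating ?D' e" "e ?x = e ?y" by blast
    \<comment> \<open>The rotations of \<open>D\<close> and \<open>?D'\<close> differ by this
      transposition, so \<open>e\<close> cannot distinguish them.\<close>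
    have "e (transpose ?x ?y a) = e a" for a using e(2) by (simp add: transpose_def)
    then have "alternating D e"
      using e(1) unfolding alternating_def rot' comp_apply X smoothing_simps(2) by metis
    then show "\<exists>e. alternating D e" by blast
  qed
qed

corollary link_diagram_alternating:
  assumes "link_diagram D"
  obtains e where "alternating D e"
  using assms alternating_of_euler_defect that unfolding link_diagram_iff planar_iff_euler_defect by blast

section \<open>Changing one marker merges two circles or splits one\<close>

definition circle_steps :: "diagram \<Rightarrow> (nat \<Rightarrow> int) \<Rightarrow> (nat \<times> nat) set" where
  "circle_steps D s = graph_of (darts D) (edge D) \<union> graph_of (plain_darts D) (rot D) \<union>
      (\<Union>v\<in>crossings D. graph_of (darts_at D v) (smooth_rot D v (s v)))"

lemma circles_eq: "circles D s = darts D // (circle_steps D s)\<^sup>*"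
  by (simp add: circles_def orbits_def circle_steps_def)

lemma graph_of_Un: "graph_of (A \<union> B) f = graph_of A f \<union> graph_of B f"
  by (auto simp: graph_of_def)

lemma graph_of_cong: "(\<And>x. x \<in> A \<Longrightarrow> f x = g x) \<Longrightarrow> graph_of A f = graph_of A g"
  by (auto simp: graph_of_def)

lemma smooth_rot_smoothing:
  assumes D: "diagram_map D" and v: "v \<in> crossings D" and w: "w \<in> crossings D" "w \<noteq> v"
    and x: "x \<in> darts_at D w"
  shows "smooth_rot (smoothing D v k) w m x = smooth_rot D w m x"
proof -
  have w': "w \<in> crossings (smoothing D v k)" using w by simp
  have "x \<in> {dart_at D w 0, dart_at D w (Suc 0), dart_at D w 2, dart_at D w 3}"
    using x by (simp add: darts_at_eq)
  then show ?thesis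
    using smooth_rot_at[OF D w(1), of m]
      smooth_rot_at[OF diagram_map_smoothing[OF D v] w', of m, unfolded dart_at_smoothing[OF D v w]]
    by (cases "m = 1") auto
qed

text \<open>The darts at \<open>v\<close> become plain darts with the same steps. This permits
  inductions that resolve crossings one at a time without changing the circles.\<close>

lemma circle_steps_smoothing:
  assumes D: "diagram_map D" and v: "v \<in> crossings D"
    and s: "\<And>w. w \<in> crossings D - {v} \<Longrightarrow> s' w = s w"
  shows "circle_steps (smoothing D v (s v)) s' = circle_steps D s"
proof -
  have "graph_of (plain_darts D) (smooth_rot D v (s v)) = graph_of (plain_darts D) (rot D)"
    by (intro graph_of_cong smooth_rot_off[OF D]) (use v in \<open>auto simp: plain_darts_def\<close>)
  moreover have "graph_of (darts_at (smoothing D v (s v)) w) (smooth_rot (smoothing D v (s v)) w (s' w))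
      = graph_of (darts_at D w) (smooth_rot D w (s w))" if w: "w \<in> crossings D - {v}" for w
  proof -
    have "w \<in> crossings D" "w \<noteq> v" using w by auto
    then show ?thesis
      unfolding s[OF w] darts_at_smoothing[OF D v \<open>w \<in> crossings D\<close> \<open>w \<noteq> v\<close>]
      by (intro graph_of_cong smooth_rot_smoothing[OF D v]) auto
  qed
  then have "(\<Union>w\<in>crossings D - {v}. graph_of (darts_at (smoothing D v (s v)) w)
        (smooth_rot (smoothing D v (s v)) w (s' w)))
      = (\<Union>w\<in>crossings D - {v}. graph_of (darts_at D w) (smooth_rot D w (s w)))"
    by (rule SUP_cong[OF refl])
  moreover have "(\<Union>w\<in>crossings D. graph_of (darts_at D w) (smooth_rot D w (s w))) =
      graph_of (darts_at D v) (smooth_rot D v (s v)) \<union>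
      (\<Union>w\<in>crossings D - {v}. graph_of (darts_at D w) (smooth_rot D w (s w)))"
    using v by blast
  ultimately show ?thesis
    unfolding circle_steps_def plain_darts_smoothing[OF D v] smoothing_simps graph_of_Un
    by (simp only: Un_assoc Un_left_commute Un_commute)
qed

lemma circles_smoothing:
  assumes "diagram_map D" "v \<in> crossings D" "\<And>w. w \<in> crossings D - {v} \<Longrightarrow> s' w = s w"
  shows "circles (smoothing D v (s v)) s' = circles D s"
  using circle_steps_smoothing[where s = s and s' = s', OF assms] by (simp add: circles_eq)

lemma circle_steps_resolved:
  assumes "crossings D = {}"
  shows "(circle_steps D s)\<^sup>* = component_rel D"
  using assms by (simp add: circle_steps_def plain_darts_def Un_commute)

text \<open>The two involutions \<open>g\<close> and \<open>g'\<close> differ by two transpositions of equally oriented elements;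
  only one of them is visible on the elements with the orientation of \<open>x\<close>.\<close>

lemma dihedral_orbits_switch:
  assumes g: "involution_pair X f g" and g': "involution_pair X f g'"
    and e: "\<And>z. z \<in> X \<Longrightarrow> e (f z) \<noteq> e z" "\<And>z. z \<in> X \<Longrightarrow> e (g z) \<noteq> e z" "\<And>z. z \<in> X \<Longrightarrow> e (g' z) \<noteq> e z"
    and x: "x \<in> X" "y \<in> X" "x \<noteq> y" and exy: "e x = (e y :: bool)"
    and sw: "\<And>z. z \<in> X \<Longrightarrow> e (g z) = e x \<Longrightarrow> g' z = transpose x y (g z)"
  shows "(x, y) \<notin> (graph_of X g \<union> graph_of X f)\<^sup>* \<Longrightarrow>
      (graph_of X g' \<union> graph_of X f)\<^sup>* = link ((graph_of X g \<union> graph_of X f)\<^sup>*) x y"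
    and "(x, y) \<in> (graph_of X g \<union> graph_of X f)\<^sup>* \<Longrightarrow> (x, y) \<notin> (graph_of X g' \<union> graph_of X f)\<^sup>*"
proof -
  interpret g: involution_pair X f g by fact
  interpret g': involution_pair X f g' by fact
  define h where "h = transpose x y \<circ> (g \<circ> f)"
  have h_permutes: "h permutes X"
    unfolding h_def using g.gf_permutes x by (auto intro: permutes_compose permutes_swap_id)
  \<comment> \<open>Rotations preserve orientation, since \<open>f\<close> and \<open>k\<close> both
    reverse it.\<close>
  have P_same: "e b = e a" if "(a, b) \<in> (graph_of X (k \<circ> f))\<^sup>*"
    and k: "involution_pair X f k" "\<And>z. z \<in> X \<Longrightarrow> e (k z) \<noteq> e z" for a b k
    using that(1)
  proof (induction rule: rtrancl_induct)
    case (step b c)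
    then have "b \<in> X" "c = k (f b)" by (auto simp: graph_of_def)
    then show ?case using step.IH e(1)[of b] k(2)[of "f b"] involution_pair.f_in[OF k(1)] by auto
  qed simp
  \<comment> \<open>Between equally oriented elements the dihedral relation is the rotation
    relation: the alternative in \<open>C_cases\<close> would reverse the orientation.\<close>
  have C_P: "(a, b) \<in> (graph_of X k \<union> graph_of X f)\<^sup>* \<longleftrightarrow> (a, b) \<in> (graph_of X (k \<circ> f))\<^sup>*"
    if a: "a \<in> X" "e a = e b" and k: "involution_pair X f k" "\<And>z. z \<in> X \<Longrightarrow> e (k z) \<noteq> e z" for a b k
  proof
    assume "(a, b) \<in> (graph_of X k \<union> graph_of X f)\<^sup>*"
    then consider "(a, b) \<in> (graph_of X (k \<circ> f))\<^sup>*" | "(f a, b) \<in> (graph_of X (k \<circ> f))\<^sup>*"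
      using involution_pair.C_cases[OF k(1)] a(1) by blast
    then show "(a, b) \<in> (graph_of X (k \<circ> f))\<^sup>*"
    proof cases
      case 2
      have "e b = e (f a)" by (rule P_same[OF 2 k])
      then show ?thesis using e(1)[OF a(1)] a(2) by simp
    qed
  qed (use involution_pair.P_subset_C[OF k(1)] in blast)
  have hg': "h z = g' (f z)" and e_h: "e (h z) = e x" if "z \<in> X" "e z = e x" for z
  proof -
    have fz: "f z \<in> X" using that g.f_in by simp
    have "e (g (f z)) = e x" using that e(1)[of z] e(2)[OF fz] by auto
    then show "h z = g' (f z)" using sw[OF fz] by (simp add: h_def)
    then show "e (h z) = e x" using that e(1)[of z] e(3)[OF fz] by auto
  qed
  have Ph: "(a, b) \<in> (graph_of X h)\<^sup>* \<longleftrightarrow> (a, b) \<in> (graph_of X (g' \<circ> f))\<^sup>*" if a: "e a = e x" for a b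
  proof
    assume "(a, b) \<in> (graph_of X h)\<^sup>*"
    then have "(a, b) \<in> (graph_of X (g' \<circ> f))\<^sup>* \<and> e b = e x"
    proof (induction rule: rtrancl_induct)
      case (step b c)
      then have b: "b \<in> X" "c = h b" "e b = e x" by (auto simp: graph_of_def)
      then have "(b, c) \<in> graph_of X (g' \<circ> f)" using hg' by (auto simp: graph_of_def)
      moreover have "e c = e x" using e_h[OF b(1,3)] b(2) by simp
      ultimately show ?case using rtrancl_into_rtrancl[OF conjunct1[OF step.IH]] by blast
    qed (use a in simp)
    then show "(a, b) \<in> (graph_of X (g' \<circ> f))\<^sup>*" by simp
  next
    assume "(a, b) \<in> (graph_of X (g' \<circ> f))\<^sup>*"
    then have "(a, b) \<in> (graph_of X h)\<^sup>* \<and> e b = e x"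
    proof (induction rule: rtrancl_induct)
      case (step b c)
      then have b: "b \<in> X" "c = g' (f b)" "e b = e x" by (auto simp: graph_of_def)
      then have c: "c = h b" using hg' by simp
      then have "(b, c) \<in> graph_of X h" using b(1) by (simp add: graph_of_def)
      from rtrancl_into_rtrancl[OF conjunct1[OF step.IH] this] show ?case using e_h[OF b(1,3)] c by simp
    qed (use a in simp)
    then show "(a, b) \<in> (graph_of X h)\<^sup>*" by simp
  qed
  note P_iff = C_P[OF x(1) exy g e(2)] C_P[OF x(1) exy g' e(3)]
  show "(x, y) \<notin> (graph_of X g' \<union> graph_of X f)\<^sup>*" if "(x, y) \<in> (graph_of X g \<union> graph_of X f)\<^sup>*"
    using transpose_splits_orbit[OF g.gf_permutes g.fin x(3,1,2) h_def] that Ph[OF refl] P_iff by blast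
  show "(graph_of X g' \<union> graph_of X f)\<^sup>* = link ((graph_of X g \<union> graph_of X f)\<^sup>*) x y"
    if n: "(x, y) \<notin> (graph_of X g \<union> graph_of X f)\<^sup>*"
  proof (rule rtrancl_eq_linkI[OF g.sym_C])
    have "(graph_of X h)\<^sup>* = link ((graph_of X (g \<circ> f))\<^sup>*) x y"
      using transpose_merges_orbits[OF g.gf_permutes g.fin x(3,1,2) h_def] n P_iff by blast
    then have "(x, y) \<in> (graph_of X h)\<^sup>*" by (simp add: link_def)
    then show xy: "(x, y) \<in> (graph_of X g' \<union> graph_of X f)\<^sup>*" using Ph[OF refl] P_iff by blast
    then show yx: "(y, x) \<in> (graph_of X g' \<union> graph_of X f)\<^sup>*" using g'.sym_C by (rule symD[rotated])
    have link_sym: "(b, a) \<in> link ((graph_of X g \<union> graph_of X f)\<^sup>*) x y"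
      if "(a, b) \<in> link ((graph_of X g \<union> graph_of X f)\<^sup>*) x y" for a b
      using that g.sym_C unfolding link_def by (auto dest: symD)
    have l1: "(z, g' z) \<in> link ((graph_of X g \<union> graph_of X f)\<^sup>*) x y" if z: "z \<in> X" "e (g z) = e x" for z
    proof -
      have "(z, g z) \<in> (graph_of X g \<union> graph_of X f)\<^sup>*" using z by (auto simp: graph_of_def)
      then show ?thesis unfolding sw[OF z] by (auto simp: link_def transpose_def)
    qed
    have l2: "(z, g z) \<in> (graph_of X g' \<union> graph_of X f)\<^sup>*" if z: "z \<in> X" "e (g z) = e x" for z
    proof -
      have "(z, g' z) \<in> (graph_of X g' \<union> graph_of X f)\<^sup>*" using z by (auto simp: graph_of_def)
      moreover have "g z = transpose x y (g' z)" using sw[OF z] by simp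
      ultimately show ?thesis using xy yx by (auto simp: transpose_def intro: rtrancl_trans)
    qed
    fix a b
    show "(a, b) \<in> link ((graph_of X g \<union> graph_of X f)\<^sup>*) x y" if "(a, b) \<in> graph_of X g' \<union> graph_of X f"
      using that
    proof
      assume "(a, b) \<in> graph_of X g'"
      then have ab: "a \<in> X" "b = g' a" by (auto simp: graph_of_def)
      show ?thesis
      proof (cases "e (g a) = e x")
        case True then show ?thesis using l1 ab by simp
      next
        case False
        have b: "b \<in> X" using ab g'.g_in by simp
        \<comment> \<open>The step is traversed backwards: at \<open>b\<close> the hypothesis
          \<open>sw\<close> applies, and \<open>g'\<close> leads from \<open>b\<close> back to
          \<open>a\<close>.\<close>
        have "e (g b) = e x" using False e(2)[OF ab(1)] e(3)[OF ab(1)] e(2)[OF b] ab(2) by auto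
        then have "(b, g' b) \<in> link ((graph_of X g \<union> graph_of X f)\<^sup>*) x y" by (rule l1[OF b])
        then show ?thesis using link_sym ab g'.g_inv by simp
      qed
    qed (auto simp: link_def)
    show "(a, b) \<in> (graph_of X g' \<union> graph_of X f)\<^sup>*" if "(a, b) \<in> graph_of X g \<union> graph_of X f"
      using that
    proof
      assume "(a, b) \<in> graph_of X g"
      then have ab: "a \<in> X" "b = g a" by (auto simp: graph_of_def)
      show ?thesis
      proof (cases "e (g a) = e x")
        case True then show ?thesis using l2 ab by simp
      next
        case False
        have b: "b \<in> X" using ab g.g_in by simp
        have "e (g b) = e x" using False e(2)[OF ab(1)] e(2)[OF b] ab(2) by auto
        then have "(b, g b) \<in> (graph_of X g' \<union> graph_of X f)\<^sup>*" by (rule l2[OF b])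
        then have "(g b, b) \<in> (graph_of X g' \<union> graph_of X f)\<^sup>*" using g'.sym_C by (rule symD[rotated])
        then show ?thesis using ab g.g_inv by simp
      qed
    qed auto
  qed
qed

text \<open>Every other crossing is resolved according to its marker, which \<open>s\<close> and
  \<open>s'\<close> share. When \<open>v\<close> alone remains, the circles are orbits of the edge
  involution and a smoothed rotation, and \<open>dihedral_orbits_switch\<close> applies.\<close>

lemma circle_rel_switch:
  assumes "diagram_map D" "alternating D e" "v \<in> crossings D"
    and "s v = 1 \<and> s' v = -1 \<or> s v = -1 \<and> s' v = 1" "\<And>w. w \<in> crossings D - {v} \<Longrightarrow> s' w = s w"
  shows "((dart_at D v 0, dart_at D v 2) \<notin> (circle_steps D s)\<^sup>* \<longrightarrow>
      (circle_steps D s')\<^sup>* = link ((circle_steps D s)\<^sup>*) (dart_at D v 0) (dart_at D v 2)) \<and>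
    ((dart_at D v 0, dart_at D v 2) \<in> (circle_steps D s)\<^sup>* \<longrightarrow>
      (dart_at D v 0, dart_at D v 2) \<notin> (circle_steps D s')\<^sup>*)"
  using assms
proof (induction "card (crossings D)" arbitrary: D)
  case 0
  then show ?case using fin_crossings[OF 0(2)] by auto
next
  case (Suc n)
  note D = \<open>diagram_map D\<close> and e = \<open>alternating D e\<close> and v = \<open>v \<in> crossings D\<close> and s = Suc.prems(4,5)
  show ?case
  proof (cases "crossings D = {v}")
    case True
    have inv: "involution_pair (darts D) (edge D) (smooth_rot D v m)" for m
    proof -
      have M: "diagram_map (smoothing D v m)" by (rule diagram_map_smoothing[OF D v])
      have pl: "plain_darts (smoothing D v m) = darts D" using True by (simp add: plain_darts_def)
      show ?thesis
        using fin_darts[OF D] edge_permutes[OF D] smooth_rot_permutes[OF D v] edge_inv[OF D] edge_fpf[OF D]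
          plain_fpf[OF M, unfolded pl smoothing_simps] plain_inv[OF M, unfolded pl smoothing_simps]
        by unfold_locales
    qed
    have rel: "(circle_steps D t)\<^sup>* = (graph_of (darts D) (smooth_rot D v (t v)) \<union> graph_of (darts D) (edge D))\<^sup>*" for t
      using circle_steps_smoothing[OF D v, of t t] circle_steps_resolved[of "smoothing D v (t v)" t] True by simp
    have ef: "e (edge D z) \<noteq> e z" if "z \<in> darts D" for z using e that by (simp add: alternating_def)
    have eg: "e (smooth_rot D v m z) \<noteq> e z" if "z \<in> darts D" for z m
      using alternating_smoothing[OF D e v, of m] that by (simp add: alternating_def)
    have in0: "dart_at D v 0 \<in> darts D" "dart_at D v 2 \<in> darts D"
      using dart_at_in[OF D v] darts_at_subset[OF D v] by blast+
    have e02: "e (dart_at D v 0) = e (dart_at D v 2)" using alternating_at[OF D e v] by simp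
    \<comment> \<open>The smoothings at \<open>v\<close> differ by the transpositions of darts 0, 2
      and of darts 1, 3. Darts 1 and 3 have the other orientation, so the second one does not act
      here.\<close>
    have sw: "smooth_rot D v (s' v) z = transpose (dart_at D v 0) (dart_at D v 2) (smooth_rot D v (s v) z)"
      if z: "e (smooth_rot D v (s v) z) = e (dart_at D v 0)" for z
    proof -
      have ne: "smooth_rot D v (s v) z \<noteq> dart_at D v (Suc 0)" "smooth_rot D v (s v) z \<noteq> dart_at D v 3"
        using z alternating_at[OF D e v] by auto
      from s(1) show ?thesis
      proof
        assume s: "s v = 1 \<and> s' v = -1"
        have "rot D z = transpose (dart_at D v 0) (dart_at D v 2) (smooth_rot D v (s v) z)"
          using s by (simp add: smooth_rot_eq[OF D v])
        moreover have "\<dots> \<noteq> dart_at D v (Suc 0)" "\<dots> \<noteq> dart_at D v 3"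
          using ne dart_at_distinct[OF D v] by (auto simp: transpose_def)
        ultimately show ?thesis using s by (simp add: smooth_rot_eq[OF D v])
      next
        assume s: "s v = -1 \<and> s' v = 1"
        have "rot D z = transpose (dart_at D v (Suc 0)) (dart_at D v 3) (smooth_rot D v (s v) z)"
          using s by (simp add: smooth_rot_eq[OF D v])
        also have "\<dots> = smooth_rot D v (s v) z" using ne by simp
        finally show ?thesis using s by (simp add: smooth_rot_eq[OF D v])
      qed
    qed
    show ?thesis
      unfolding rel
      using dihedral_orbits_switch[OF inv[of "s v"] inv[of "s' v"] ef eg eg in0 dart_at_distinct(2)[OF D v] e02 sw]
      by blast
  next
    case False
    then obtain w where w: "w \<in> crossings D" "w \<noteq> v" using v by blast
    let ?D' = "smoothing D w (s w)"
    have "n = card (crossings ?D')" using Suc(2) w fin_crossings[OF D] by simp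
    moreover have "diagram_map ?D'" by (rule diagram_map_smoothing[OF D w(1)])
    moreover have "alternating ?D' e" by (rule alternating_smoothing[OF D e w(1)])
    moreover have "v \<in> crossings ?D'" using v w by simp
    moreover have "circle_steps ?D' s = circle_steps D s" by (rule circle_steps_smoothing[OF D w(1)]) simp
    moreover have "circle_steps ?D' s' = circle_steps D s'"
      using circle_steps_smoothing[OF D w(1), of s' s'] s(2)[of w] w by simp
    moreover have "dart_at ?D' v k = dart_at D v k" for k by (rule dart_at_smoothing[OF D w(1) v w(2)[symmetric]])
    moreover have "\<And>u. u \<in> crossings ?D' - {v} \<Longrightarrow> s' u = s u" using s(2) by auto
    ultimately show ?thesis using Suc(1)[of ?D'] s(1) by metis
  qed
qed

text \<open>The trace of a saddle on the sets of circles, with \<open>T\<close> the darts at the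
  crossing. Requiring \<open>A \<union> B \<notin> P\<close> makes the union a new circle, so that
  the number of circles drops by exactly one. In this form the counting below is free of
  diagrams.\<close>

definition merges :: "'a set \<Rightarrow> 'a set set \<Rightarrow> 'a set set \<Rightarrow> bool" where
  "merges T P Q \<longleftrightarrow> (\<exists>A B. A \<in> P \<and> B \<in> P \<and> A \<noteq> B \<and> A \<union> B \<notin> P \<and> Q = P - {A, B} \<union> {A \<union> B} \<and>
     (\<forall>C\<in>P. C \<inter> T \<noteq> {} \<longleftrightarrow> C = A \<or> C = B))"

lemma mergesE:
  assumes "merges T P Q"
  obtains A B where "A \<in> P" "B \<in> P" "A \<noteq> B" "A \<union> B \<notin> P" "Q = P - {A, B} \<union> {A \<union> B}"
    "\<forall>C\<in>P. C \<inter> T \<noteq> {} \<longleftrightarrow> C = A \<or> C = B"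
  using assms unfolding merges_def by (elim exE conjE) (rule that)

lemma mergesI:
  assumes "A \<in> P" "B \<in> P" "A \<noteq> B" "A \<union> B \<notin> P" "Q = P - {A, B} \<union> {A \<union> B}"
    "\<And>C. C \<in> P \<Longrightarrow> C \<inter> T \<noteq> {} \<longleftrightarrow> C = A \<or> C = B"
  shows "merges T P Q"
  unfolding merges_def by (intro exI[of _ A] exI[of _ B] conjI ballI assms)

lemma sym_circle_rel:
  assumes D: "diagram_map D"
  shows "sym ((circle_steps D s)\<^sup>*)"
proof (rule sym_rtranclI)
  fix x y assume "(x, y) \<in> circle_steps D s"
  then consider "x \<in> darts D" "y = edge D x" | "x \<in> plain_darts D" "y = rot D x"
    | w where "w \<in> crossings D" "x \<in> darts_at D w" "y = smooth_rot D w (s w) x"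
    unfolding circle_steps_def graph_of_def by blast
  then have "(y, x) \<in> circle_steps D s"
  proof cases
    case 1
    then have "y \<in> darts D" "x = edge D y"
      using edge_inv[OF D] permutes_in_image[OF edge_permutes[OF D]] by simp_all
    then show ?thesis unfolding circle_steps_def graph_of_def by blast
  next
    case 2
    then have "rot D x \<in> plain_darts D"
      using rot_in_darts_at[OF D] permutes_in_image[OF rot_permutes[OF D]] unfolding plain_darts_def by simp
    then have "y \<in> plain_darts D" "x = rot D y" using 2 plain_inv[OF D] by simp_all
    then show ?thesis unfolding circle_steps_def graph_of_def by blast
  next
    case 3
    then have "y \<in> darts_at D w" "x = smooth_rot D w (s w) y"
      using smooth_rot_involution[OF D 3(1,2)] by simp_all
    then show ?thesis using 3(1) unfolding circle_steps_def graph_of_def by blast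
  qed
  then show "(y, x) \<in> (circle_steps D s)\<^sup>*" by blast
qed

text \<open>Either smoothing joins each of the darts 1 and 3 to dart 0 or dart 2; so at most two
  circles pass through a crossing.\<close>

lemma circle_of_darts_at:
  assumes D: "diagram_map D" and v: "v \<in> crossings D" and x: "x \<in> darts_at D v"
  shows "(dart_at D v 0, x) \<in> (circle_steps D s)\<^sup>* \<or> (dart_at D v 2, x) \<in> (circle_steps D s)\<^sup>*"
proof -
  have "(dart_at D v k, smooth_rot D v (s v) (dart_at D v k)) \<in> circle_steps D s" for k
    using dart_at_in[OF D v] v unfolding circle_steps_def graph_of_def by blast
  from this[of 0] this[of 2] x show ?thesis
    unfolding darts_at_eq using smooth_rot_at[OF D v, of "s v"] by (cases "s v = 1") auto
qed

lemma circles_switch_merges: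
  assumes D: "diagram_map D" and v: "v \<in> crossings D"
    and n: "(dart_at D v 0, dart_at D v 2) \<notin> (circle_steps D s)\<^sup>*"
    and eq: "(circle_steps D s')\<^sup>* = link ((circle_steps D s)\<^sup>*) (dart_at D v 0) (dart_at D v 2)"
  shows "merges (darts_at D v) (circles D s) (circles D s')"
proof -
  let ?E = "(circle_steps D s)\<^sup>*"
  let ?A = "?E `` {dart_at D v 0}" and ?B = "?E `` {dart_at D v 2}"
  have inD: "dart_at D v k \<in> darts D" for k using dart_at_in[OF D v] darts_at_subset[OF D v] by blast
  note q = quotient_link[OF sym_circle_rel[OF D] trans_rtrancl refl_rtrancl n inD inD]
  have cl: "C = ?E `` {x}" if "C \<in> circles D s" "x \<in> C" for C x
    using that sym_circle_rel[OF D, of s] unfolding circles_eq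
    by (auto elim!: quotientE dest: symD intro: rtrancl_trans)
  have "?A \<in> circles D s" "?B \<in> circles D s" unfolding circles_eq using inD by (auto intro: quotientI)
  moreover have "?A \<union> ?B \<notin> circles D s"
  proof
    assume a: "?A \<union> ?B \<in> circles D s"
    have "?A \<union> ?B = ?A" by (rule cl[OF a]) simp
    moreover have "?A \<union> ?B = ?B" by (rule cl[OF a]) simp
    ultimately show False using q(2) by simp
  qed
  moreover have "circles D s' = circles D s - {?A, ?B} \<union> {?A \<union> ?B}"
    unfolding circles_eq eq using q(1) .
  moreover have "C \<inter> darts_at D v \<noteq> {} \<longleftrightarrow> C = ?A \<or> C = ?B" if C: "C \<in> circles D s" for C
  proof
    assume "C \<inter> darts_at D v \<noteq> {}"
    then obtain x where x: "x \<in> C" "x \<in> darts_at D v" by blast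
    have "x \<in> ?A \<or> x \<in> ?B" using circle_of_darts_at[OF D v x(2)] by auto
    then show "C = ?A \<or> C = ?B" using cl[OF C x(1)] cl[OF \<open>?A \<in> circles D s\<close>] cl[OF \<open>?B \<in> circles D s\<close>]
      by blast
  next
    have "dart_at D v 0 \<in> ?A" "dart_at D v 2 \<in> ?B" by auto
    then show "C = ?A \<or> C = ?B \<Longrightarrow> C \<inter> darts_at D v \<noteq> {}" using dart_at_in[OF D v] by blast
  qed
  ultimately show ?thesis using q(2) by (intro mergesI)
qed

text \<open>Darts 0 and 2 lie on different circles in at least one of the two states, and the merge
  starts from that state.\<close>

theorem circles_switch:
  assumes "diagram_map D" "alternating D e" "v \<in> crossings D"
    and "s v = 1 \<and> s' v = -1 \<or> s v = -1 \<and> s' v = 1" "\<And>w. w \<in> crossings D - {v} \<Longrightarrow> s' w = s w"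
  shows "merges (darts_at D v) (circles D s) (circles D s') \<or> merges (darts_at D v) (circles D s') (circles D s)"
proof (cases "(dart_at D v 0, dart_at D v 2) \<in> (circle_steps D s)\<^sup>*")
  case True
  then have n: "(dart_at D v 0, dart_at D v 2) \<notin> (circle_steps D s')\<^sup>*"
    using circle_rel_switch[where s = s and s' = s', OF assms] by blast
  have "s' v = 1 \<and> s v = -1 \<or> s' v = -1 \<and> s v = 1" "\<And>w. w \<in> crossings D - {v} \<Longrightarrow> s w = s' w"
    using assms(4,5) by auto
  from circle_rel_switch[where s = s' and s' = s, OF assms(1-3) this] n circles_switch_merges[OF assms(1,3) n] show ?thesis by blast
next
  case False
  with circle_rel_switch[where s = s and s' = s', OF assms] circles_switch_merges[OF assms(1,3) False] show ?thesis by blast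
qed

lemma finite_circles: "diagram_map D \<Longrightarrow> finite (circles D s)"
  unfolding circles_eq quotient_def using fin_darts by simp

lemma merges_card:
  assumes "merges T P Q" "finite P"
  shows "int (card P) - int (card Q) = 1"
proof -
  obtain A B where AB: "A \<in> P" "B \<in> P" "A \<noteq> B" "A \<union> B \<notin> P" and Q: "Q = P - {A, B} \<union> {A \<union> B}"
    and "\<forall>C\<in>P. C \<inter> T \<noteq> {} \<longleftrightarrow> C = A \<or> C = B"
    using assms(1) by (rule mergesE)
  have "card Q = Suc (card (P - {A, B}))" unfolding Q using AB(4) assms(2) by simp
  moreover have "card (P - {A, B}) = card P - 2" using AB by (subst card_Diff_subset) auto
  moreover have "2 \<le> card P" using card_mono[of P "{A, B}"] AB assms(2) by simp
  ultimately show ?thesis by simp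
qed

text \<open>Adequacy provides two circles of \<open>s\<close> at \<open>v\<close>. If
  \<open>s\<close> arose from \<open>s'\<close> by a merge, only the merged circle would touch
  \<open>v\<close>; hence the merge goes from \<open>s\<close> to \<open>s'\<close>.\<close>

lemma adequate_switch:
  assumes "diagram_map D" "alternating D e" "v \<in> crossings D" "adequate_state D s"
    and "s v = 1 \<and> s' v = -1 \<or> s v = -1 \<and> s' v = 1" "\<And>w. w \<in> crossings D - {v} \<Longrightarrow> s' w = s w"
  shows "num_circles D s - num_circles D s' = 1"
proof -
  obtain C C' where C: "C \<in> circles D s" "C' \<in> circles D s" "C \<noteq> C'"
    "C \<inter> darts_at D v \<noteq> {}" "C' \<inter> darts_at D v \<noteq> {}"
    using bspec[OF assms(4)[unfolded adequate_state_def touches_def] assms(3)] by blast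
  have "\<not> merges (darts_at D v) (circles D s') (circles D s)"
  proof
    assume "merges (darts_at D v) (circles D s') (circles D s)"
    then obtain A B where "A \<in> circles D s'" "B \<in> circles D s'" "A \<noteq> B" "A \<union> B \<notin> circles D s'"
      and Q: "circles D s = circles D s' - {A, B} \<union> {A \<union> B}"
      and P: "\<forall>C\<in>circles D s'. C \<inter> darts_at D v \<noteq> {} \<longleftrightarrow> C = A \<or> C = B"
      by (rule mergesE)
    have KAB: "K = A \<union> B" if K: "K \<in> circles D s" "K \<inter> darts_at D v \<noteq> {}" for K
    proof (rule ccontr)
      assume "K \<noteq> A \<union> B"
      then have "K \<in> circles D s'" "K \<noteq> A" "K \<noteq> B" using K(1) Q by simp_all
      then show False using bspec[OF P, of K] K(2) by simp
    qed
    have "C = C'" using KAB[OF C(1,4)] KAB[OF C(2,5)] by simp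
    then show False using C(3) by simp
  qed
  then have "merges (darts_at D v) (circles D s) (circles D s')"
    using circles_switch[where s = s and s' = s', OF assms(1-3,5,6)] by blast
  from merges_card[OF this finite_circles[OF assms(1)]] show ?thesis by (simp add: num_circles_def)
qed

section \<open>Counting intermediate enhanced states\<close>

definition bifurcation :: "'a set \<Rightarrow> 'a set set \<Rightarrow> 'a set set \<Rightarrow> bool" where
  "bifurcation T P Q \<longleftrightarrow> merges T P Q \<or> merges T Q P"

text \<open>Decides whether the saddles at the crossings with darts \<open>T\<close> and
  \<open>U\<close> lie on one component of the cobordism.\<close>

definition linked :: "'a set \<Rightarrow> 'a set \<Rightarrow> 'a set set \<Rightarrow> bool" where
  "linked T U P \<longleftrightarrow> (\<exists>C\<in>P. C \<inter> T \<noteq> {} \<and> C \<inter> U \<noteq> {})"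

text \<open>The possible signs \<open>h\<close> on the intermediate circles \<open>M\<close>, given
  the signs \<open>f\<close> before and \<open>g\<close> after two changes of marker, the first at
  \<open>T\<close> and the second at \<open>U\<close>. The summand 1 keeps the degree: sigma drops
  by 2 with a change and sigma + 2 tau is fixed, so tau grows by 1.\<close>

definition colourings ::
  "'a set \<Rightarrow> 'a set \<Rightarrow> 'a set set \<Rightarrow> 'a set set \<Rightarrow> ('a set \<Rightarrow> int) \<Rightarrow> ('a set \<Rightarrow> int) \<Rightarrow> ('a set \<Rightarrow> int) set" where
  "colourings T U P M f g = {h \<in> M \<rightarrow>\<^sub>E {1, -1}. sum h M = sum f P + 1 \<and>
     (\<forall>C\<in>P. C \<inter> T = {} \<longrightarrow> f C = h C) \<and> (\<forall>C\<in>M. C \<inter> U = {} \<longrightarrow> h C = g C)}"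

lemma doubleton_mem_eq: "{a, b} = {c, d} \<Longrightarrow> x = a \<or> x = b \<longleftrightarrow> x = c \<or> x = d"
  by (auto simp: doubleton_eq_iff)

lemma touched_eqI:
  assumes "\<And>C. C \<in> S \<Longrightarrow> C \<in> P \<and> (C \<inter> T \<noteq> {} \<or> C \<inter> U \<noteq> {})"
    and "\<And>C. C \<in> P \<Longrightarrow> C \<notin> S \<Longrightarrow> C \<inter> T = {} \<and> C \<inter> U = {}"
  shows "{C\<in>P. C \<inter> T \<noteq> {} \<or> C \<inter> U \<noteq> {}} = S"
proof (intro equalityI subsetI)
  fix C assume "C \<in> {C\<in>P. C \<inter> T \<noteq> {} \<or> C \<inter> U \<noteq> {}}"
  then show "C \<in> S" using assms(2)[of C] by (cases "C \<in> S") simp_all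
qed (use assms(1) in simp)

lemma touched_memI:
  assumes "\<And>C. C \<in> P \<Longrightarrow> C \<inter> T \<noteq> {} \<Longrightarrow> C \<in> S" "\<And>C. C \<in> P \<Longrightarrow> C \<inter> U \<noteq> {} \<Longrightarrow> C \<in> S"
    and "\<And>C. C \<in> S \<Longrightarrow> C \<in> P \<and> (C \<inter> T \<noteq> {} \<or> C \<inter> U \<noteq> {})"
  shows "{C\<in>P. C \<inter> T \<noteq> {} \<or> C \<inter> U \<noteq> {}} = S"
proof (rule touched_eqI[OF assms(3)])
  fix C assume "C \<in> P" "C \<notin> S"
  then show "C \<inter> T = {} \<and> C \<inter> U = {}" using assms(1,2)[of C] by argo
qed

lemma touched_singleI:
  assumes "\<And>C. C \<in> P \<Longrightarrow> C \<inter> T \<noteq> {} \<or> C \<inter> U \<noteq> {} \<Longrightarrow> C = X"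
    and "X \<in> P" "X \<inter> T \<noteq> {} \<or> X \<inter> U \<noteq> {}"
  shows "{C\<in>P. C \<inter> T \<noteq> {} \<or> C \<inter> U \<noteq> {}} = {X}"
proof (intro equalityI subsetI)
  fix C assume "C \<in> {C\<in>P. C \<inter> T \<noteq> {} \<or> C \<inter> U \<noteq> {}}"
  then show "C \<in> {X}" using assms(1)[of C] by simp
qed (use assms(2,3) in simp)

lemma colouringsD:
  assumes "h \<in> colourings T U P M f g"
  shows "h \<in> M \<rightarrow>\<^sub>E {1, -1}" "sum h M = sum f P + 1" "C \<in> P \<Longrightarrow> C \<inter> T = {} \<Longrightarrow> f C = h C"
    "C \<in> M \<Longrightarrow> C \<inter> U = {} \<Longrightarrow> h C = g C"
  using assms unfolding colourings_def by simp_all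

lemma colouringsI:
  assumes "h \<in> M \<rightarrow>\<^sub>E {1, -1}" "sum h M = sum f P + 1" "\<And>C. C \<in> P \<Longrightarrow> C \<inter> T = {} \<Longrightarrow> f C = h C"
    "\<And>C. C \<in> M \<Longrightarrow> C \<inter> U = {} \<Longrightarrow> h C = g C"
  shows "h \<in> colourings T U P M f g"
  using assms unfolding colourings_def by simp

lemma merges_iff_untouched:
  assumes "merges T P Q" "C \<inter> T = {}"
  shows "C \<in> P \<longleftrightarrow> C \<in> Q"
proof -
  obtain A B where AB: "A \<in> P" "B \<in> P" "A \<noteq> B" "A \<union> B \<notin> P" and Q: "Q = P - {A, B} \<union> {A \<union> B}"
    and t: "\<forall>C\<in>P. C \<inter> T \<noteq> {} \<longleftrightarrow> C = A \<or> C = B"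
    using assms(1) by (rule mergesE)
  have "A \<inter> T \<noteq> {}" "B \<inter> T \<noteq> {}" using AB t by simp_all
  then have "C \<noteq> A" "C \<noteq> B" "C \<noteq> A \<union> B" using assms(2) by auto
  then show ?thesis by (simp add: Q)
qed

text \<open>The circles touching \<open>T\<close> have the same union \<open>A \<union> B\<close>
  before and after the merge.\<close>

lemma merges_linked:
  assumes "merges T P Q"
  shows "linked T U P \<longleftrightarrow> linked T U Q"
proof -
  obtain A B where AB: "A \<in> P" "B \<in> P" "A \<noteq> B" "A \<union> B \<notin> P" and Q: "Q = P - {A, B} \<union> {A \<union> B}"
    and t: "\<forall>C\<in>P. C \<inter> T \<noteq> {} \<longleftrightarrow> C = A \<or> C = B"
    using assms(1) by (rule mergesE)
  have tAB: "A \<inter> T \<noteq> {}" "B \<inter> T \<noteq> {}" using AB t by simp_all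
  have "linked T U P \<longleftrightarrow> A \<inter> U \<noteq> {} \<or> B \<inter> U \<noteq> {}"
  proof
    assume "linked T U P"
    then obtain C where C: "C \<in> P" "C \<inter> T \<noteq> {}" "C \<inter> U \<noteq> {}" unfolding linked_def by blast
    then have "C = A \<or> C = B" using t by simp
    then show "A \<inter> U \<noteq> {} \<or> B \<inter> U \<noteq> {}" using C(3) by auto
  next
    assume "A \<inter> U \<noteq> {} \<or> B \<inter> U \<noteq> {}"
    then show "linked T U P" unfolding linked_def using tAB AB(1,2) by blast
  qed
  also have "\<dots> \<longleftrightarrow> (A \<union> B) \<inter> U \<noteq> {}" by (simp add: Int_Un_distrib2)
  also have "\<dots> \<longleftrightarrow> linked T U Q"
  proof
    assume "(A \<union> B) \<inter> U \<noteq> {}"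
    moreover have "A \<union> B \<in> Q" "(A \<union> B) \<inter> T \<noteq> {}" using Q tAB(1) by auto
    ultimately show "linked T U Q" unfolding linked_def by (intro bexI[of _ "A \<union> B"] conjI)
  next
    assume "linked T U Q"
    then obtain C where C: "C \<in> Q" "C \<inter> T \<noteq> {}" "C \<inter> U \<noteq> {}" unfolding linked_def by blast
    have "C = A \<union> B" using C(1,2) t unfolding Q by auto
    then show "(A \<union> B) \<inter> U \<noteq> {}" using C(3) by simp
  qed
  finally show ?thesis .
qed

lemma bifurcation_iff_untouched: "bifurcation T P Q \<Longrightarrow> C \<inter> T = {} \<Longrightarrow> C \<in> P \<longleftrightarrow> C \<in> Q"
  unfolding bifurcation_def using merges_iff_untouched by metis

lemma bifurcation_linked: "bifurcation T P Q \<Longrightarrow> linked T U P \<longleftrightarrow> linked T U Q"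
  unfolding bifurcation_def using merges_linked by metis

lemma card_PiE_unique:
  assumes "k \<in> M \<rightarrow> V" "\<And>h. h \<in> M \<rightarrow>\<^sub>E V \<Longrightarrow> R h \<longleftrightarrow> (\<forall>C\<in>M. h C = k C)"
  shows "card {h \<in> M \<rightarrow>\<^sub>E V. R h} = 1"
proof -
  have r: "restrict k M \<in> M \<rightarrow>\<^sub>E V" using assms(1) by auto
  have "{h \<in> M \<rightarrow>\<^sub>E V. R h} = {restrict k M}"
  proof (intro equalityI subsetI)
    fix h assume "h \<in> {h \<in> M \<rightarrow>\<^sub>E V. R h}"
    then have h: "h \<in> M \<rightarrow>\<^sub>E V" "\<forall>C\<in>M. h C = k C" using assms(2)[of h] by blast+
    then show "h \<in> {restrict k M}" using PiE_ext[OF h(1) r] by simp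
  qed (use r assms(2)[OF r] in simp)
  then show ?thesis by simp
qed

text \<open>Circles off both crossings keep their sign throughout. They either exclude all
  colourings or cancel from the degree condition, and counting becomes local.\<close>

lemma card_colourings_off:
  assumes fin: "finite J" "finite K" "finite Z" and dj: "J \<inter> Z = {}" "K \<inter> Z = {}"
    and Z: "\<And>C. C \<in> Z \<Longrightarrow> C \<inter> T = {} \<and> C \<inter> U = {}" and f: "f \<in> Z \<rightarrow> {1, -1}"
    and K: "\<And>C. C \<in> K \<Longrightarrow> C \<inter> T = {} \<Longrightarrow> C \<in> J"
  shows "card (colourings T U (K \<union> Z) (J \<union> Z) f g) =
    (if \<forall>C\<in>Z. f C = g C then card (colourings T U K J f g) else 0)"
proof (cases "\<forall>C\<in>Z. f C = g C")
  case False
  have "colourings T U (K \<union> Z) (J \<union> Z) f g = {}"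
  proof (rule ccontr)
    assume "colourings T U (K \<union> Z) (J \<union> Z) f g \<noteq> {}"
    then obtain h where h: "h \<in> colourings T U (K \<union> Z) (J \<union> Z) f g" by blast
    have "f C = g C" if "C \<in> Z" for C
    proof -
      have "f C = h C" "h C = g C" using colouringsD(3,4)[OF h, of C] that Z[OF that] by simp_all
      then show ?thesis by simp
    qed
    with False show False by simp
  qed
  then show ?thesis unfolding if_not_P[OF False] by simp
next
  case True
  have sumh: "sum h Z = sum f Z" if "\<And>C. C \<in> Z \<Longrightarrow> h C = f C" for h using that by (intro sum.cong) auto
  have "bij_betw (\<lambda>h. restrict h J) (colourings T U (K \<union> Z) (J \<union> Z) f g) (colourings T U K J f g)"
  proof (rule bij_betw_byWitness[where f' = "\<lambda>k C. if C \<in> Z then f C else k C"])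
    show "\<forall>h\<in>colourings T U (K \<union> Z) (J \<union> Z) f g. (\<lambda>C. if C \<in> Z then f C else restrict h J C) = h"
    proof (intro ballI ext)
      fix h C assume h: "h \<in> colourings T U (K \<union> Z) (J \<union> Z) f g"
      have "f C = h C" if "C \<in> Z" using colouringsD(3)[OF h, of C] Z[OF that] that by simp
      moreover have "h C = undefined" if "C \<notin> J \<union> Z" using PiE_arb[OF colouringsD(1)[OF h] that] .
      ultimately show "(if C \<in> Z then f C else restrict h J C) = h C" by (simp add: restrict_def)
    qed
    show "\<forall>k\<in>colourings T U K J f g. restrict (\<lambda>C. if C \<in> Z then f C else k C) J = k"
    proof (intro ballI ext)
      fix k C assume k: "k \<in> colourings T U K J f g"
      have "k C = undefined" if "C \<notin> J" using PiE_arb[OF colouringsD(1)[OF k] that] .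
      then show "restrict (\<lambda>C. if C \<in> Z then f C else k C) J C = k C"
        using dj by (auto simp: restrict_def)
    qed
    show "(\<lambda>h. restrict h J) ` colourings T U (K \<union> Z) (J \<union> Z) f g \<subseteq> colourings T U K J f g"
    proof (rule image_subsetI)
      fix h assume h: "h \<in> colourings T U (K \<union> Z) (J \<union> Z) f g"
      have hf: "h C = f C" if "C \<in> Z" for C using colouringsD(3)[OF h, of C] that Z[OF that] by simp
      note s0 = colouringsD(2)[OF h]
      then have s: "sum h J = sum f K + 1"
        using sumh[OF hf] by (simp add: sum.union_disjoint fin dj)
      show "restrict h J \<in> colourings T U K J f g"
      proof (rule colouringsI)
        show "restrict h J \<in> J \<rightarrow>\<^sub>E {1, -1}" using colouringsD(1)[OF h] by auto
        show "f C = restrict h J C" if "C \<in> K" "C \<inter> T = {}" for C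
          using colouringsD(3)[OF h, of C] K[OF that] that by simp
        show "restrict h J C = g C" if "C \<in> J" "C \<inter> U = {}" for C
          using colouringsD(4)[OF h, of C] that by simp
      qed (use s in simp)
    qed
    show "(\<lambda>k C. if C \<in> Z then f C else k C) ` colourings T U K J f g
        \<subseteq> colourings T U (K \<union> Z) (J \<union> Z) f g"
    proof (rule image_subsetI)
      fix k assume k: "k \<in> colourings T U K J f g"
      let ?h = "\<lambda>C. if C \<in> Z then f C else k C"
      have JZ: "C \<notin> Z" if "C \<in> J" for C using that dj by blast
      have KZ: "C \<notin> Z" if "C \<in> K" for C using that dj by blast
      have "sum ?h J = sum k J" using JZ by (intro sum.cong) auto
      then have "sum ?h (J \<union> Z) = sum f (K \<union> Z) + 1"
        using colouringsD(2)[OF k] by (simp add: sum.union_disjoint fin dj)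
      moreover have "?h \<in> J \<union> Z \<rightarrow>\<^sub>E {1, -1}" 
        using colouringsD(1)[OF k] f JZ by (auto simp: PiE_iff Pi_iff extensional_def)
      ultimately show "?h \<in> colourings T U (K \<union> Z) (J \<union> Z) f g"
      proof (intro colouringsI)
        show "f C = ?h C" if "C \<in> K \<union> Z" "C \<inter> T = {}" for C
          using colouringsD(3)[OF k, of C] that by auto
        show "?h C = g C" if "C \<in> J \<union> Z" "C \<inter> U = {}" for C
          using colouringsD(4)[OF k, of C] that True by auto
      qed
    qed
  qed
  then show ?thesis using True bij_betw_same_card by auto
qed

text \<open>If both crossings meet one component of the cobordism from \<open>P\<close> to \<open>Q\<close>, the intermediate colouring
  is determined by its degree, except when that component has genus 1 (one circle splits in two, which
  merge again); then there are two.\<close>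

theorem card_colourings_linked:
  fixes f g :: "'a set \<Rightarrow> int"
  assumes fin: "finite P" and PM: "bifurcation T P M" and MQ: "bifurcation U M Q" and l: "linked T U P"
    and f: "f \<in> P \<rightarrow> {1, -1}" and g: "g \<in> Q \<rightarrow> {1, -1}" and fg: "sum g Q = sum f P + 2"
  shows "card (colourings T U P M f g) =
    (if \<forall>C\<in>P. C \<inter> T = {} \<and> C \<inter> U = {} \<longrightarrow> f C = g C then
       if card {C\<in>P. C \<inter> T \<noteq> {} \<or> C \<inter> U \<noteq> {}} = 1 \<and> card {C\<in>Q. C \<inter> T \<noteq> {} \<or> C \<inter> U \<noteq> {}} = 1
       then 2 else 1
     else 0)"
proof -
  let ?Z = "{C\<in>P. C \<inter> T = {} \<and> C \<inter> U = {}}"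
  let ?K = "{C\<in>P. C \<inter> T \<noteq> {} \<or> C \<inter> U \<noteq> {}}" and ?J = "{C\<in>M. C \<inter> T \<noteq> {} \<or> C \<inter> U \<noteq> {}}"
    and ?L = "{C\<in>Q. C \<inter> T \<noteq> {} \<or> C \<inter> U \<noteq> {}}"
  have lM: "linked T U M" using l bifurcation_linked[OF PM] by blast
  have ZM: "?Z = {C\<in>M. C \<inter> T = {} \<and> C \<inter> U = {}}" using bifurcation_iff_untouched[OF PM] by auto
  have ZQ: "?Z = {C\<in>Q. C \<inter> T = {} \<and> C \<inter> U = {}}"
    unfolding ZM using bifurcation_iff_untouched[OF MQ] by auto
  have P_eq: "P = ?K \<union> ?Z" by blast
  have M_eq: "M = ?J \<union> ?Z" unfolding ZM by blast
  have Q_eq: "Q = ?L \<union> ?Z" unfolding ZQ by blast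
  have finM: "finite M"
    using PM fin unfolding bifurcation_def merges_def by (elim disjE exE conjE) (auto dest: finite_subset)
  have finQ: "finite Q"
    using MQ finM unfolding bifurcation_def merges_def by (elim disjE exE conjE) (auto dest: finite_subset)
  have red: "card (colourings T U P M f g) = (if \<forall>C\<in>?Z. f C = g C then card (colourings T U ?K ?J f g) else 0)"
  proof -
    have "card (colourings T U (?K \<union> ?Z) (?J \<union> ?Z) f g) =
      (if \<forall>C\<in>?Z. f C = g C then card (colourings T U ?K ?J f g) else 0)"
    proof (rule card_colourings_off)
      show "C \<in> ?J" if "C \<in> ?K" "C \<inter> T = {}" for C
        using that bifurcation_iff_untouched[OF PM that(2)] by auto
    qed (use fin finM f in auto)
    then show ?thesis using P_eq M_eq by simp
  qed
  have main: "card (colourings T U ?K ?J f g) = (if card ?K = 1 \<and> card ?L = 1 then 2 else 1)"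
    if agree: "\<forall>C\<in>?Z. f C = g C"
  proof -
    have "sum g (?L \<union> ?Z) = sum f (?K \<union> ?Z) + 2" using fg P_eq Q_eq by simp
    moreover have "sum g (?L \<union> ?Z) = sum g ?L + sum g ?Z"
      by (intro sum.union_disjoint) (use fin finQ in auto)
    moreover have "sum f (?K \<union> ?Z) = sum f ?K + sum f ?Z"
      by (intro sum.union_disjoint) (use fin in auto)
    moreover have "sum f ?Z = sum g ?Z" using agree by (intro sum.cong) auto
    ultimately have loc: "sum g ?L = sum f ?K + 2" by simp
    have fV: "f C = 1 \<or> f C = -1" if "C \<in> ?K" for C using f that by auto
    have gV: "g C = 1 \<or> g C = -1" if "C \<in> ?L" for C using g that by auto
    consider (MM) "merges T P M" "merges U M Q" | (MS) "merges T P M" "merges U Q M"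
      | (SM) "merges T M P" "merges U M Q" | (SS) "merges T M P" "merges U Q M"
      using PM MQ unfolding bifurcation_def by blast
    then show ?thesis
    proof cases
      \<comment> \<open>Two merges: \<open>A\<close> and \<open>B\<close> are fused, and then the
        result with a third circle \<open>X\<close>, whose sign is copied from
        \<open>f\<close>.\<close>
      case MM
      from MM(1) obtain A B where AB: "A \<in> P" "B \<in> P" "A \<noteq> B" "A \<union> B \<notin> P" and M: "M = P - {A, B} \<union> {A \<union> B}"
        and t: "\<forall>C\<in>P. C \<inter> T \<noteq> {} \<longleftrightarrow> C = A \<or> C = B" by (rule mergesE)
      from MM(2) obtain E F where EF: "E \<in> M" "F \<in> M" "E \<noteq> F" "E \<union> F \<notin> M" and Q: "Q = M - {E, F} \<union> {E \<union> F}"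
        and u: "\<forall>C\<in>M. C \<inter> U \<noteq> {} \<longleftrightarrow> C = E \<or> C = F" by (rule mergesE)
      have "(A \<union> B) \<inter> U \<noteq> {}"
      proof -
        from lM obtain C where C: "C \<in> M" "C \<inter> T \<noteq> {}" "C \<inter> U \<noteq> {}" unfolding linked_def by blast
        then have "C = A \<union> B" using t unfolding M by auto
        then show ?thesis using C by simp
      qed
      then have "A \<union> B = E \<or> A \<union> B = F" using u unfolding M by auto
      then have "\<exists>X. {E, F} = {A \<union> B, X} \<and> X \<noteq> A \<union> B \<and> X \<in> M \<and> E \<union> F = A \<union> B \<union> X"
      proof
        assume "A \<union> B = E"
        then show ?thesis using EF(2,3) by (intro exI[of _ F]) simp
      next
        assume "A \<union> B = F"
        then show ?thesis using EF(1,3) by (intro exI[of _ E]) (simp add: insert_commute Un_commute)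
      qed
      then obtain X where X: "{E, F} = {A \<union> B, X}" "X \<noteq> A \<union> B" "X \<in> M" "E \<union> F = A \<union> B \<union> X"
        by blast
      note u' = u[unfolded doubleton_mem_eq[OF X(1)]]
      have ABM: "A \<union> B \<in> M" unfolding M by simp
      have XP: "X \<in> P" "X \<noteq> A" "X \<noteq> B" using X(2,3) unfolding M by auto
      have tX: "X \<inter> T = {}" using t XP by auto
      have uX: "X \<inter> U \<noteq> {}" "(A \<union> B) \<inter> U \<noteq> {}" using bspec[OF u' X(3)] bspec[OF u' ABM] by simp_all
      have tA: "A \<inter> T \<noteq> {}" "B \<inter> T \<noteq> {}" using t AB by auto
      have K: "?K = {A, B, X}"
      proof -
        have "C \<inter> U = {}" if "C \<in> P" "C \<noteq> A" "C \<noteq> B" "C \<noteq> X" for C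
        proof -
          have "C \<in> M" "C \<noteq> A \<union> B" using that AB(4) unfolding M by auto
          then show ?thesis using bspec[OF u', of C] that(4) by blast
        qed
        moreover have "C \<inter> T = {}" if "C \<in> P" "C \<noteq> A" "C \<noteq> B" for C using bspec[OF t, of C] that by blast
        ultimately show ?thesis using AB(1,2) XP(1) uX(1) tA by (intro touched_eqI) auto
      qed
      have J: "?J = {A \<union> B, X}"
      proof -
        have "C = A \<union> B" if "C \<in> M" "C \<inter> T \<noteq> {}" for C using that t unfolding M by auto
        moreover have "C = A \<union> B \<or> C = X" if "C \<in> M" "C \<inter> U \<noteq> {}" for C
          using that bspec[OF u', of C] by blast
        ultimately show ?thesis using X(3) ABM uX by (intro touched_eqI) auto
      qed
      have L: "?L = {A \<union> B \<union> X}"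
      proof -
        have "C = A \<union> B \<union> X" if "C \<in> Q" "C \<inter> T \<noteq> {} \<or> C \<inter> U \<noteq> {}" for C
        proof (rule ccontr)
          assume n: "C \<noteq> A \<union> B \<union> X"
          then have "C \<in> M" "\<not> (C = E \<or> C = F)" using that(1) X(4) unfolding Q by simp_all
          moreover from this(2) have "C \<notin> ?J" unfolding J doubleton_mem_eq[OF X(1)] by simp
          ultimately show False using that(2) by simp
        qed
        moreover have "A \<union> B \<union> X \<in> Q" using Q X(4) by simp
        moreover have "(A \<union> B \<union> X) \<inter> U \<noteq> {}" using uX(1) by auto
        ultimately show ?thesis by (intro touched_singleI disjI2)
      qed
      have v: "f A = 1 \<or> f A = -1" "f B = 1 \<or> f B = -1" "f X = 1 \<or> f X = -1" "g (A \<union> B \<union> X) = 1 \<or> g (A \<union> B \<union> X) = -1"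
        using fV gV unfolding K L by auto
      have tot: "g (A \<union> B \<union> X) = f A + f B + f X + 2" using loc unfolding K L using AB XP by auto
      have "card (colourings T U ?K ?J f g) = 1"
        unfolding colourings_def K J
      proof (rule card_PiE_unique[where k = "f(A \<union> B := f A + f B + 1)"])
        \<comment> \<open>The degree prescribes this sign for \<open>A \<union> B\<close>. The only
          bad value is 3, for two positive circles, and \<open>tot\<close> excludes it because a
          single sign follows. The other cases use the total degree in the same way.\<close>
        have "f A + f B + 1 = 1 \<or> f A + f B + 1 = -1" using v tot by presburger
        then show "f(A \<union> B := f A + f B + 1) \<in> {A \<union> B, X} \<rightarrow> {1, -1}" using v(3) X(2) by (simp add: Pi_iff)
        fix h assume "h \<in> {A \<union> B, X} \<rightarrow>\<^sub>E {1, - 1::int}"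
        show "(sum h {A \<union> B, X} = sum f {A, B, X} + 1 \<and> (\<forall>C\<in>{A, B, X}. C \<inter> T = {} \<longrightarrow> f C = h C) \<and>
            (\<forall>C\<in>{A \<union> B, X}. C \<inter> U = {} \<longrightarrow> h C = g C)) =
          (\<forall>C\<in>{A \<union> B, X}. h C = (f(A \<union> B := f A + f B + 1)) C)"
        proof -
          have "sum h {A \<union> B, X} = h (A \<union> B) + h X" using X(2) by simp
          moreover have "sum f {A, B, X} = f A + f B + f X" using AB(3) XP by simp
          moreover have "X \<noteq> A \<union> B" by (rule X(2))
          ultimately show ?thesis using tA tX uX by (simp; presburger)
        qed
      qed
      then show ?thesis unfolding K using AB XP by simp
    next
      \<comment> \<open>Merge and split: two circles become one and then two, and the one in the
        middle gets its sign from the degree.\<close>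
      case MS
      from MS(1) obtain A B where AB: "A \<in> P" "B \<in> P" "A \<noteq> B" "A \<union> B \<notin> P" and M: "M = P - {A, B} \<union> {A \<union> B}"
        and t: "\<forall>C\<in>P. C \<inter> T \<noteq> {} \<longleftrightarrow> C = A \<or> C = B" by (rule mergesE)
      from MS(2) obtain E F where EF: "E \<in> Q" "F \<in> Q" "E \<noteq> F" "E \<union> F \<notin> Q" and M': "M = Q - {E, F} \<union> {E \<union> F}"
        and u: "\<forall>C\<in>Q. C \<inter> U \<noteq> {} \<longleftrightarrow> C = E \<or> C = F" by (rule mergesE)
      have tM: "C = A \<union> B" if "C \<in> M" "C \<inter> T \<noteq> {}" for C using that t unfolding M by auto
      have uM: "C = E \<union> F" if "C \<in> M" "C \<inter> U \<noteq> {}" for C using that u unfolding M' by auto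
      have eq: "E \<union> F = A \<union> B" using lM tM uM unfolding linked_def by metis
      have tA: "A \<inter> T \<noteq> {}" "B \<inter> T \<noteq> {}" using t AB by auto
      have uE: "E \<inter> U \<noteq> {}" "F \<inter> U \<noteq> {}" using u EF by auto
      have J: "?J = {A \<union> B}"
      proof -
        have "A \<union> B \<in> M" "(A \<union> B) \<inter> T \<noteq> {}" using tA(1) M by auto
        moreover have "C = A \<union> B" if "C \<in> M" "C \<inter> T \<noteq> {} \<or> C \<inter> U \<noteq> {}" for C
          using that(2) tM[OF that(1)] uM[OF that(1)] eq by metis
        ultimately show ?thesis by (intro touched_singleI disjI1)
      qed
      have K: "?K = {A, B}"
      proof -
        have "C \<inter> U = {}" if "C \<in> P" "C \<noteq> A" "C \<noteq> B" for C
        proof -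
          have "C \<in> M" "C \<noteq> A \<union> B" using that AB(4) unfolding M by auto
          then show ?thesis using uM eq by auto
        qed
        moreover have "C \<inter> T = {}" if "C \<in> P" "C \<noteq> A" "C \<noteq> B" for C using bspec[OF t, of C] that by blast
        ultimately show ?thesis using AB(1,2) tA by (intro touched_eqI) auto
      qed
      have L: "?L = {E, F}"
      proof -
        have "C \<inter> T = {}" if "C \<in> Q" "C \<noteq> E" "C \<noteq> F" for C
        proof -
          have "C \<in> M" "C \<noteq> A \<union> B" using that EF(4) eq unfolding M' by auto
          then show ?thesis using tM by auto
        qed
        moreover have "C \<inter> U = {}" if "C \<in> Q" "C \<noteq> E" "C \<noteq> F" for C using bspec[OF u, of C] that by blast
        ultimately show ?thesis using EF(1,2) uE by (intro touched_eqI) auto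
      qed
      have v: "f A = 1 \<or> f A = -1" "f B = 1 \<or> f B = -1" "g E = 1 \<or> g E = -1" "g F = 1 \<or> g F = -1"
        using fV gV unfolding K L by auto
      have tot: "g E + g F = f A + f B + 2" using loc unfolding K L using AB EF by auto
      have uAB: "(A \<union> B) \<inter> U \<noteq> {}" using eq uE by auto
      have "card (colourings T U ?K ?J f g) = 1"
        unfolding colourings_def K J
      proof (rule card_PiE_unique[where k = "\<lambda>_. f A + f B + 1"])
        have "f A + f B + 1 = 1 \<or> f A + f B + 1 = -1" using v tot by presburger
        then show "(\<lambda>_. f A + f B + 1) \<in> {A \<union> B} \<rightarrow> {1, -1}" by (simp add: Pi_iff)
        fix h assume "h \<in> {A \<union> B} \<rightarrow>\<^sub>E {1, - 1::int}"
        show "(sum h {A \<union> B} = sum f {A, B} + 1 \<and> (\<forall>C\<in>{A, B}. C \<inter> T = {} \<longrightarrow> f C = h C) \<and>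
            (\<forall>C\<in>{A \<union> B}. C \<inter> U = {} \<longrightarrow> h C = g C)) = (\<forall>C\<in>{A \<union> B}. h C = f A + f B + 1)"
          using AB(3) tA uAB by simp
      qed
      then show ?thesis unfolding K using AB by simp
    next
      \<comment> \<open>Two splits: one circle becomes \<open>E \<union> F\<close> and
        \<open>X\<close>, and then \<open>E \<union> F\<close> is split. The sign of
        \<open>X\<close> is read off from \<open>g\<close>.\<close>
      case SS
      from SS(1) obtain A B where AB: "A \<in> M" "B \<in> M" "A \<noteq> B" "A \<union> B \<notin> M" and P: "P = M - {A, B} \<union> {A \<union> B}"
        and t: "\<forall>C\<in>M. C \<inter> T \<noteq> {} \<longleftrightarrow> C = A \<or> C = B" by (rule mergesE)
      from SS(2) obtain E F where EF: "E \<in> Q" "F \<in> Q" "E \<noteq> F" "E \<union> F \<notin> Q" and M: "M = Q - {E, F} \<union> {E \<union> F}"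
        and u: "\<forall>C\<in>Q. C \<inter> U \<noteq> {} \<longleftrightarrow> C = E \<or> C = F" by (rule mergesE)
      have uM: "C = E \<union> F" if "C \<in> M" "C \<inter> U \<noteq> {}" for C using that u unfolding M by auto
      have "E \<union> F = A \<or> E \<union> F = B" using lM uM t unfolding linked_def by metis
      then have "\<exists>X. {A, B} = {E \<union> F, X} \<and> X \<noteq> E \<union> F \<and> X \<in> M \<and> A \<union> B = E \<union> F \<union> X"
      proof
        assume "E \<union> F = A"
        then show ?thesis using AB(2,3) by (intro exI[of _ B]) simp
      next
        assume "E \<union> F = B"
        then show ?thesis using AB(1,3) by (intro exI[of _ A]) (simp add: insert_commute Un_commute)
      qed
      then obtain X where X: "{A, B} = {E \<union> F, X}" "X \<noteq> E \<union> F" "X \<in> M" "A \<union> B = E \<union> F \<union> X"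
        by blast
      note t' = t[unfolded doubleton_mem_eq[OF X(1)]]
      have EFM: "E \<union> F \<in> M" unfolding M by simp
      have XQ: "X \<in> Q" "X \<noteq> E" "X \<noteq> F" using X(2,3) unfolding M by auto
      have uX: "X \<inter> U = {}" using u XQ by auto
      have uE: "E \<inter> U \<noteq> {}" "F \<inter> U \<noteq> {}" using u EF by auto
      have tX: "X \<inter> T \<noteq> {}" "(E \<union> F) \<inter> T \<noteq> {}" using bspec[OF t' X(3)] bspec[OF t' EFM] by simp_all
      have J: "?J = {E \<union> F, X}"
      proof (rule touched_memI)
        show "C \<in> {E \<union> F, X}" if "C \<in> M" "C \<inter> T \<noteq> {}" for C using bspec[OF t' that(1)] that(2) by simp
        show "C \<in> {E \<union> F, X}" if "C \<in> M" "C \<inter> U \<noteq> {}" for C using uM[OF that] by simp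
      qed (use X(3) EFM tX in auto)
      have K: "?K = {E \<union> F \<union> X}"
      proof -
        have "C = E \<union> F \<union> X" if "C \<in> P" "C \<inter> T \<noteq> {} \<or> C \<inter> U \<noteq> {}" for C
        proof (rule ccontr)
          assume n: "C \<noteq> E \<union> F \<union> X"
          then have "C \<in> M" "\<not> (C = A \<or> C = B)" using that(1) X(4) unfolding P by simp_all
          moreover from this(2) have "C \<notin> ?J" unfolding J doubleton_mem_eq[OF X(1)] by simp
          ultimately show False using that(2) by simp
        qed
        moreover have "E \<union> F \<union> X \<in> P" using P X(4) by simp
        moreover have "(E \<union> F \<union> X) \<inter> T \<noteq> {}" using tX(1) by auto
        ultimately show ?thesis by (intro touched_singleI disjI1)
      qed
      have L: "?L = {E, F, X}"
      proof -
        have "C \<inter> T = {}" if "C \<in> Q" "C \<noteq> E" "C \<noteq> F" "C \<noteq> X" for C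
        proof -
          have "C \<in> M" "C \<noteq> E \<union> F" using that EF(4) unfolding M by auto
          then show ?thesis using bspec[OF t', of C] that(4) by blast
        qed
        moreover have "C \<inter> U = {}" if "C \<in> Q" "C \<noteq> E" "C \<noteq> F" for C using bspec[OF u that(1)] that(2,3) by simp
        ultimately show ?thesis using EF(1,2) XQ(1) uE tX(1) by (intro touched_eqI) auto
      qed
      have v: "g E = 1 \<or> g E = -1" "g F = 1 \<or> g F = -1" "g X = 1 \<or> g X = -1" "f (E \<union> F \<union> X) = 1 \<or> f (E \<union> F \<union> X) = -1"
        using fV gV unfolding K L by auto
      have tot: "g E + g F + g X = f (E \<union> F \<union> X) + 2" using loc unfolding K L using EF XQ by auto
      have "card (colourings T U ?K ?J f g) = 1"
        unfolding colourings_def K J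
      proof (rule card_PiE_unique[where k = "g(E \<union> F := f (E \<union> F \<union> X) + 1 - g X)"])
        have "f (E \<union> F \<union> X) + 1 - g X = 1 \<or> f (E \<union> F \<union> X) + 1 - g X = -1" using v tot by presburger
        then show "g(E \<union> F := f (E \<union> F \<union> X) + 1 - g X) \<in> {E \<union> F, X} \<rightarrow> {1, -1}" using v(3) X(2) by (simp add: Pi_iff)
        fix h assume "h \<in> {E \<union> F, X} \<rightarrow>\<^sub>E {1, - 1::int}"
        have "(E \<union> F \<union> X) \<inter> T \<noteq> {}" "(E \<union> F) \<inter> U \<noteq> {}" using tX uE by auto
        moreover have "sum h {E \<union> F, X} = h (E \<union> F) + h X" using X(2) by simp
        ultimately show "(sum h {E \<union> F, X} = sum f {E \<union> F \<union> X} + 1 \<and> (\<forall>C\<in>{E \<union> F \<union> X}. C \<inter> T = {} \<longrightarrow> f C = h C) \<and>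
            (\<forall>C\<in>{E \<union> F, X}. C \<inter> U = {} \<longrightarrow> h C = g C)) =
          (\<forall>C\<in>{E \<union> F, X}. h C = (g(E \<union> F := f (E \<union> F \<union> X) + 1 - g X)) C)"
          using X(2) uX by (simp; presburger)
      qed
      then show ?thesis unfolding L using EF XQ by simp
    next
      case SM
      from SM(1) obtain A B where AB: "A \<in> M" "B \<in> M" "A \<noteq> B" "A \<union> B \<notin> M" and P: "P = M - {A, B} \<union> {A \<union> B}"
        and t: "\<forall>C\<in>M. C \<inter> T \<noteq> {} \<longleftrightarrow> C = A \<or> C = B" by (rule mergesE)
      from SM(2) obtain E F where EF: "E \<in> M" "F \<in> M" "E \<noteq> F" "E \<union> F \<notin> M" and Q: "Q = M - {E, F} \<union> {E \<union> F}"
        and u: "\<forall>C\<in>M. C \<inter> U \<noteq> {} \<longleftrightarrow> C = E \<or> C = F" by (rule mergesE)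
      have tA: "A \<inter> T \<noteq> {}" "B \<inter> T \<noteq> {}" using t AB by auto
      have uE: "E \<inter> U \<noteq> {}" "F \<inter> U \<noteq> {}" using u EF by auto
      show ?thesis
      \<comment> \<open>Either the two halves of the split circle are merged again, which gives
        genus 1, or one half is merged with a third circle.\<close>
      proof (cases "{E, F} = {A, B}")
        case True
        then have eq: "E \<union> F = A \<union> B" by (auto simp: doubleton_eq_iff)
        note u' = u[unfolded doubleton_mem_eq[OF True]]
        have uA: "A \<inter> U \<noteq> {}" "B \<inter> U \<noteq> {}" using bspec[OF u' AB(1)] bspec[OF u' AB(2)] by simp_all
        have off: "C \<inter> T = {} \<and> C \<inter> U = {}" if "C \<in> M" "C \<noteq> A" "C \<noteq> B" for C
          using that bspec[OF t, of C] bspec[OF u', of C] by blast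
        have J: "?J = {A, B}" using AB(1,2) tA off by blast
        have K: "?K = {A \<union> B}"
        proof (rule touched_eqI)
          show "C \<inter> T = {} \<and> C \<inter> U = {}" if "C \<in> P" "C \<notin> {A \<union> B}" for C
            using off[of C] that unfolding P by auto
        qed (use tA(1) P in auto)
        have L: "?L = {A \<union> B}"
        proof (rule touched_eqI)
          show "C \<inter> T = {} \<and> C \<inter> U = {}" if "C \<in> Q" "C \<notin> {A \<union> B}" for C
          proof -
            have "C \<in> M" "\<not> (C = E \<or> C = F)" using that eq unfolding Q by auto
            then show ?thesis using off[of C] unfolding doubleton_mem_eq[OF True] by simp
          qed
        qed (use tA(1) Q eq in auto)
        have v: "f (A \<union> B) = 1 \<or> f (A \<union> B) = -1" "g (A \<union> B) = 1 \<or> g (A \<union> B) = -1"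
          using fV gV unfolding K L by auto
        have tot: "g (A \<union> B) = f (A \<union> B) + 2" using loc unfolding K L by auto
        \<comment> \<open>The signs must be negative before and positive after, so the two circles
          in between have opposite signs, in either order.\<close>
        then have fm: "f (A \<union> B) = -1" using v by auto
        let ?h = "\<lambda>a b. \<lambda>C\<in>{A, B}. if C = A then a else b :: int"
        have tAB: "(A \<union> B) \<inter> T \<noteq> {}" using tA by auto
        have mem: "?h a b \<in> colourings T U ?K ?J f g" if ab: "a \<in> {1, -1}" "b \<in> {1, -1}" "a + b = 0" for a b
          unfolding K J
        proof (rule colouringsI)
          show "?h a b \<in> {A, B} \<rightarrow>\<^sub>E {1, -1}" using ab(1,2) by simp
          show "sum (?h a b) {A, B} = sum f {A \<union> B} + 1" using AB(3) fm ab(3) by simp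
        qed (use tAB uA in auto)
        have "colourings T U ?K ?J f g = {?h 1 (-1), ?h (-1) 1}"
        proof (intro equalityI subsetI)
          fix h assume "h \<in> colourings T U ?K ?J f g"
          then have h: "h \<in> {A, B} \<rightarrow>\<^sub>E {1, -1}" "h A + h B = 0"
            unfolding colourings_def K J using AB(3) fm by simp_all
          have "?h (h A) (h B) \<in> {A, B} \<rightarrow>\<^sub>E {1, -1}" using h(1) by (auto simp: PiE_iff)
          then have eq: "h = ?h (h A) (h B)" by (intro PiE_ext[OF h(1)]) auto
          have "h A = 1 \<or> h A = -1" using h(1) by auto
          then consider "h A = 1" "h B = -1" | "h A = -1" "h B = 1" using h(2) by linarith
          then show "h \<in> {?h 1 (-1), ?h (-1) 1}"
          proof cases
            case 1 show ?thesis by (subst eq[unfolded 1]) simp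
          next
            case 2 show ?thesis by (subst eq[unfolded 2]) simp
          qed
        next
          fix h assume "h \<in> {?h 1 (-1), ?h (-1) 1}"
          then consider "h = ?h 1 (-1)" | "h = ?h (-1) 1" by blast
          then show "h \<in> colourings T U ?K ?J f g"
          proof cases
            case 1 show ?thesis unfolding 1 by (rule mem) simp_all
          next
            case 2 show ?thesis unfolding 2 by (rule mem) simp_all
          qed
        qed
        moreover have "?h 1 (-1) \<noteq> ?h (-1) 1" by (auto dest: fun_cong[of _ _ A])
        ultimately show ?thesis unfolding K L by simp
      next
        case False
        obtain C where "C \<in> M" "C \<inter> T \<noteq> {}" "C \<inter> U \<noteq> {}" using lM unfolding linked_def by blast
        then have "E = A \<or> E = B \<or> F = A \<or> F = B" using t u by metis
        \<comment> \<open>\<open>X\<close> is the circle on which both saddles act, \<open>Y\<close>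
          the other half of the split circle and \<open>W\<close> the other partner of the merge.
          The sign of \<open>Y\<close> comes from \<open>g\<close>, that of \<open>W\<close> from
          \<open>f\<close>, and that of \<open>X\<close> from the degree.\<close>
        then obtain X Y W where XY: "{A, B} = {X, Y}" "{E, F} = {X, W}" using insert_commute by metis
        have ne: "X \<noteq> Y" "X \<noteq> W" "Y \<noteq> W" using XY AB(3) EF(3) False by (auto simp: doubleton_eq_iff)
        have eq: "A \<union> B = X \<union> Y" "E \<union> F = X \<union> W" using XY by (auto simp: doubleton_eq_iff)
        have inM: "X \<in> M" "Y \<in> M" "W \<in> M" using XY AB EF by (auto simp: doubleton_eq_iff)
        have t': "C \<inter> T \<noteq> {} \<longleftrightarrow> C = X \<or> C = Y" if "C \<in> M" for C
          by (rule bspec[OF t[unfolded doubleton_mem_eq[OF XY(1)]] that])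
        have u': "C \<inter> U \<noteq> {} \<longleftrightarrow> C = X \<or> C = W" if "C \<in> M" for C
          by (rule bspec[OF u[unfolded doubleton_mem_eq[OF XY(2)]] that])
        have tt: "X \<inter> T \<noteq> {}" "Y \<inter> T \<noteq> {}" "W \<inter> T = {}" "X \<inter> U \<noteq> {}" "W \<inter> U \<noteq> {}" "Y \<inter> U = {}"
          using t' u' inM ne by blast+
        have P': "P = M - {X, Y} \<union> {X \<union> Y}" and Q': "Q = M - {X, W} \<union> {X \<union> W}" using P Q XY eq by simp_all
        have nn: "X \<union> Y \<notin> M" "X \<union> W \<notin> M" using AB(4) EF(4) eq by simp_all
        have off: "C \<inter> T = {} \<and> C \<inter> U = {}" if "C \<in> M" "C \<noteq> X" "C \<noteq> Y" "C \<noteq> W" for C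
          using that t' u' by blast
        have J: "?J = {X, Y, W}" using inM tt off by (intro touched_eqI) auto
        have K: "?K = {X \<union> Y, W}"
        proof (rule touched_eqI)
          show "C \<inter> T = {} \<and> C \<inter> U = {}" if "C \<in> P" "C \<notin> {X \<union> Y, W}" for C
            using off[of C] that unfolding P' by auto
        qed (use tt(1,5) inM ne P' in auto)
        have L: "?L = {X \<union> W, Y}"
        proof (rule touched_eqI)
          show "C \<inter> T = {} \<and> C \<inter> U = {}" if "C \<in> Q" "C \<notin> {X \<union> W, Y}" for C
            using off[of C] that unfolding Q' by auto
        qed (use tt(1,2) inM ne Q' in auto)
        have ne': "X \<union> Y \<noteq> W" "X \<union> W \<noteq> Y" using nn inM by auto
        have v: "f (X \<union> Y) = 1 \<or> f (X \<union> Y) = -1" "f W = 1 \<or> f W = -1"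
          "g (X \<union> W) = 1 \<or> g (X \<union> W) = -1" "g Y = 1 \<or> g Y = -1"
          using fV gV unfolding K L by auto
        have tot: "g (X \<union> W) + g Y = f (X \<union> Y) + f W + 2" using loc unfolding K L using ne' by auto
        let ?h0 = "\<lambda>C. if C = X then f (X \<union> Y) + 1 - g Y else if C = Y then g Y else f C"
        have "card (colourings T U ?K ?J f g) = 1"
          unfolding colourings_def K J
        proof (rule card_PiE_unique[where k = ?h0])
          have "f (X \<union> Y) + 1 - g Y = 1 \<or> f (X \<union> Y) + 1 - g Y = -1" using v tot by presburger
          then show "?h0 \<in> {X, Y, W} \<rightarrow> {1, -1}" using v(2,4) ne(1) by (simp add: Pi_iff)
          fix h assume "h \<in> {X, Y, W} \<rightarrow>\<^sub>E {1, - 1::int}"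
          have "(X \<union> Y) \<inter> T \<noteq> {}" using tt by auto
          moreover have "sum h {X, Y, W} = h X + h Y + h W" using ne by simp
          moreover have "sum f {X \<union> Y, W} = f (X \<union> Y) + f W" using ne' by simp
          ultimately show "(sum h {X, Y, W} = sum f {X \<union> Y, W} + 1 \<and> (\<forall>C\<in>{X \<union> Y, W}. C \<inter> T = {} \<longrightarrow> f C = h C) \<and>
              (\<forall>C\<in>{X, Y, W}. C \<inter> U = {} \<longrightarrow> h C = g C)) = (\<forall>C\<in>{X, Y, W}. h C = ?h0 C)"
            using ne ne' tt by (simp; presburger)
        qed
        then show ?thesis unfolding K L using ne' by simp
      qed
    qed
  qed
  show ?thesis
  proof (cases "\<forall>C\<in>?Z. f C = g C")
    case True
    then have t: "\<forall>C\<in>P. C \<inter> T = {} \<and> C \<inter> U = {} \<longrightarrow> f C = g C" by blast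
    from red[unfolded if_P[OF True]] main[OF True] show ?thesis unfolding if_P[OF t] by (rule trans)
  next
    case False
    then have t: "\<not> (\<forall>C\<in>P. C \<inter> T = {} \<and> C \<inter> U = {} \<longrightarrow> f C = g C)" by blast
    from red[unfolded if_not_P[OF False]] show ?thesis unfolding if_not_P[OF t] .
  qed
qed

section \<open>Crossings without a common circle, and independence of the order\<close>

lemma sum_split_touched:
  assumes "finite P" "\<And>C. C \<in> P \<Longrightarrow> C \<inter> T = {} \<or> C \<inter> U = {}"
  shows "sum f P = sum f {C\<in>P. C \<inter> U \<noteq> {}} + (sum f {C\<in>P. C \<inter> T \<noteq> {}} +
    sum f {C\<in>P. C \<inter> T = {} \<and> C \<inter> U = {}})"
proof -
  let ?A = "{C\<in>P. C \<inter> U \<noteq> {}}" and ?B = "{C\<in>P. C \<inter> T \<noteq> {}}" and ?Z = "{C\<in>P. C \<inter> T = {} \<and> C \<inter> U = {}}"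
  have "P = ?A \<union> (?B \<union> ?Z)" by blast
  then have "sum f P = sum f (?A \<union> (?B \<union> ?Z))" by simp
  also have "\<dots> = sum f ?A + sum f (?B \<union> ?Z)" using assms by (intro sum.union_disjoint) auto
  also have "sum f (?B \<union> ?Z) = sum f ?B + sum f ?Z" using assms(1) by (intro sum.union_disjoint) auto
  finally show ?thesis .
qed

text \<open>The two changes act on disjoint families of circles, so every intermediate sign is
  forced: circles off \<open>U\<close> already have their final sign, circles at \<open>U\<close>
  still have their initial one. What remains is the degree condition for the change at
  \<open>T\<close>.\<close>

lemma card_colourings_unlinked:
  fixes f g :: "'a set \<Rightarrow> int"
  assumes fin: "finite P" "finite M" "finite Q"
    and PM: "bifurcation T P M" and MQ: "bifurcation U M Q" and l: "\<not> linked T U P"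
    and f: "f \<in> P \<rightarrow> {1, -1}" and g: "g \<in> Q \<rightarrow> {1, -1}"
  shows "card (colourings T U P M f g) =
    (if (\<forall>C\<in>P. C \<inter> T = {} \<and> C \<inter> U = {} \<longrightarrow> f C = g C) \<and>
       sum g {C\<in>Q. C \<inter> T \<noteq> {}} = sum f {C\<in>P. C \<inter> T \<noteq> {}} + 1 then 1 else 0)"
proof -
  let ?Z = "{C\<in>P. C \<inter> T = {} \<and> C \<inter> U = {}}"
  have lM: "\<not> linked T U M" using l bifurcation_linked[OF PM] by blast
  have lP: "C \<inter> T = {} \<or> C \<inter> U = {}" if "C \<in> P" for C using l that unfolding linked_def by blast
  have lM': "C \<inter> T = {} \<or> C \<inter> U = {}" if "C \<in> M" for C using lM that unfolding linked_def by blast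
  have t: "C \<in> P \<longleftrightarrow> C \<in> M" if "C \<inter> T = {}" for C using bifurcation_iff_untouched[OF PM that] .
  have u: "C \<in> M \<longleftrightarrow> C \<in> Q" if "C \<inter> U = {}" for C using bifurcation_iff_untouched[OF MQ that] .
  have Qt: "C \<inter> U = {}" if "C \<in> Q" "C \<inter> T \<noteq> {}" for C
  proof -
    have "linked U T M \<longleftrightarrow> linked U T Q" by (rule bifurcation_linked[OF MQ])
    then have "\<not> linked U T Q" using lM unfolding linked_def by blast
    then show ?thesis using that unfolding linked_def by blast
  qed
  let ?h = "\<lambda>C. if C \<inter> U = {} then g C else f C"
  have char: "(\<forall>C\<in>P. C \<inter> T = {} \<longrightarrow> f C = h C) \<and> (\<forall>C\<in>M. C \<inter> U = {} \<longrightarrow> h C = g C) \<longleftrightarrow>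
    (\<forall>C\<in>M. h C = ?h C) \<and> (\<forall>C\<in>?Z. f C = g C)" for h
  proof
    assume c: "(\<forall>C\<in>P. C \<inter> T = {} \<longrightarrow> f C = h C) \<and> (\<forall>C\<in>M. C \<inter> U = {} \<longrightarrow> h C = g C)"
    have "h C = ?h C" if C: "C \<in> M" for C
    proof (cases "C \<inter> U = {}")
      case False
      then have "C \<inter> T = {}" using lM'[OF C] by blast
      then show ?thesis using False c t C by simp
    qed (use c C in simp)
    moreover have "f C = g C" if "C \<in> ?Z" for C
    proof -
      have C: "C \<in> P" "C \<inter> T = {}" "C \<inter> U = {}" using that by simp_all
      then have "C \<in> M" using t by simp
      then show ?thesis using c C by simp
    qed
    ultimately show "(\<forall>C\<in>M. h C = ?h C) \<and> (\<forall>C\<in>?Z. f C = g C)" by blast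
  next
    assume c: "(\<forall>C\<in>M. h C = ?h C) \<and> (\<forall>C\<in>?Z. f C = g C)"
    have "f C = h C" if C: "C \<in> P" "C \<inter> T = {}" for C
    proof -
      have "C \<in> M" using C t by simp
      then have "h C = ?h C" using c by blast
      then show ?thesis using C c by (cases "C \<inter> U = {}") simp_all
    qed
    moreover have "h C = g C" if "C \<in> M" "C \<inter> U = {}" for C using c that by simp
    ultimately show "(\<forall>C\<in>P. C \<inter> T = {} \<longrightarrow> f C = h C) \<and> (\<forall>C\<in>M. C \<inter> U = {} \<longrightarrow> h C = g C)"
      by (intro conjI ballI impI)
  qed
  have M_eq: "M = {C\<in>P. C \<inter> U \<noteq> {}} \<union> ({C\<in>Q. C \<inter> T \<noteq> {}} \<union> ?Z)"
  proof (intro equalityI subsetI)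
    fix C assume C: "C \<in> M"
    show "C \<in> {C\<in>P. C \<inter> U \<noteq> {}} \<union> ({C\<in>Q. C \<inter> T \<noteq> {}} \<union> ?Z)"
      using C lM'[OF C] t[of C] u[of C] by (cases "C \<inter> U = {}"; cases "C \<inter> T = {}") simp_all
  next
    fix C assume "C \<in> {C\<in>P. C \<inter> U \<noteq> {}} \<union> ({C\<in>Q. C \<inter> T \<noteq> {}} \<union> ?Z)"
    then consider "C \<in> P" "C \<inter> U \<noteq> {}" | "C \<in> Q" "C \<inter> T \<noteq> {}" | "C \<in> P" "C \<inter> T = {}" by blast
    then show "C \<in> M"
    proof cases
      case 1 then show ?thesis using lP[of C] t[of C] by simp
    next
      case 2 then show ?thesis using Qt[of C] u[of C] by simp
    next
      case 3 then show ?thesis using t[of C] by simp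
    qed
  qed
  have sM: "sum ?h M = sum f {C\<in>P. C \<inter> U \<noteq> {}} + (sum g {C\<in>Q. C \<inter> T \<noteq> {}} + sum g ?Z)"
  proof -
    have "sum ?h M = sum ?h {C\<in>P. C \<inter> U \<noteq> {}} + (sum ?h {C\<in>Q. C \<inter> T \<noteq> {}} + sum ?h ?Z)"
    proof -
      have "sum ?h M = sum ?h ({C\<in>P. C \<inter> U \<noteq> {}} \<union> ({C\<in>Q. C \<inter> T \<noteq> {}} \<union> ?Z))" using M_eq by simp
      also have "\<dots> = sum ?h {C\<in>P. C \<inter> U \<noteq> {}} + sum ?h ({C\<in>Q. C \<inter> T \<noteq> {}} \<union> ?Z)"
        using fin Qt by (intro sum.union_disjoint) auto
      also have "sum ?h ({C\<in>Q. C \<inter> T \<noteq> {}} \<union> ?Z) = sum ?h {C\<in>Q. C \<inter> T \<noteq> {}} + sum ?h ?Z"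
        using fin by (intro sum.union_disjoint) auto
      finally show ?thesis .
    qed
    moreover have "sum ?h {C\<in>P. C \<inter> U \<noteq> {}} = sum f {C\<in>P. C \<inter> U \<noteq> {}}" by (intro sum.cong) auto
    moreover have "sum ?h {C\<in>Q. C \<inter> T \<noteq> {}} = sum g {C\<in>Q. C \<inter> T \<noteq> {}}" using Qt by (intro sum.cong) auto
    moreover have "sum ?h ?Z = sum g ?Z" by (intro sum.cong) auto
    ultimately show ?thesis by simp
  qed
  have sP: "sum f P = sum f {C\<in>P. C \<inter> U \<noteq> {}} + (sum f {C\<in>P. C \<inter> T \<noteq> {}} + sum f ?Z)"
    by (rule sum_split_touched[OF fin(1) lP])
  have hV: "?h \<in> M \<rightarrow> {1, -1}"
  proof
    fix C assume C: "C \<in> M"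
    show "?h C \<in> {1, -1}"
    proof (cases "C \<inter> U = {}")
      case True
      then have "C \<in> Q" using u C by blast
      with g have "g C \<in> {1, -1}" by (rule funcset_mem)
      then show ?thesis using True by simp
    next
      case False
      then have "C \<in> P" using t lM'[OF C] C by blast
      with f have "f C \<in> {1, -1}" by (rule funcset_mem)
      then show ?thesis using False by simp
    qed
  qed
  have sh: "sum h M = sum ?h M" if "\<forall>C\<in>M. h C = ?h C" for h using that by (intro sum.cong) auto
  show ?thesis
  proof (cases "(\<forall>C\<in>?Z. f C = g C) \<and> sum g {C\<in>Q. C \<inter> T \<noteq> {}} = sum f {C\<in>P. C \<inter> T \<noteq> {}} + 1")
    case True
    then have "sum f ?Z = sum g ?Z" by (intro sum.cong) auto
    then have s1: "sum ?h M = sum f P + 1" using sM sP True by simp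
    have "card (colourings T U P M f g) = 1"
      unfolding colourings_def
    proof (rule card_PiE_unique[OF hV], unfold char, rule iffI)
      fix h assume D: "\<forall>C\<in>M. h C = ?h C"
      then show "sum h M = sum f P + 1 \<and> (\<forall>C\<in>M. h C = ?h C) \<and> (\<forall>C\<in>?Z. f C = g C)"
        by (intro conjI D conjunct1[OF True]) (simp only: sh[OF D] s1)
    qed (elim conjE)
    then show ?thesis using True by simp
  next
    case False
    have "colourings T U P M f g = {}"
    proof (rule ccontr)
      assume "colourings T U P M f g \<noteq> {}"
      then obtain h where h: "sum h M = sum f P + 1"
        "(\<forall>C\<in>P. C \<inter> T = {} \<longrightarrow> f C = h C) \<and> (\<forall>C\<in>M. C \<inter> U = {} \<longrightarrow> h C = g C)"
        unfolding colourings_def by blast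
      then have c: "\<forall>C\<in>M. h C = ?h C" "\<forall>C\<in>?Z. f C = g C" using char[of h] by blast+
      then have "sum f ?Z = sum g ?Z" by (intro sum.cong) auto
      then have "sum g {C\<in>Q. C \<inter> T \<noteq> {}} = sum f {C\<in>P. C \<inter> T \<noteq> {}} + 1"
        using h(1) sh[OF c(1)] sM sP by simp
      with False c show False by blast
    qed
    then show ?thesis using False by auto
  qed
qed

text \<open>In the linked case the count is an expression in \<open>P\<close>, \<open>Q\<close>,
  \<open>f\<close>, \<open>g\<close> that is symmetric in \<open>T\<close> and \<open>U\<close>. In
  the unlinked case the degree conditions at \<open>T\<close> and at \<open>U\<close> have to be
  compared.\<close>

theorem card_colourings_commute:
  fixes f g :: "'a set \<Rightarrow> int"
  assumes fin: "finite P" "finite M" "finite M'" "finite Q"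
    and b: "bifurcation T P M" "bifurcation U M Q" "bifurcation U P M'" "bifurcation T M' Q"
    and f: "f \<in> P \<rightarrow> {1, -1}" and g: "g \<in> Q \<rightarrow> {1, -1}" and fg: "sum g Q = sum f P + 2"
  shows "card (colourings T U P M f g) = card (colourings U T P M' f g)"
proof (cases "linked T U P")
  case True
  then have "linked U T P" unfolding linked_def by blast
  then have "card (colourings U T P M' f g) =
    (if \<forall>C\<in>P. C \<inter> U = {} \<and> C \<inter> T = {} \<longrightarrow> f C = g C then
       if card {C\<in>P. C \<inter> U \<noteq> {} \<or> C \<inter> T \<noteq> {}} = 1 \<and> card {C\<in>Q. C \<inter> U \<noteq> {} \<or> C \<inter> T \<noteq> {}} = 1
       then 2 else 1
     else 0)"
    by (rule card_colourings_linked[OF fin(1) b(3,4) _ f g fg])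
  then show ?thesis
    unfolding card_colourings_linked[OF fin(1) b(1,2) True f g fg]
      conj_commute[of "_ \<inter> U = {}"] disj_commute[of "_ \<inter> U \<noteq> {}"] by (rule sym)
next
  case False
  then have l': "\<not> linked U T P" unfolding linked_def by blast
  let ?Z = "{C\<in>P. C \<inter> T = {} \<and> C \<inter> U = {}}"
  have lP: "C \<inter> T = {} \<or> C \<inter> U = {}" if "C \<in> P" for C using False that unfolding linked_def by blast
  have "\<not> linked T U M" using False bifurcation_linked[OF b(1)] by blast
  then have "\<not> linked U T M" unfolding linked_def by blast
  then have "\<not> linked U T Q" using bifurcation_linked[OF b(2)] by blast
  then have lQ: "C \<inter> T = {} \<or> C \<inter> U = {}" if "C \<in> Q" for C using that unfolding linked_def by blast
  have ZQ: "?Z = {C\<in>Q. C \<inter> T = {} \<and> C \<inter> U = {}}"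
    using bifurcation_iff_untouched[OF b(1)] bifurcation_iff_untouched[OF b(2)] by blast
  have sP: "sum f P = sum f {C\<in>P. C \<inter> U \<noteq> {}} + (sum f {C\<in>P. C \<inter> T \<noteq> {}} + sum f ?Z)"
    by (rule sum_split_touched[OF fin(1) lP])
  have sQ: "sum g Q = sum g {C\<in>Q. C \<inter> U \<noteq> {}} + (sum g {C\<in>Q. C \<inter> T \<noteq> {}} + sum g ?Z)"
    unfolding ZQ by (rule sum_split_touched[OF fin(4) lQ])
  \<comment> \<open>The total degree rises by 2 and the circles off both crossings contribute
    nothing, so a rise by 1 at one crossing means a rise by 1 at the other.\<close>
  have "sum g {C\<in>Q. C \<inter> T \<noteq> {}} = sum f {C\<in>P. C \<inter> T \<noteq> {}} + 1 \<longleftrightarrow>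
      sum g {C\<in>Q. C \<inter> U \<noteq> {}} = sum f {C\<in>P. C \<inter> U \<noteq> {}} + 1"
    if "\<forall>C\<in>?Z. f C = g C"
  proof -
    have "sum f ?Z = sum g ?Z" using that by (intro sum.cong) auto
    then show ?thesis using sP sQ fg by linarith
  qed
  then show ?thesis
    unfolding card_colourings_unlinked[OF fin(1,2,4) b(1,2) False f g]
      card_colourings_unlinked[OF fin(1,3,4) b(3,4) l' f g]
    by (auto simp: conj_commute)
qed

section \<open>The differential squares to zero\<close>

lemma card_signs_eq_sum:
  fixes f :: "'a \<Rightarrow> int"
  assumes "finite A" "f \<in> A \<rightarrow> {1, -1}"
  shows "int (card {x\<in>A. f x = 1}) - int (card {x\<in>A. f x = -1}) = sum f A"
proof -
  have "sum f A = (\<Sum>x\<in>A. of_bool (f x = 1) - of_bool (f x = -1))"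
    by (intro sum.cong) (use assms(2) in auto)
  also have "\<dots> = int (card {x\<in>A. f x = 1}) - int (card {x\<in>A. f x = -1})"
    using assms(1) by (simp add: sum_subtractf sum_of_bool_eq Int_def)
  finally show ?thesis by simp
qed

definition agree_off :: "diagram \<Rightarrow> nat \<Rightarrow> enhanced_state \<Rightarrow> enhanced_state \<Rightarrow> bool" where
  "agree_off D v S T \<longleftrightarrow> (\<forall>C\<in>circles D (fst S). C \<inter> darts_at D v = {} \<longrightarrow> snd S C = snd T C)"

definition negatives_above :: "diagram \<Rightarrow> (nat \<Rightarrow> int) \<Rightarrow> nat \<Rightarrow> nat" where
  "negatives_above D s v = card {w \<in> crossings D. s w = -1 \<and> v < w}"

definition coeff :: "diagram \<Rightarrow> enhanced_state \<Rightarrow> enhanced_state \<Rightarrow> int" where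
  "coeff D S T = (-1) ^ sign_exp D S T * incidence D S T"

lemma enhanced_statesD:
  assumes "S \<in> enhanced_states D"
  shows "fst S \<in> crossings D \<rightarrow>\<^sub>E {1, -1}" "snd S \<in> circles D (fst S) \<rightarrow>\<^sub>E {1, -1}"
  using assms by (auto simp: enhanced_states_def states_def)

lemma state_values:
  assumes "s \<in> crossings D \<rightarrow>\<^sub>E {1, -1::int}" "v \<in> crossings D"
  shows "s v = 1 \<or> s v = -1"
  using assms by auto

lemma sigma_eq_sum:
  assumes "finite (crossings D)" "fst S \<in> crossings D \<rightarrow>\<^sub>E {1, -1}"
  shows "sigma D S = sum (fst S) (crossings D)"
  unfolding sigma_def using assms by (intro card_signs_eq_sum) auto

lemma tau_eq_sum:
  assumes "diagram_map D" "S \<in> enhanced_states D"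
  shows "tau D S = sum (snd S) (circles D (fst S))"
  unfolding tau_def using enhanced_statesD(2)[OF assms(2)] finite_circles[OF assms(1)]
  by (intro card_signs_eq_sum) auto

lemma finite_enhanced_states:
  assumes "diagram_map D" shows "finite (enhanced_states D)"
  unfolding enhanced_states_def states_def
  using fin_crossings[OF assms] finite_circles[OF assms] by (intro finite_SigmaI finite_PiE) auto

lemma finite_gens: "diagram_map D \<Longrightarrow> finite (gens D i j)"
  using finite_enhanced_states by (simp add: gens_def)

lemma sum_state_upd:
  assumes "finite A" "v \<in> A"
  shows "sum (s(v := c)) A = sum s A - s v + (c :: int)"
  using assms by (simp add: sum.remove[of A v] sum.cong[of "A - {v}" "A - {v}" "s(v := c)" s])

text \<open>As sigma drops by 2, the changed marker can only pass from positive to negative.\<close>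

lemma differ_only_at_state:
  assumes D: "diagram_map D" and S: "S \<in> gens D (i + 2) j" and T: "T \<in> gens D i j"
    and d: "differ_only_at D S T v"
  shows "v \<in> crossings D" "fst S v = 1" "fst T = (fst S)(v := -1)"
proof -
  have s: "fst S \<in> crossings D \<rightarrow>\<^sub>E {1, -1}" and t: "fst T \<in> crossings D \<rightarrow>\<^sub>E {1, -1}"
    and SE: "sigma D S = i + 2" "sigma D T = i"
    using S T enhanced_statesD(1) unfolding gens_def by blast+
  show v: "v \<in> crossings D" using d by (simp add: differ_only_at_def)
  have eq: "fst T = (fst S)(v := fst T v)"
  proof
    fix w
    show "fst T w = ((fst S)(v := fst T v)) w"
    proof (cases "w \<in> crossings D")
      case True then show ?thesis using d by (simp add: differ_only_at_def)
    next
      case False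
      then show ?thesis using v PiE_arb[OF s False] PiE_arb[OF t False] by auto
    qed
  qed
  have "sum ((fst S)(v := fst T v)) (crossings D) = sum (fst S) (crossings D) - fst S v + fst T v"
    by (rule sum_state_upd[OF fin_crossings[OF D] v])
  then have "fst S v = fst T v + 2"
    using SE sigma_eq_sum[OF fin_crossings[OF D] s] sigma_eq_sum[OF fin_crossings[OF D] t] eq by simp
  then show "fst S v = 1" using state_values[OF s v] state_values[OF t v] by linarith
  then have "fst T v = -1" using \<open>fst S v = fst T v + 2\<close> by simp
  then show "fst T = (fst S)(v := -1)" using eq by simp
qed

lemma differ_only_at_switched:
  assumes "v \<in> crossings D" "fst S v = 1" "fst T = (fst S)(v := -1)"
  shows "differ_only_at D S T u \<longleftrightarrow> u = v"
  using assms by (auto simp: differ_only_at_def)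

lemma coeff_switched:
  assumes "v \<in> crossings D" "fst S v = 1" "fst T = (fst S)(v := -1)"
  shows "coeff D S T = (if agree_off D v S T then (-1) ^ negatives_above D (fst S) v else 0)"
  unfolding coeff_def sign_exp_def incidence_def differ_only_at_switched[OF assms] agree_off_def
    touches_def negatives_above_def by simp

lemma coeff_nonzero:
  assumes "diagram_map D" "S \<in> gens D (i + 2) j" "T \<in> gens D i j" "coeff D S T \<noteq> 0"
  obtains v where "v \<in> crossings D" "fst S v = 1" "fst T = (fst S)(v := -1)" "agree_off D v S T"
proof -
  have "incidence D S T \<noteq> 0" using assms(4) by (simp add: coeff_def)
  then have "\<exists>v. differ_only_at D S T v" by (auto simp: incidence_def split: if_splits)
  then obtain v where "differ_only_at D S T v" by blast
  note v = differ_only_at_state[OF assms(1-3) this]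
  moreover have "agree_off D v S T" using assms(4) coeff_switched[OF v] by (simp split: if_splits)
  ultimately show thesis by (rule that)
qed

lemma gens_switched_iff:
  assumes D: "diagram_map D" and S: "S \<in> gens D (i + 2) j" and v: "v \<in> crossings D" "fst S v = 1"
    and T: "fst T = (fst S)(v := -1)"
  shows "T \<in> gens D i j \<longleftrightarrow> snd T \<in> circles D (fst T) \<rightarrow>\<^sub>E {1, -1} \<and>
    sum (snd T) (circles D (fst T)) = sum (snd S) (circles D (fst S)) + 1"
proof -
  have SE: "S \<in> enhanced_states D" "sigma D S = i + 2" "sigma D S + 2 * tau D S = j"
    using S by (simp_all add: gens_def)
  note s = enhanced_statesD(1)[OF SE(1)]
  have t: "fst T \<in> crossings D \<rightarrow>\<^sub>E {1, -1}" unfolding T using s v(1) by (auto simp: PiE_iff extensional_def)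
  have "sum (fst T) (crossings D) = sum (fst S) (crossings D) - fst S v + (-1)"
    unfolding T by (rule sum_state_upd[OF fin_crossings[OF D] v(1)])
  then have sig: "sigma D T = i"
    using sigma_eq_sum[OF fin_crossings[OF D] s] sigma_eq_sum[OF fin_crossings[OF D] t] SE(2) v(2) by simp
  have en: "T \<in> enhanced_states D \<longleftrightarrow> snd T \<in> circles D (fst T) \<rightarrow>\<^sub>E {1, -1}"
    using t unfolding enhanced_states_def states_def by (cases T) simp
  show ?thesis
  proof (cases "T \<in> enhanced_states D")
    case True
    then have "T \<in> gens D i j \<longleftrightarrow> tau D T = tau D S + 1" using sig SE(2,3) by (auto simp: gens_def)
    then show ?thesis using en True tau_eq_sum[OF D True] tau_eq_sum[OF D SE(1)] by simp
  next
    case False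
    then show ?thesis using en by (simp add: gens_def)
  qed
qed

text \<open>The markers of an intermediate state are prescribed, so only the signs of its circles
  are left to count.\<close>

lemma intermediate_states_eq:
  assumes D: "diagram_map D" and S: "S \<in> gens D (i + 2) j" and v: "v \<in> crossings D" "fst S v = 1"
  shows "{T \<in> gens D i j. fst T = (fst S)(v := -1) \<and> agree_off D v S T \<and> agree_off D w T U} =
    Pair ((fst S)(v := -1)) ` colourings (darts_at D v) (darts_at D w) (circles D (fst S))
      (circles D ((fst S)(v := -1))) (snd S) (snd U)"
    (is "?L = Pair ?t ` ?C")
proof (intro equalityI subsetI)
  fix T assume "T \<in> ?L"
  then have T: "T \<in> gens D i j" "fst T = ?t" "agree_off D v S T" "agree_off D w T U" by simp_all
  have "snd T \<in> ?C"
    using gens_switched_iff[OF D S v T(2)] T by (intro colouringsI) (simp_all add: agree_off_def)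
  then show "T \<in> Pair ?t ` ?C" using T(2) by (metis image_eqI prod.collapse)
next
  fix T assume "T \<in> Pair ?t ` ?C"
  then obtain h where h: "h \<in> ?C" and T: "T = (?t, h)" by blast
  have "T \<in> gens D i j"
    using gens_switched_iff[OF D S v, of T] colouringsD(1,2)[OF h] by (simp add: T)
  moreover have "agree_off D v S T" "agree_off D w T U"
    using colouringsD(3,4)[OF h] by (simp_all add: agree_off_def T)
  ultimately show "T \<in> ?L" by (simp add: T)
qed

lemma bifurcation_circles:
  assumes "diagram_map D" "alternating D e" "v \<in> crossings D" "s v = 1"
  shows "bifurcation (darts_at D v) (circles D s) (circles D (s(v := -1)))"
  unfolding bifurcation_def
  by (rule circles_switch[where s = s and s' = "s(v := -1)", OF assms(1-3)]) (use assms(4) in auto)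

text \<open>There are two families of paths, changing \<open>v\<close> or \<open>w\<close> first.
  Within a family all products have the same sign, the signs of the families are opposite, and the
  families have equal size.\<close>

lemma coeff_square_ordered:
  assumes D: "diagram_map D" and e: "alternating D e"
    and S: "S \<in> gens D (i + 2) j" and U: "U \<in> gens D (i - 2) j"
    and v: "v \<in> crossings D" "fst S v = 1" and w: "w \<in> crossings D" "fst S w = 1" and vw: "v < w"
    and fU: "fst U = (fst S)(v := -1, w := -1)"
  shows "(\<Sum>T\<in>gens D i j. coeff D S T * coeff D T U) = 0"
proof -
  let ?s = "fst S"
  let ?A = "{T \<in> gens D i j. fst T = ?s(v := -1) \<and> agree_off D v S T \<and> agree_off D w T U}"
  let ?B = "{T \<in> gens D i j. fst T = ?s(w := -1) \<and> agree_off D w S T \<and> agree_off D v T U}"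
  define k where "k = negatives_above D ?s v + negatives_above D ?s w"
  have fU': "fst U = ?s(w := -1, v := -1)" using fU vw by (simp add: fun_upd_twist)
  have kw: "negatives_above D (?s(v := -1)) w = negatives_above D ?s w"
    unfolding negatives_above_def using vw by (intro arg_cong[where f = card]) auto
  \<comment> \<open>The asymmetry that produces the minus sign: a negative marker at
    \<open>w\<close> is counted at \<open>v\<close>, whereas one at \<open>v\<close> is not counted
    at \<open>w\<close>.\<close>
  have kv: "negatives_above D (?s(w := -1)) v = Suc (negatives_above D ?s v)"
  proof -
    have "{u \<in> crossings D. (?s(w := -1)) u = -1 \<and> v < u} = insert w {u \<in> crossings D. ?s u = -1 \<and> v < u}"
      using w(1) vw by auto
    moreover have "w \<notin> {u \<in> crossings D. ?s u = -1 \<and> v < u}" using w(2) by simp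
    ultimately show ?thesis unfolding negatives_above_def using fin_crossings[OF D] by simp
  qed
  have sV: "?s \<in> crossings D \<rightarrow>\<^sub>E {1, -1}" using S enhanced_statesD(1) unfolding gens_def by blast
  have summand: "coeff D S T * coeff D T U = (-1) ^ k * (of_bool (T \<in> ?A) - of_bool (T \<in> ?B))"
    if T: "T \<in> gens D i j" for T
  proof -
    have ne: "?s(v := -1) \<noteq> ?s(w := -1)" using v(2) w(2) vw by (auto dest: fun_cong[of _ _ v])
    consider (v) "fst T = ?s(v := -1)" | (w) "fst T = ?s(w := -1)"
      | (other) "fst T \<noteq> ?s(v := -1)" "fst T \<noteq> ?s(w := -1)" by blast
    then show ?thesis
    proof cases
      case v': v
      have "coeff D S T = (if agree_off D v S T then (-1) ^ negatives_above D ?s v else 0)"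
        by (rule coeff_switched[OF v v'])
      moreover have "coeff D T U = (if agree_off D w T U then (-1) ^ negatives_above D (fst T) w else 0)"
        by (rule coeff_switched[OF w(1)]) (use v' w vw fU in auto)
      ultimately show ?thesis using v' ne T kw by (simp add: k_def power_add)
    next
      case w': w
      have "coeff D S T = (if agree_off D w S T then (-1) ^ negatives_above D ?s w else 0)"
        by (rule coeff_switched[OF w w'])
      moreover have "coeff D T U = (if agree_off D v T U then (-1) ^ negatives_above D (fst T) v else 0)"
        by (rule coeff_switched[OF v(1)]) (use w' v vw fU' in auto)
      ultimately show ?thesis using w' ne T kv by (simp add: k_def power_add)
    next
      \<comment> \<open>Both changes make a marker negative, so the first one must occur at a
        crossing where \<open>U\<close> is negative and \<open>S\<close> is positive, that is at
        \<open>v\<close> or \<open>w\<close>.\<close>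
      case other
      have "coeff D S T * coeff D T U = 0"
      proof (rule ccontr)
        assume "coeff D S T * coeff D T U \<noteq> 0"
        then have nz: "coeff D S T \<noteq> 0" "coeff D T U \<noteq> 0" by auto
        obtain x where x: "x \<in> crossings D" "?s x = 1" "fst T = ?s(x := -1)"
          using coeff_nonzero[OF D S T nz(1)] by blast
        have "T \<in> gens D (i - 2 + 2) j" using T by simp
        then obtain y where y: "fst U = (fst T)(y := -1)"
          using coeff_nonzero[OF D _ U nz(2)] by blast
        have "fst U x = -1" using x(3) y by auto
        then have "x = v \<or> x = w" using fU x(2) by (auto split: if_splits)
        then show False using x(3) other by auto
      qed
      then show ?thesis using other by simp
    qed
  qed
  have "(\<Sum>T\<in>gens D i j. coeff D S T * coeff D T U) =
      (\<Sum>T\<in>gens D i j. (-1) ^ k * (of_bool (T \<in> ?A) - of_bool (T \<in> ?B)))"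
    by (rule sum.cong[OF refl summand])
  also have "\<dots> = (-1) ^ k * (int (card ?A) - int (card ?B))"
  proof -
    have "(\<Sum>T\<in>gens D i j. of_bool (T \<in> ?A)) = int (card ?A)" "(\<Sum>T\<in>gens D i j. of_bool (T \<in> ?B)) = int (card ?B)"
      using finite_gens[OF D] by (simp_all only: sum_of_bool_eq) (auto intro!: arg_cong[where f = card])
    then show ?thesis by (simp only: sum_distrib_left[symmetric] sum_subtractf)
  qed
  also have "\<dots> = 0"
  proof -
    note fc = finite_circles[OF D]
    have SE: "S \<in> enhanced_states D" "sigma D S = i + 2" "sigma D S + 2 * tau D S = j"
      and UE: "U \<in> enhanced_states D" "sigma D U = i - 2" "sigma D U + 2 * tau D U = j"
      using S U by (simp_all add: gens_def)
    have f: "snd S \<in> circles D ?s \<rightarrow> {1, -1}" using enhanced_statesD(2)[OF SE(1)] by auto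
    have g: "snd U \<in> circles D (fst U) \<rightarrow> {1, -1}" using enhanced_statesD(2)[OF UE(1)] by auto
    have fg: "sum (snd U) (circles D (fst U)) = sum (snd S) (circles D ?s) + 2"
      using tau_eq_sum[OF D SE(1)] tau_eq_sum[OF D UE(1)] SE(2,3) UE(2,3) by linarith
    have b1: "bifurcation (darts_at D v) (circles D ?s) (circles D (?s(v := -1)))"
      by (rule bifurcation_circles[where s = ?s, OF D e v])
    have b3: "bifurcation (darts_at D w) (circles D ?s) (circles D (?s(w := -1)))"
      by (rule bifurcation_circles[where s = ?s, OF D e w])
    have b2: "bifurcation (darts_at D w) (circles D (?s(v := -1))) (circles D (fst U))"
      unfolding fU by (rule bifurcation_circles[OF D e w(1)]) (use w vw in simp)
    have b4: "bifurcation (darts_at D v) (circles D (?s(w := -1))) (circles D (fst U))"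
      unfolding fU' by (rule bifurcation_circles[OF D e v(1)]) (use v vw in simp)
    have inj: "card (Pair t ` X) = card X" for t :: "nat \<Rightarrow> int" and X :: "(nat set \<Rightarrow> int) set"
      by (rule card_image) (simp add: inj_on_def)
    have "card ?A = card ?B"
      unfolding intermediate_states_eq[OF D S v] intermediate_states_eq[OF D S w] inj
      by (rule card_colourings_commute[OF fc fc fc fc b1 b2 b3 b4 f g fg])
    then show ?thesis by (simp only: diff_self mult_zero_right)
  qed
  finally show ?thesis .
qed

text \<open>A nonzero sum has a nonzero term, and this term exhibits the two crossings at which
  \<open>S\<close> and \<open>U\<close> differ; the smaller one plays the role of \<open>v\<close>
  in the ordered case.\<close>

theorem coeff_square:
  assumes D: "diagram_map D" and e: "alternating D e"
    and S: "S \<in> gens D (i + 2) j" and U: "U \<in> gens D (i - 2) j"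
  shows "(\<Sum>T\<in>gens D i j. coeff D S T * coeff D T U) = 0"
proof (rule ccontr)
  assume n: "(\<Sum>T\<in>gens D i j. coeff D S T * coeff D T U) \<noteq> 0"
  then obtain T where T: "T \<in> gens D i j" "coeff D S T * coeff D T U \<noteq> 0"
    using sum.not_neutral_contains_not_neutral by blast
  then have nz: "coeff D S T \<noteq> 0" "coeff D T U \<noteq> 0" by auto
  obtain v where v: "v \<in> crossings D" "fst S v = 1" "fst T = (fst S)(v := -1)"
    using coeff_nonzero[OF D S T(1) nz(1)] by blast
  have "T \<in> gens D (i - 2 + 2) j" using T by simp
  then obtain w where w: "w \<in> crossings D" "fst T w = 1" "fst U = (fst T)(w := -1)"
    using coeff_nonzero[OF D _ U nz(2)] by blast
  have wv: "w \<noteq> v" "fst S w = 1" using v(3) w(2) by (auto split: if_splits)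
  have U1: "fst U = (fst S)(v := -1, w := -1)" and U2: "fst U = (fst S)(w := -1, v := -1)"
    using v(3) w(3) wv(1) by (simp_all add: fun_upd_twist)
  have "(\<Sum>T\<in>gens D i j. coeff D S T * coeff D T U) = 0"
  proof (cases "v < w")
    case True
    from coeff_square_ordered[OF D e S U v(1,2) w(1) wv(2) True U1] show ?thesis .
  next
    case False
    then have "w < v" using wv(1) by simp
    from coeff_square_ordered[OF D e S U w(1) wv(2) v(1,2) this U2] show ?thesis .
  qed
  with n show False by simp
qed

section \<open>Exactness\<close>

text \<open>Kernel contained in image for a matrix \<open>M\<close>, with chains as coefficient
  functions of which only the values on the generators count. It turns the vanishing of homology
  into the solvability of integral linear systems.\<close>

definition exact_at :: "'s set \<Rightarrow> 's set \<Rightarrow> 's set \<Rightarrow> ('s \<Rightarrow> 's \<Rightarrow> int) \<Rightarrow> bool" where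
  "exact_at G2 G1 G0 M \<longleftrightarrow> (\<forall>c. (\<forall>T\<in>G0. (\<Sum>S\<in>G1. c S * M S T) = 0) \<longrightarrow>
     (\<exists>b. \<forall>T\<in>G1. (\<Sum>S\<in>G2. b S * M S T) = c T))"

lemma exact_atD:
  assumes "exact_at G2 G1 G0 M" "\<And>T. T \<in> G0 \<Longrightarrow> (\<Sum>S\<in>G1. c S * M S T) = 0"
  shows "\<exists>b. \<forall>T\<in>G1. (\<Sum>S\<in>G2. b S * M S T) = c T"
  using assms unfolding exact_at_def by simp

text \<open>A change of basis: generators are renamed by \<open>h\<close> and multiplied by the
  signs \<open>\<eta>\<close>, which are their own inverses.\<close>

lemma exact_at_reindex:
  assumes ex: "exact_at G2 G1 G0 M" and inj: "inj_on h G2" "inj_on h G1"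
    and \<eta>: "\<And>S. \<eta> S * \<eta> S = (1::int)"
    and M1: "\<And>S T. S \<in> G2 \<Longrightarrow> T \<in> G1 \<Longrightarrow> N (h S) (h T) = \<eta> S * \<eta> T * M S T"
    and M0: "\<And>S T. S \<in> G1 \<Longrightarrow> T \<in> G0 \<Longrightarrow> N (h S) (h T) = \<eta> S * \<eta> T * M S T"
  shows "exact_at (h ` G2) (h ` G1) (h ` G0) N"
  unfolding exact_at_def
proof (intro allI impI)
  fix c assume c: "\<forall>T\<in>h ` G0. (\<Sum>S\<in>h ` G1. c S * N S T) = 0"
  have "(\<Sum>S\<in>G1. (c (h S) * \<eta> S) * M S T) = 0" if T: "T \<in> G0" for T
  proof -
    have "0 = (\<Sum>S\<in>h ` G1. c S * N S (h T))" using c T by simp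
    also have "\<dots> = (\<Sum>S\<in>G1. c (h S) * N (h S) (h T))" by (simp add: sum.reindex[OF inj(2)])
    also have "\<dots> = (\<Sum>S\<in>G1. \<eta> T * ((c (h S) * \<eta> S) * M S T))"
      by (intro sum.cong refl) (simp add: M0 T ac_simps)
    also have "\<dots> = \<eta> T * (\<Sum>S\<in>G1. (c (h S) * \<eta> S) * M S T)" by (rule sum_distrib_left[symmetric])
    finally show ?thesis using \<eta>[of T] by auto
  qed
  from exact_atD[OF ex this] obtain b
    where b: "\<And>T. T \<in> G1 \<Longrightarrow> (\<Sum>S\<in>G2. b S * M S T) = c (h T) * \<eta> T" by blast
  define b' where "b' = (\<lambda>S. b (inv_into G2 h S) * \<eta> (inv_into G2 h S))"
  have "(\<Sum>S\<in>h ` G2. b' S * N S (h T)) = c (h T)" if T: "T \<in> G1" for T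
  proof -
    have "(\<Sum>S\<in>h ` G2. b' S * N S (h T)) = (\<Sum>S\<in>G2. b' (h S) * N (h S) (h T))"
      by (simp add: sum.reindex[OF inj(1)])
    also have "\<dots> = (\<Sum>S\<in>G2. \<eta> T * (b S * M S T))"
    proof (intro sum.cong refl)
      fix S assume S: "S \<in> G2"
      have "b' (h S) * N (h S) (h T) = \<eta> T * (b S * M S T) * (\<eta> S * \<eta> S)"
        by (simp add: b'_def inv_into_f_f[OF inj(1) S] M1[OF S T] ac_simps)
      then show "b' (h S) * N (h S) (h T) = \<eta> T * (b S * M S T)" by (simp add: \<eta>)
    qed
    also have "\<dots> = \<eta> T * (\<Sum>S\<in>G2. b S * M S T)" by (rule sum_distrib_left[symmetric])
    also have "\<dots> = c (h T) * (\<eta> T * \<eta> T)" by (simp add: b[OF T] ac_simps)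
    finally show ?thesis by (simp add: \<eta>)
  qed
  then show "\<exists>b. \<forall>T\<in>h ` G1. (\<Sum>S\<in>h ` G2. b S * N S T) = c T" by blast
qed

text \<open>The part of the long exact sequence of a subcomplex (spanned by the generators outside \<open>P\<close>)
  that does not involve the connecting homomorphism.\<close>

lemma exact_at_extension:
  assumes fin: "finite G2" "finite G1"
    and sq: "\<And>S U. S \<in> G2 \<Longrightarrow> U \<in> G0 \<Longrightarrow> (\<Sum>T\<in>G1. M S T * M T U) = (0::int)"
    and sub1: "\<And>S T. S \<in> G2 \<Longrightarrow> T \<in> G1 \<Longrightarrow> \<not> P S \<Longrightarrow> P T \<Longrightarrow> M S T = 0"
    and sub0: "\<And>S T. S \<in> G1 \<Longrightarrow> T \<in> G0 \<Longrightarrow> \<not> P S \<Longrightarrow> P T \<Longrightarrow> M S T = 0"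
    and exP: "exact_at {S\<in>G2. P S} {S\<in>G1. P S} {S\<in>G0. P S} M"
    and exN: "exact_at {S\<in>G2. \<not> P S} {S\<in>G1. \<not> P S} {S\<in>G0. \<not> P S} M"
  shows "exact_at G2 G1 G0 M"
  unfolding exact_at_def
proof (intro allI impI)
  have split: "sum f G = sum f {S\<in>G. P S} + sum f {S\<in>G. \<not> P S}" if "finite G" for f :: "_ \<Rightarrow> int" and G
  proof -
    have "G = {S\<in>G. P S} \<union> {S\<in>G. \<not> P S}" by blast
    then have "sum f G = sum f ({S\<in>G. P S} \<union> {S\<in>G. \<not> P S})" by simp
    also have "\<dots> = sum f {S\<in>G. P S} + sum f {S\<in>G. \<not> P S}" using that by (intro sum.union_disjoint) auto
    finally show ?thesis .
  qed
  fix c assume c: "\<forall>T\<in>G0. (\<Sum>S\<in>G1. c S * M S T) = 0"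
  \<comment> \<open>The part of \<open>c\<close> on \<open>P\<close> is a cycle of the quotient,
    since by \<open>sub0\<close> the rest of \<open>c\<close> has no boundary there.\<close>
  have "(\<Sum>S\<in>{S\<in>G1. P S}. c S * M S T) = 0" if T: "T \<in> {S\<in>G0. P S}" for T
  proof -
    have "(\<Sum>S\<in>{S\<in>G1. \<not> P S}. c S * M S T) = 0" using T by (intro sum.neutral) (simp add: sub0)
    then show ?thesis using c T split[OF fin(2), of "\<lambda>S. c S * M S T"] by simp
  qed
  from exact_atD[OF exP this] obtain a
    where a: "\<And>T. T \<in> {S\<in>G1. P S} \<Longrightarrow> (\<Sum>S\<in>{S\<in>G2. P S}. a S * M S T) = c T" by blast
  \<comment> \<open>\<open>c\<close> minus the boundary of the lifted solution \<open>a\<close>; it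
    vanishes on \<open>P\<close> and so belongs to the subcomplex. It is a cycle because boundaries
    are cycles, by \<open>sq\<close>.\<close>
  define z where "z T = c T - (\<Sum>S\<in>{S\<in>G2. P S}. a S * M S T)" for T
  have "(\<Sum>T\<in>{S\<in>G1. \<not> P S}. z T * M T U) = 0" if U: "U \<in> {S\<in>G0. \<not> P S}" for U
  proof -
    have "(\<Sum>T\<in>{S\<in>G1. P S}. z T * M T U) = 0" by (intro sum.neutral) (simp add: z_def a)
    then have "(\<Sum>T\<in>{S\<in>G1. \<not> P S}. z T * M T U) = (\<Sum>T\<in>G1. z T * M T U)"
      using split[OF fin(2), of "\<lambda>T. z T * M T U"] by simp
    also have "\<dots> = (\<Sum>T\<in>G1. c T * M T U) - (\<Sum>T\<in>G1. \<Sum>S\<in>{S\<in>G2. P S}. a S * (M S T * M T U))"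
      by (simp add: z_def left_diff_distrib sum_subtractf sum_distrib_right mult.assoc)
    also have "(\<Sum>T\<in>G1. \<Sum>S\<in>{S\<in>G2. P S}. a S * (M S T * M T U)) =
        (\<Sum>S\<in>{S\<in>G2. P S}. a S * (\<Sum>T\<in>G1. M S T * M T U))"
      by (subst sum.swap) (simp add: sum_distrib_left)
    also have "\<dots> = 0" using U sq by (intro sum.neutral) simp
    finally show ?thesis using c U by simp
  qed
  from exact_atD[OF exN this] obtain b
    where b: "\<And>T. T \<in> {S\<in>G1. \<not> P S} \<Longrightarrow> (\<Sum>S\<in>{S\<in>G2. \<not> P S}. b S * M S T) = z T" by blast
  have sol: "(\<Sum>S\<in>G2. (if P S then a S else b S) * M S T) = c T" if T: "T \<in> G1" for T
  proof -
    have "(\<Sum>S\<in>G2. (if P S then a S else b S) * M S T) =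
      (\<Sum>S\<in>{S\<in>G2. P S}. a S * M S T) + (\<Sum>S\<in>{S\<in>G2. \<not> P S}. b S * M S T)"
      by (subst split[OF fin(1)]) simp
    also have "\<dots> = c T"
    proof (cases "P T")
      case True
      have "(\<Sum>S\<in>{S\<in>G2. \<not> P S}. b S * M S T) = 0" using T True by (intro sum.neutral) (simp add: sub1)
      then show ?thesis using a[of T] T True by simp
    next
      case False
      then show ?thesis using b[of T] T by (simp add: z_def)
    qed
    finally show ?thesis .
  qed
  show "\<exists>b. \<forall>T\<in>G1. (\<Sum>S\<in>G2. b S * M S T) = c T"
    by (intro exI[of _ "\<lambda>S. if P S then a S else b S"] ballI sol)
qed

section \<open>From homology groups to coefficient matrices\<close>

lemma lookup_differential:
  assumes D: "diagram_map D" and c: "Poly_Mapping.keys c \<subseteq> gens D i j"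
  shows "Poly_Mapping.lookup (differential D i j c) T =
    (if T \<in> gens D (i - 2) j then \<Sum>S\<in>gens D i j. Poly_Mapping.lookup c S * coeff D S T else 0)"
proof -
  note fin = finite_gens[OF D]
  have row: "Poly_Mapping.lookup (\<Sum>S'\<in>gens D (i - 2) j.
      frag_cmul ((-1) ^ sign_exp D S S' * incidence D S S') (frag_of S')) T =
    (if T \<in> gens D (i - 2) j then coeff D S T else 0)" for S
  proof -
    have "Poly_Mapping.lookup (\<Sum>S'\<in>gens D (i - 2) j.
      frag_cmul ((-1) ^ sign_exp D S S' * incidence D S S') (frag_of S')) T =
      (\<Sum>S'\<in>gens D (i - 2) j. if S' = T then coeff D S S' else 0)"
      unfolding lookup_sum by (intro sum.cong refl) (simp add: coeff_def)
    then show ?thesis using fin by simp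
  qed
  have "Poly_Mapping.lookup (differential D i j c) T =
    (\<Sum>S\<in>Poly_Mapping.keys c. Poly_Mapping.lookup c S * (if T \<in> gens D (i - 2) j then coeff D S T else 0))"
    unfolding differential_def frag_extend_def lookup_sum[of _ "Poly_Mapping.keys c"] lookup_frag_cmul row ..
  also have "\<dots> = (\<Sum>S\<in>gens D i j. Poly_Mapping.lookup c S * (if T \<in> gens D (i - 2) j then coeff D S T else 0))"
    by (rule sum.mono_neutral_left[OF fin c]) (simp add: in_keys_iff)
  finally show ?thesis by simp
qed

lemma chain_exists:
  assumes "finite G"
  obtains c :: "'a \<Rightarrow>\<^sub>0 int" where "Poly_Mapping.keys c \<subseteq> G" "\<And>S. S \<in> G \<Longrightarrow> Poly_Mapping.lookup c S = b S"
proof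
  let ?c = "\<Sum>S\<in>G. frag_cmul (b S) (frag_of S)"
  have l: "Poly_Mapping.lookup ?c T = (if T \<in> G then b T else 0)" for T
  proof -
    have "Poly_Mapping.lookup ?c T = (\<Sum>S\<in>G. if S = T then b S else 0)"
      unfolding lookup_sum by (intro sum.cong refl) simp
    then show ?thesis using assms by simp
  qed
  show "Poly_Mapping.keys ?c \<subseteq> G"
  proof
    fix S assume "S \<in> Poly_Mapping.keys ?c"
    then have "(if S \<in> G then b S else 0) \<noteq> 0" unfolding in_keys_iff l .
    then show "S \<in> G" by (simp split: if_splits)
  qed
  show "Poly_Mapping.lookup ?c S = b S" if "S \<in> G" for S by (simp only: l that if_True)
qed

lemma differential_add: "differential D i j (x + y) = differential D i j x + differential D i j y"
  unfolding differential_def by (rule frag_extend_add)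

text \<open>The image is not known here to lie in the kernel. The cosets in the quotient are
  therefore computed from their definition: all of them equal the image exactly when every kernel
  element lies in it.\<close>

lemma trivial_homology_iff_kernel:
  "trivial_group (homology D i j) \<longleftrightarrow>
    kernel (chain_gp D i j) (chain_gp D (i - 2) j) (differential D i j) \<subseteq>
    differential D (i + 2) j ` carrier (chain_gp D (i + 2) j)"
proof -
  let ?G = "chain_gp D i j"
  let ?K = "kernel ?G (chain_gp D (i - 2) j) (differential D i j)"
  let ?I = "differential D (i + 2) j ` carrier (chain_gp D (i + 2) j)"
  let ?S = "subgroup_generated ?G ?K"
  interpret G: group ?G by (simp add: chain_gp_def)
  have mult: "x \<otimes>\<^bsub>?G\<^esub> y = x + y" and one: "\<one>\<^bsub>?G\<^esub> = 0" for x y by (simp_all add: chain_gp_def)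
  have KG: "?K \<subseteq> carrier ?G" by (auto simp: kernel_def)
  have inv: "inv\<^bsub>?G\<^esub> x = - x" if "x \<in> carrier ?G" for x using that by (simp add: chain_gp_def)
  have d_minus: "differential D a b (- x) = - differential D a b x" for a b x
    unfolding differential_def by (rule frag_extend_minus)
  have d0: "differential D a b 0 = 0" for a b unfolding differential_def by simp
  have Kmem: "x \<in> ?K \<longleftrightarrow> x \<in> carrier ?G \<and> differential D i j x = 0" for x by (simp add: kernel_def chain_gp_def)
  have "subgroup ?K ?G"
  proof
    show "x \<otimes>\<^bsub>?G\<^esub> y \<in> ?K" if "x \<in> ?K" "y \<in> ?K" for x y
      using that G.m_closed[of x y] unfolding Kmem by (simp add: mult differential_add)
    show "inv\<^bsub>?G\<^esub> x \<in> ?K" if "x \<in> ?K" for x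
      using that G.inv_closed[of x] inv[of x] unfolding Kmem by (simp add: d_minus)
    show "\<one>\<^bsub>?G\<^esub> \<in> ?K" using G.one_closed unfolding Kmem by (simp add: one d0)
  qed (rule KG)
  then have carS: "carrier ?S = ?K" by (rule subgroup.carrier_subgroup_generated_subgroup)
  have carI: "carrier (chain_gp D (i + 2) j) = {c. Poly_Mapping.keys c \<subseteq> gens D (i + 2) j}"
    by (auto simp: chain_gp_def)
  have I0: "0 \<in> ?I" unfolding carI by (rule image_eqI[of _ _ 0]) (simp_all add: d0)
  have Iadd: "x + y \<in> ?I" if xy: "x \<in> ?I" "y \<in> ?I" for x y
  proof -
    obtain a b where ab: "x = differential D (i + 2) j a" "y = differential D (i + 2) j b"
      "Poly_Mapping.keys a \<subseteq> gens D (i + 2) j" "Poly_Mapping.keys b \<subseteq> gens D (i + 2) j"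
      using xy unfolding carI by blast
    have "Poly_Mapping.keys (a + b) \<subseteq> gens D (i + 2) j" using keys_add[of a b] ab(3,4) by blast
    then show ?thesis unfolding carI by (intro image_eqI[of _ _ "a + b"]) (simp_all add: ab(1,2) differential_add)
  qed
  have Iminus: "- x \<in> ?I" if x: "x \<in> ?I" for x
  proof -
    obtain a where a: "x = differential D (i + 2) j a" "Poly_Mapping.keys a \<subseteq> gens D (i + 2) j"
      using x unfolding carI by blast
    then show ?thesis unfolding carI by (intro image_eqI[of _ _ "- a"]) (simp_all add: d_minus)
  qed
  have coset: "?I #>\<^bsub>?S\<^esub> a = (\<lambda>x. x + a) ` ?I" for a by (auto simp: r_coset_def mult)
  have cosetI: "(\<lambda>x. x + a) ` ?I = ?I \<longleftrightarrow> a \<in> ?I" for a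
  proof
    assume eq: "(\<lambda>x. x + a) ` ?I = ?I"
    have "0 + a \<in> (\<lambda>x. x + a) ` ?I" using I0 by (rule imageI)
    then show "a \<in> ?I" unfolding eq by simp
  next
    assume a: "a \<in> ?I"
    show "(\<lambda>x. x + a) ` ?I = ?I"
    proof (intro equalityI subsetI)
      fix x assume "x \<in> (\<lambda>x. x + a) ` ?I"
      then show "x \<in> ?I" using Iadd a by blast
    next
      fix x assume x: "x \<in> ?I"
      show "x \<in> (\<lambda>x. x + a) ` ?I"
        by (rule image_eqI[of _ _ "x + - a"]) (simp, rule Iadd[OF x Iminus[OF a]])
    qed
  qed
  have car: "carrier (homology D i j) = (\<lambda>a. (\<lambda>x. x + a) ` ?I) ` ?K"
    unfolding homology_def FactGroup_def RCOSETS_def coset carS by auto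
  have one_h: "\<one>\<^bsub>homology D i j\<^esub> = ?I" by (simp add: homology_def FactGroup_def)
  have mult_h: "?I \<otimes>\<^bsub>homology D i j\<^esub> ?I = ?I"
  proof -
    have "?I \<otimes>\<^bsub>homology D i j\<^esub> ?I = (\<Union>x\<in>?I. \<Union>y\<in>?I. {x + y})"
      by (simp add: homology_def FactGroup_def set_mult_def mult)
    also have "\<dots> = ?I"
    proof (intro equalityI subsetI)
      fix x assume "x \<in> (\<Union>x\<in>?I. \<Union>y\<in>?I. {x + y})"
      then obtain a b where "a \<in> ?I" "b \<in> ?I" "x = a + b" by (elim UN_E singletonE)
      then show "x \<in> ?I" using Iadd by simp
    next
      fix x assume "x \<in> ?I"
      moreover have "x \<in> {x + 0}" by simp
      ultimately show "x \<in> (\<Union>x\<in>?I. \<Union>y\<in>?I. {x + y})" using I0 by (intro UN_I)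
    qed
    finally show ?thesis .
  qed
  show ?thesis
  proof
    assume "trivial_group (homology D i j)"
    then have c: "carrier (homology D i j) = {?I}" by (simp only: trivial_group_def one_h)
    show "?K \<subseteq> ?I"
    proof
      fix a assume "a \<in> ?K"
      then have "(\<lambda>x. x + a) ` ?I \<in> carrier (homology D i j)" unfolding car by (rule imageI)
      then show "a \<in> ?I" unfolding c singleton_iff cosetI .
    qed
  next
    assume sub: "?K \<subseteq> ?I"
    have K0: "(0 :: enhanced_state \<Rightarrow>\<^sub>0 int) \<in> ?K" unfolding Kmem using G.one_closed by (simp add: one d0)
    have const: "(\<lambda>x. x + a) ` ?I = ?I" if "a \<in> ?K" for a
      unfolding cosetI using sub that by (rule subsetD)
    have c: "carrier (homology D i j) = {?I}"
      unfolding car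
    proof (intro equalityI subsetI)
      fix Y assume "Y \<in> (\<lambda>a. (\<lambda>x. x + a) ` ?I) ` ?K"
      then obtain a where "a \<in> ?K" "Y = (\<lambda>x. x + a) ` ?I" by (rule imageE)
      then show "Y \<in> {?I}" using const by (simp only: singleton_iff)
    next
      fix Y assume "Y \<in> {?I}"
      then have "Y = (\<lambda>x. x + 0) ` ?I" by (simp only: singleton_iff const[OF K0])
      then show "Y \<in> (\<lambda>a. (\<lambda>x. x + a) ` ?I) ` ?K" using K0 by (rule image_eqI)
    qed
    have "group (homology D i j)"
      by (rule groupI) (simp_all only: c one_h mult_h singleton_iff simp_thms bex_simps)
    then show "trivial_group (homology D i j)" by (simp only: trivial_group_def one_h c simp_thms)
  qed
qed

theorem trivial_homology_iff:
  assumes D: "diagram_map D"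
  shows "trivial_group (homology D i j) \<longleftrightarrow>
    exact_at (gens D (i + 2) j) (gens D i j) (gens D (i - 2) j) (coeff D)"
proof -
  note fin = finite_gens[OF D]
  have Kmem: "x \<in> kernel (chain_gp D i j) (chain_gp D (i - 2) j) (differential D i j) \<longleftrightarrow>
    Poly_Mapping.keys x \<subseteq> gens D i j \<and> differential D i j x = 0" for x
    by (simp add: kernel_def chain_gp_def)
  have car: "carrier (chain_gp D (i + 2) j) = {c. Poly_Mapping.keys c \<subseteq> gens D (i + 2) j}"
    by (auto simp: chain_gp_def)
  have zero: "differential D i j x = 0 \<longleftrightarrow>
      (\<forall>T\<in>gens D (i - 2) j. (\<Sum>S\<in>gens D i j. Poly_Mapping.lookup x S * coeff D S T) = 0)"
    if "Poly_Mapping.keys x \<subseteq> gens D i j" for x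
    unfolding poly_mapping_eq_iff fun_eq_iff using lookup_differential[OF D that] by auto
  have bound: "differential D (i + 2) j b = x \<longleftrightarrow>
      (\<forall>T\<in>gens D i j. (\<Sum>S\<in>gens D (i + 2) j. Poly_Mapping.lookup b S * coeff D S T) = Poly_Mapping.lookup x T)"
    if x: "Poly_Mapping.keys x \<subseteq> gens D i j" and b: "Poly_Mapping.keys b \<subseteq> gens D (i + 2) j" for b x
  proof -
    have "Poly_Mapping.lookup x T = 0" if "T \<notin> gens D i j" for T using x that by (auto simp: in_keys_iff)
    then show ?thesis
      unfolding poly_mapping_eq_iff fun_eq_iff using lookup_differential[OF D b] by auto
  qed
  show ?thesis
    unfolding trivial_homology_iff_kernel
  proof
    assume sub: "kernel (chain_gp D i j) (chain_gp D (i - 2) j) (differential D i j)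
      \<subseteq> differential D (i + 2) j ` carrier (chain_gp D (i + 2) j)"
    show "exact_at (gens D (i + 2) j) (gens D i j) (gens D (i - 2) j) (coeff D)"
      unfolding exact_at_def
    proof (intro allI impI)
      fix c assume c: "\<forall>T\<in>gens D (i - 2) j. (\<Sum>S\<in>gens D i j. c S * coeff D S T) = 0"
      obtain x where x: "Poly_Mapping.keys x \<subseteq> gens D i j" "\<And>S. S \<in> gens D i j \<Longrightarrow> Poly_Mapping.lookup x S = c S"
        using chain_exists[OF fin] by blast
      have "(\<Sum>S\<in>gens D i j. Poly_Mapping.lookup x S * coeff D S T) = (\<Sum>S\<in>gens D i j. c S * coeff D S T)" for T
        by (intro sum.cong) (simp_all add: x(2))
      then have "differential D i j x = 0" using c zero[OF x(1)] by simp
      then have "x \<in> differential D (i + 2) j ` carrier (chain_gp D (i + 2) j)"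
        using x(1) by (intro subsetD[OF sub]) (simp only: Kmem simp_thms)
      then obtain b where b: "Poly_Mapping.keys b \<subseteq> gens D (i + 2) j" "x = differential D (i + 2) j b"
        unfolding car by blast
      from bound[OF x(1) b(1)] b(2) x(2)
      have "\<forall>T\<in>gens D i j. (\<Sum>S\<in>gens D (i + 2) j. Poly_Mapping.lookup b S * coeff D S T) = c T" by simp
      then show "\<exists>b. \<forall>T\<in>gens D i j. (\<Sum>S\<in>gens D (i + 2) j. b S * coeff D S T) = c T" by blast
    qed
  next
    assume ex: "exact_at (gens D (i + 2) j) (gens D i j) (gens D (i - 2) j) (coeff D)"
    show "kernel (chain_gp D i j) (chain_gp D (i - 2) j) (differential D i j)
      \<subseteq> differential D (i + 2) j ` carrier (chain_gp D (i + 2) j)"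
    proof
      fix x assume "x \<in> kernel (chain_gp D i j) (chain_gp D (i - 2) j) (differential D i j)"
      then have x: "Poly_Mapping.keys x \<subseteq> gens D i j" "differential D i j x = 0" unfolding Kmem by blast+
      then have "\<forall>T\<in>gens D (i - 2) j. (\<Sum>S\<in>gens D i j. Poly_Mapping.lookup x S * coeff D S T) = 0"
        using zero by blast
      then obtain b where b: "\<And>T. T \<in> gens D i j \<Longrightarrow>
          (\<Sum>S\<in>gens D (i + 2) j. b S * coeff D S T) = Poly_Mapping.lookup x T"
        using exact_atD[OF ex, of "Poly_Mapping.lookup x"] by blast
      obtain y where y: "Poly_Mapping.keys y \<subseteq> gens D (i + 2) j"
        "\<And>S. S \<in> gens D (i + 2) j \<Longrightarrow> Poly_Mapping.lookup y S = b S"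
        using chain_exists[OF fin] by blast
      have "(\<Sum>S\<in>gens D (i + 2) j. Poly_Mapping.lookup y S * coeff D S T) =
          (\<Sum>S\<in>gens D (i + 2) j. b S * coeff D S T)" for T
        by (intro sum.cong) (simp_all add: y(2))
      then have "differential D (i + 2) j y = x" using bound[OF x(1) y(1)] b by simp
      then show "x \<in> differential D (i + 2) j ` carrier (chain_gp D (i + 2) j)"
        unfolding car using y(1) by (intro image_eqI[of _ _ y]) simp_all
    qed
  qed
qed

section \<open>The two smoothings of a crossing\<close>

text \<open>The signs can be carried over unchanged because a circle is a set of darts, and a
  smoothing keeps all darts and the circles of corresponding states.\<close>

definition lift_state :: "nat \<Rightarrow> int \<Rightarrow> enhanced_state \<Rightarrow> enhanced_state" where
  "lift_state v m S = ((fst S)(v := m), snd S)"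

text \<open>Lifting to a negative marker at \<open>v\<close> changes the signs of the differential at the crossings
  below \<open>v\<close>; the sign \<open>lift_sign\<close> compensates for this.\<close>

definition lift_sign :: "diagram \<Rightarrow> nat \<Rightarrow> int \<Rightarrow> enhanced_state \<Rightarrow> int" where
  "lift_sign D v m S = (if m = 1 then 1 else (-1) ^ card {w \<in> crossings D - {v}. w < v \<and> fst S w = -1})"

lemma lift_sign_square: "lift_sign D v m S * lift_sign D v m S = 1"
  by (simp add: lift_sign_def flip: power_add)

lemma circles_lift:
  assumes "diagram_map D" "v \<in> crossings D"
  shows "circles (smoothing D v m) s = circles D (s(v := m))"
  using circles_smoothing[where s = "s(v := m)" and s' = s, OF assms] by simp

section \<open>Generators of a smoothing as generators with a fixed marker\<close>

context
  fixes D :: diagram and v :: nat and m :: int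
  assumes D: "diagram_map D" and v: "v \<in> crossings D" and m: "m = 1 \<or> m = -1"
begin

lemma fst_gens_smoothing:
  assumes "S \<in> gens (smoothing D v m) i j"
  shows "fst S \<in> (crossings D - {v}) \<rightarrow>\<^sub>E {1, -1}"
  using enhanced_statesD(1)[of S "smoothing D v m"] assms by (simp add: gens_def)

text \<open>The marker \<open>m\<close> at \<open>v\<close> adds \<open>m\<close> to sigma and
  leaves tau unchanged, so both degrees move by \<open>m\<close>.\<close>

lemma lift_gens_iff:
  assumes s: "fst S \<in> (crossings D - {v}) \<rightarrow>\<^sub>E {1, -1}"
  shows "lift_state v m S \<in> gens D (i + m) (j + m) \<longleftrightarrow> S \<in> gens (smoothing D v m) i j"
proof -
  let ?t = "(fst S)(v := m)"
  have t: "?t \<in> crossings D \<rightarrow>\<^sub>E {1, -1}" using s v m by (auto simp: PiE_iff extensional_def)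
  have "sum ?t (crossings D) = ?t v + sum ?t (crossings D - {v})"
    by (rule sum.remove[OF fin_crossings[OF D] v])
  also have "sum ?t (crossings D - {v}) = sum (fst S) (crossings D - {v})" by (intro sum.cong) auto
  finally have sum: "sum ?t (crossings D) = sum (fst S) (crossings D - {v}) + m" by simp
  have sig: "sigma D (lift_state v m S) = sigma (smoothing D v m) S + m"
    using sigma_eq_sum[of D "lift_state v m S"] sigma_eq_sum[of "smoothing D v m" S] s t sum fin_crossings[OF D]
    by (simp add: lift_state_def)
  have tau: "tau D (lift_state v m S) = tau (smoothing D v m) S"
    by (simp add: tau_def lift_state_def circles_lift[OF D v])
  have "lift_state v m S \<in> enhanced_states D \<longleftrightarrow> S \<in> enhanced_states (smoothing D v m)"
    using s t by (cases S) (simp add: enhanced_states_def states_def lift_state_def circles_lift[OF D v])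
  then show ?thesis unfolding gens_def sig tau mem_Collect_eq by auto
qed

lemma lift_image_gens:
  "lift_state v m ` gens (smoothing D v m) i j = {T \<in> gens D (i + m) (j + m). fst T v = m}"
proof (intro equalityI subsetI)
  fix T assume "T \<in> lift_state v m ` gens (smoothing D v m) i j"
  then obtain S where S: "S \<in> gens (smoothing D v m) i j" "T = lift_state v m S" by blast
  then show "T \<in> {T \<in> gens D (i + m) (j + m). fst T v = m}"
    using lift_gens_iff[OF fst_gens_smoothing[OF S(1)]] by (simp add: lift_state_def)
next
  fix T assume T: "T \<in> {T \<in> gens D (i + m) (j + m). fst T v = m}"
  \<comment> \<open>States are extensional functions, so a state of the smoothing has the default
    value at the removed crossing.\<close>
  let ?S = "((fst T)(v := undefined), snd T)"
  have t: "fst T \<in> crossings D \<rightarrow>\<^sub>E {1, -1}" using T enhanced_statesD(1) by (simp add: gens_def)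
  have s: "fst ?S \<in> (crossings D - {v}) \<rightarrow>\<^sub>E {1, -1}" using t by (auto simp: PiE_iff extensional_def)
  have eq: "lift_state v m ?S = T" using T by (auto simp: lift_state_def prod_eq_iff)
  then have "?S \<in> gens (smoothing D v m) i j" using lift_gens_iff[OF s] T by simp
  then show "T \<in> lift_state v m ` gens (smoothing D v m) i j" using eq by (metis image_eqI)
qed

lemma inj_on_lift: "inj_on (lift_state v m) (gens (smoothing D v m) i j)"
proof (rule inj_onI)
  fix S T assume S: "S \<in> gens (smoothing D v m) i j" and T: "T \<in> gens (smoothing D v m) i j"
    and eq: "lift_state v m S = lift_state v m T"
  have "fst S v = fst T v"
    using PiE_arb[OF fst_gens_smoothing[OF S], of v] PiE_arb[OF fst_gens_smoothing[OF T], of v] by simp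
  moreover have e: "(fst S)(v := m) = (fst T)(v := m)" "snd S = snd T" using eq by (simp_all add: lift_state_def)
  ultimately have "fst S = fst T" by (metis fun_upd_triv fun_upd_upd)
  with e(2) show "S = T" by (simp add: prod_eq_iff)
qed

text \<open>For \<open>m = -1\<close> the negative marker at \<open>v\<close> is counted at
  \<open>w\<close> exactly when \<open>w < v\<close>. Under the same condition the change at
  \<open>w\<close> adds one to the exponent of \<open>lift_sign\<close>.\<close>

lemma sign_lift:
  assumes w: "w \<in> crossings D - {v}" and s: "fst S w = 1" and t: "fst T = (fst S)(w := -1)"
  shows "(-1) ^ negatives_above D ((fst S)(v := m)) w =
    lift_sign D v m S * lift_sign D v m T * (-1) ^ negatives_above (smoothing D v m) (fst S) w"
proof -
  note fin = fin_crossings[OF D]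
  let ?A = "{u \<in> crossings D - {v}. fst S u = -1 \<and> w < u}"
  let ?B = "{u \<in> crossings D - {v}. u < v \<and> fst S u = -1}"
  have nA: "negatives_above (smoothing D v m) (fst S) w = card ?A" by (simp add: negatives_above_def)
  show ?thesis
  proof (cases "m = 1")
    case True
    have "{u \<in> crossings D. ((fst S)(v := m)) u = -1 \<and> w < u} = ?A" using True by auto
    then show ?thesis using True unfolding nA by (simp add: negatives_above_def lift_sign_def)
  next
    case False
    then have m: "m = -1" using m by simp
    have B: "lift_sign D v m S = (-1) ^ card ?B" using False by (simp add: lift_sign_def)
    show ?thesis
    proof (cases "w < v")
      case True
      have "{u \<in> crossings D. ((fst S)(v := m)) u = -1 \<and> w < u} = insert v ?A" using True v m by auto
      moreover have "{u \<in> crossings D - {v}. u < v \<and> fst T u = -1} = insert w ?B" using True w t by auto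
      moreover have "v \<notin> ?A" "w \<notin> ?B" using s by simp_all
      ultimately have "negatives_above D ((fst S)(v := m)) w = Suc (card ?A)"
        "lift_sign D v m T = (-1) ^ Suc (card ?B)"
        using fin False by (simp_all add: negatives_above_def lift_sign_def)
      then show ?thesis unfolding nA B by (simp add: power_add[symmetric])
    next
      case False
      have "{u \<in> crossings D. ((fst S)(v := m)) u = -1 \<and> w < u} = ?A" using False v m by auto
      moreover have "{u \<in> crossings D - {v}. u < v \<and> fst T u = -1} = ?B" using False w t by auto
      ultimately have "negatives_above D ((fst S)(v := m)) w = card ?A" "lift_sign D v m T = (-1) ^ card ?B"
        using m by (simp_all add: negatives_above_def lift_sign_def)
      then show ?thesis unfolding nA B by (simp add: power_add[symmetric])
    qed
  qed
qed

lemma coeff_lift: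
  assumes S: "S \<in> gens (smoothing D v m) (i + 2) j" and T: "T \<in> gens (smoothing D v m) i j"
  shows "coeff D (lift_state v m S) (lift_state v m T) =
    lift_sign D v m S * lift_sign D v m T * coeff (smoothing D v m) S T"
proof (cases "\<exists>w\<in>crossings D - {v}. fst S w = 1 \<and> fst T = (fst S)(w := -1)")
  case True
  then obtain w where w: "w \<in> crossings D - {v}" "fst S w = 1" "fst T = (fst S)(w := -1)" by blast
  have wD: "w \<in> crossings D" "w \<noteq> v" using w(1) by simp_all
  have up: "coeff D (lift_state v m S) (lift_state v m T) =
      (if agree_off D w (lift_state v m S) (lift_state v m T)
       then (-1) ^ negatives_above D (fst (lift_state v m S)) w else 0)"
    by (rule coeff_switched) (use w wD in \<open>simp_all add: lift_state_def fun_upd_twist\<close>)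
  have down: "coeff (smoothing D v m) S T =
      (if agree_off (smoothing D v m) w S T then (-1) ^ negatives_above (smoothing D v m) (fst S) w else 0)"
    by (rule coeff_switched) (use w in simp_all)
  have "agree_off D w (lift_state v m S) (lift_state v m T) \<longleftrightarrow> agree_off (smoothing D v m) w S T"
    by (simp add: agree_off_def lift_state_def circles_lift[OF D v] darts_at_smoothing[OF D v wD])
  then show ?thesis using up down sign_lift[OF w] by (simp add: lift_state_def)
next
  case False
  have "coeff (smoothing D v m) S T = 0"
  proof (rule ccontr)
    assume "coeff (smoothing D v m) S T \<noteq> 0"
    then obtain w where "w \<in> crossings (smoothing D v m)" "fst S w = 1" "fst T = (fst S)(w := -1)"
      using coeff_nonzero[OF diagram_map_smoothing[OF D v] S T] by blast
    with False show False by auto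
  qed
  moreover have "coeff D (lift_state v m S) (lift_state v m T) = 0"
  proof (rule ccontr)
    assume nz: "coeff D (lift_state v m S) (lift_state v m T) \<noteq> 0"
    have L1: "lift_state v m S \<in> gens D (i + m + 2) (j + m)"
      using lift_gens_iff[OF fst_gens_smoothing[OF S], of "i + 2" j] S by (simp add: ac_simps)
    have L2: "lift_state v m T \<in> gens D (i + m) (j + m)"
      using lift_gens_iff[OF fst_gens_smoothing[OF T]] T by simp
    obtain w where "w \<in> crossings D" "fst (lift_state v m S) w = 1"
        "fst (lift_state v m T) = (fst (lift_state v m S))(w := -1)"
        "agree_off D w (lift_state v m S) (lift_state v m T)"
      by (rule coeff_nonzero[OF D L1 L2 nz])
    then have w: "w \<in> crossings D" "((fst S)(v := m)) w = 1"
        "(fst T)(v := m) = ((fst S)(v := m))(w := -1)"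
      unfolding lift_state_def fst_conv by blast+
    \<comment> \<open>Both lifts have the marker \<open>m\<close> at \<open>v\<close>, so the
      changed crossing is not \<open>v\<close>.\<close>
    have "((fst T)(v := m)) v = (((fst S)(v := m))(w := -1)) v" using w(3) by simp
    then have wv: "w \<noteq> v" using w(2) by (auto split: if_splits)
    have "fst T u = ((fst S)(w := -1)) u" for u
    proof (cases "u = v")
      case True
      then show ?thesis using wv PiE_arb[OF fst_gens_smoothing[OF S], of v] PiE_arb[OF fst_gens_smoothing[OF T], of v]
        by simp
    next
      case False
      then show ?thesis using fun_cong[OF w(3), of u] by simp
    qed
    then have "fst T = (fst S)(w := -1)" by (rule ext)
    then show False using False w(1,2) wv by auto
  qed
  ultimately show ?thesis by simp
qed

lemma exact_lift:
  assumes "trivial_group (homology (smoothing D v m) i j)"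
  shows "exact_at {T \<in> gens D (i + m + 2) (j + m). fst T v = m} {T \<in> gens D (i + m) (j + m). fst T v = m}
    {T \<in> gens D (i + m - 2) (j + m). fst T v = m} (coeff D)"
proof -
  let ?D = "smoothing D v m"
  have "exact_at (gens ?D (i + 2) j) (gens ?D i j) (gens ?D (i - 2) j) (coeff ?D)"
    using assms trivial_homology_iff[OF diagram_map_smoothing[OF D v]] by blast
  then have "exact_at (lift_state v m ` gens ?D (i + 2) j) (lift_state v m ` gens ?D i j)
      (lift_state v m ` gens ?D (i - 2) j) (coeff D)"
  proof (rule exact_at_reindex[where \<eta> = "lift_sign D v m"])
    show "coeff D (lift_state v m S) (lift_state v m T) = lift_sign D v m S * lift_sign D v m T * coeff ?D S T"
      if "S \<in> gens ?D i j" "T \<in> gens ?D (i - 2) j" for S T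
      by (rule coeff_lift[OF _ that(2)]) (use that(1) in simp)
  qed (simp_all add: inj_on_lift lift_sign_square coeff_lift)
  moreover have "i + 2 + m = i + m + 2" "i - 2 + m = i + m - 2" by simp_all
  ultimately show ?thesis unfolding lift_image_gens by simp
qed

end

text \<open>Generators with a positive marker at \<open>v\<close> give the quotient complex, those
  with a negative one the subcomplex; the index shifts undo those of the lift with
  \<open>m = 1\<close> and \<open>m = -1\<close>.\<close>

theorem trivial_homology_of_smoothings:
  assumes D: "diagram_map D" and e: "alternating D e" and v: "v \<in> crossings D"
    and h0: "trivial_group (homology (smoothing D v 1) (i - 1) (j - 1))"
    and hinf: "trivial_group (homology (smoothing D v (-1)) (i + 1) (j + 1))"
  shows "trivial_group (homology D i j)"
  unfolding trivial_homology_iff[OF D]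
proof (rule exact_at_extension[where P = "\<lambda>S. fst S v = 1"])
  have neg: "{S \<in> gens D k j. fst S v \<noteq> 1} = {S \<in> gens D k j. fst S v = -1}" for k
  proof -
    have "fst S v = 1 \<or> fst S v = -1" if "S \<in> gens D k j" for S
      by (rule state_values[OF enhanced_statesD(1) v]) (use that in \<open>simp add: gens_def\<close>)
    then show ?thesis by auto
  qed
  show "exact_at {S \<in> gens D (i + 2) j. fst S v = 1} {S \<in> gens D i j. fst S v = 1}
      {S \<in> gens D (i - 2) j. fst S v = 1} (coeff D)"
    using exact_lift[OF D v _ h0] by simp
  show "exact_at {S \<in> gens D (i + 2) j. fst S v \<noteq> 1} {S \<in> gens D i j. fst S v \<noteq> 1}
      {S \<in> gens D (i - 2) j. fst S v \<noteq> 1} (coeff D)"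
    unfolding neg using exact_lift[OF D v _ hinf] by simp
  \<comment> \<open>The differential never makes a negative marker positive, so the negative markers
    at \<open>v\<close> span a subcomplex.\<close>
  have sub: "coeff D S T = 0"
    if S: "S \<in> gens D (k + 2) j" and T: "T \<in> gens D k j" and n: "fst S v \<noteq> 1" "fst T v = 1" for k S T
  proof (rule ccontr)
    assume "coeff D S T \<noteq> 0"
    then obtain w where "fst T = (fst S)(w := -1)" using coeff_nonzero[OF D S T] by blast
    then show False using n by (auto split: if_splits)
  qed
  show "coeff D S T = 0" if "S \<in> gens D (i + 2) j" "T \<in> gens D i j" "fst S v \<noteq> 1" "fst T v = 1" for S T
    by (rule sub[OF that])
  show "coeff D S T = 0" if "S \<in> gens D i j" "T \<in> gens D (i - 2) j" "fst S v \<noteq> 1" "fst T v = 1" for S T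
    by (rule sub[OF _ that(2,3,4)]) (use that(1) in simp)
qed (use finite_gens[OF D] coeff_square[OF D e] in simp_all)

lemma num_circles_smoothing:
  assumes "diagram_map D" "v \<in> crossings D" "\<And>w. w \<in> crossings D - {v} \<Longrightarrow> s' w = s w" "s v = m"
  shows "num_circles (smoothing D v m) s' = num_circles D s"
  using circles_smoothing[where s = s and s' = s', OF assms(1-3)] assms(4) by (simp add: num_circles_def)

text \<open>The parameters are maxima so that the strip for \<open>Dp\<close> contains the strips
  for both smoothings after their shifts. A bidegree outside it then lies outside both, and both
  outer homology groups vanish.\<close>

theorem theoremX5p3:
  fixes Dp D0 Dinf :: diagram and v :: nat
    and k1_inf k2_inf k1_0 k2_0 k1_p k2_p :: real
  assumes "link_diagram Dp" and "v \<in> crossings Dp"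
    and "D0 = smoothing Dp v 1" and "Dinf = smoothing Dp v (-1)"
    and "H_thick Dinf k1_inf k2_inf" and "H_thick D0 k1_0 k2_0"
    and "k1_p = max (k1_inf + 1/2 * (num_circles Dinf (splus Dinf) - num_circles Dp (splus Dp) + 1)) k1_0"
    and "k2_p = max k2_inf (k2_0 + 1/2 * (num_circles D0 (sminus D0) - num_circles Dp (sminus Dp) + 1))"
  shows "H_thick Dp k1_p k2_p \<and>
    (plus_adequate Dp \<longrightarrow> num_circles Dp (splus Dp) - num_circles Dinf (splus Dinf) = 1) \<and>
    (num_circles Dp (splus Dp) - num_circles Dinf (splus Dinf) = 1 \<longrightarrow> k1_p = max k1_inf k1_0) \<and>
    (minus_adequate Dp \<longrightarrow> num_circles Dp (sminus Dp) - num_circles D0 (sminus D0) = 1) \<and>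
    (num_circles Dp (sminus Dp) - num_circles D0 (sminus D0) = 1 \<longrightarrow> k2_p = max k2_inf k2_0)"
proof -
  note v = assms(2)
  have D: "diagram_map Dp" using assms(1) link_diagram_iff by blast
  obtain e where e: "alternating Dp e" using link_diagram_alternating[OF assms(1)] .
  have card: "real (card (crossings (smoothing Dp v m))) = real (card (crossings Dp)) - 1" for m
  proof -
    have "0 < card (crossings Dp)" using v fin_crossings[OF D] by (auto simp: card_gt_0_iff)
    then show ?thesis using v by (simp add: of_nat_diff)
  qed
  have splus0: "num_circles D0 (splus D0) = num_circles Dp (splus Dp)"
    unfolding assms(3) by (rule num_circles_smoothing[OF D v]) (use v in \<open>simp_all add: splus_def\<close>)
  have sminusinf: "num_circles Dinf (sminus Dinf) = num_circles Dp (sminus Dp)"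
    unfolding assms(4) by (rule num_circles_smoothing[OF D v]) (use v in \<open>simp_all add: sminus_def\<close>)
  have splusinf: "num_circles Dinf (splus Dinf) = num_circles Dp ((splus Dp)(v := -1))"
    unfolding assms(4) by (rule num_circles_smoothing[OF D v]) (use v in \<open>simp_all add: splus_def\<close>)
  have sminus0: "num_circles D0 (sminus D0) = num_circles Dp ((sminus Dp)(v := 1))"
    unfolding assms(3) by (rule num_circles_smoothing[OF D v]) (use v in \<open>simp_all add: sminus_def\<close>)
  have k: "k1_inf + 1/2 * (num_circles Dinf (splus Dinf) - num_circles Dp (splus Dp) + 1) \<le> k1_p" "k1_0 \<le> k1_p"
    "k2_inf \<le> k2_p" "k2_0 + 1/2 * (num_circles D0 (sminus D0) - num_circles Dp (sminus Dp) + 1) \<le> k2_p"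
    unfolding assms(7,8) by simp_all
  have "H_thick Dp k1_p k2_p"
    unfolding H_thick_def
  proof (intro allI impI)
    fix i j :: int
    assume out: "\<not> (real (card (crossings Dp)) - 2 * num_circles Dp (sminus Dp) - 4 * k2_p \<le> real_of_int j - 2 * real_of_int i \<and>
        real_of_int j - 2 * real_of_int i \<le> 2 * num_circles Dp (splus Dp) - real (card (crossings Dp)) + 4 * k1_p)"
    \<comment> \<open>With one crossing less and j - 2i raised by 1, the upper bound keeps
      \<open>k1_0\<close>, as \<open>D0\<close> and \<open>Dp\<close> have equally many circles for
      all markers positive; the lower bound moves by 2 and by the change in the number of
      circles.\<close>
    have "\<not> (real (card (crossings D0)) - 2 * num_circles D0 (sminus D0) - 4 * k2_0 \<le> real_of_int (j - 1) - 2 * real_of_int (i - 1) \<and>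
        real_of_int (j - 1) - 2 * real_of_int (i - 1) \<le> 2 * num_circles D0 (splus D0) - real (card (crossings D0)) + 4 * k1_0)"
      using out k splus0 card[of 1, folded assms(3)] by (simp; argo)
    then have h0: "trivial_group (homology D0 (i - 1) (j - 1))" using assms(6) unfolding H_thick_def by blast
    \<comment> \<open>The mirror situation: j - 2i is lowered by 1, so the lower bound is the one
      that keeps its parameter.\<close>
    have "\<not> (real (card (crossings Dinf)) - 2 * num_circles Dinf (sminus Dinf) - 4 * k2_inf \<le> real_of_int (j + 1) - 2 * real_of_int (i + 1) \<and>
        real_of_int (j + 1) - 2 * real_of_int (i + 1) \<le> 2 * num_circles Dinf (splus Dinf) - real (card (crossings Dinf)) + 4 * k1_inf)"
      using out k sminusinf card[of "-1", folded assms(4)] by (simp; argo)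
    then have hinf: "trivial_group (homology Dinf (i + 1) (j + 1))" using assms(5) unfolding H_thick_def by blast
    show "trivial_group (homology Dp i j)"
      by (rule trivial_homology_of_smoothings[OF D e v h0[unfolded assms(3)] hinf[unfolded assms(4)]])
  qed
  moreover have "num_circles Dp (splus Dp) - num_circles Dinf (splus Dinf) = 1" if "plus_adequate Dp"
    unfolding splusinf
    by (rule adequate_switch[OF D e v that[unfolded plus_adequate_def]]) (use v in \<open>simp_all add: splus_def\<close>)
  moreover have "num_circles Dp (sminus Dp) - num_circles D0 (sminus D0) = 1" if "minus_adequate Dp"
    unfolding sminus0
    by (rule adequate_switch[OF D e v that[unfolded minus_adequate_def]]) (use v in \<open>simp_all add: sminus_def\<close>)
  moreover have "k1_p = max k1_inf k1_0" if "num_circles Dp (splus Dp) - num_circles Dinf (splus Dinf) = 1"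
  proof -
    have z: "num_circles Dinf (splus Dinf) - num_circles Dp (splus Dp) + 1 = 0" using that by simp
    show ?thesis unfolding assms(7) z by simp
  qed
  moreover have "k2_p = max k2_inf k2_0" if "num_circles Dp (sminus Dp) - num_circles D0 (sminus D0) = 1"
  proof -
    have z: "num_circles D0 (sminus D0) - num_circles Dp (sminus Dp) + 1 = 0" using that by simp
    show ?thesis unfolding assms(8) z by simp
  qed
  ultimately show ?thesis by blast
qed

end
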